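(* (Hyperbolic case.) The gravitational field created by a spherical shell in the hyperbolic space $\mathbb{H}^n$ equals zero in the region bounded by the shell. Outside of the shell, it is the same as the field created by the total mass of the shell concentrated at the center. (Spherical case.) In the spherical space $\mathbb{S}^n$, a spherical shell exerts no force in the smaller of the two regions bounded by it, as well as inside the antipodal region. Between the shell and its antipode, the field is the same as the one created by the total mass of the spherical shell concentrated at the center.
   Context: Here $n\ge 2$, and $\mathbb{S}^n$, $\mathbb{H}^n$ are the unit sphere and the hyperbolic space of curvature $-1$. Law of attraction: the attraction between two points at distance $r$ in $\mathbb{S}^n$ (respectively $\mathbb{H}^n$) is inversely proportional to $\sin^{n-1}r$ (respectively $\sinh^{n-1}r$), proportional to the masses, and directed along the geodesic (the shortest one, in the spherical case) connecting the points. Equivalently, a unit point mass has potential $u(r)=\int_r^{\pi/2}\frac{dx}{\sin^{n-1}x}$ in $\mathbb{S}^n$ and $u(r)=\int_r^{\infty}\frac{dx}{\sinh^{n-1}x}$ in $\mathbb{H}^n$. The field of a body is the integral of the fields of its points with respect to the mass density. A spherical shell with center $c$ is the region $\{x : r_1\le \mathrm{dist}(x,c)\le r_2\}$ between two concentric geodesic spheres, with constant mass density. In the hyperbolic case the region bounded by the shell is $\{\mathrm{dist}(x,c)<r_1\}$ and its outside is $\{\mathrm{dist}(x,c)>r_2\}$. In the spherical case take $r_2<\pi/2$; then the smaller region is $\{\mathrm{dist}(x,c)<r_1\}$, the antipodal region is $\{\mathrm{dist}(x,-c)<r_1\}$, and the part between the shell and its antipode is $\{r_2<\mathrm{dist}(x,c)<\pi-r_2\}$.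 *)

theory Defs
  imports "HOL-Analysis.Analysis"
begin

text \<open>
  Both spaces are realised as hypersurfaces of \<^typ>\<open>'a \<times> real\<close>, where \<open>DIM('a) = n\<close>: the
  spherical space as the Euclidean unit sphere \<^term>\<open>sphere 0 1\<close>, the hyperbolic space as the
  upper sheet of the unit hyperboloid for the Lorentz form. Tangent vectors at a point are
  vectors of the ambient space, so force fields take their values there.
\<close>

subsection \<open>Spherical space\<close>

definition sph_dist :: "'a::euclidean_space \<times> real \<Rightarrow> 'a \<times> real \<Rightarrow> real" where
  "sph_dist x y = arccos (x \<bullet> y)"

text \<open>
  Riemannian volume. The position vector of a point of the sphere is a unit normal, so in
  coordinates \<open>X = s \<xi>\<close>, with \<open>\<xi>\<close> on the sphere and \<open>s > 0\<close>, Lebesgue measure is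
  \<open>s\<^sup>n ds dvol(\<xi>)\<close>. Hence the volume of \<open>A\<close> is \<open>n + 1\<close> times the Lebesgue measure of the cone
  \<open>{s \<xi> | 0 < s \<le> 1, \<xi> \<in> A}\<close>.
\<close>

definition sph_volume :: "('a::euclidean_space \<times> real) measure" where
  "sph_volume =
     distr (density lborel
             (\<lambda>X. ennreal (real (DIM('a) + 1)) * indicator {X. 0 < norm X \<and> norm X \<le> 1} X))
           borel (\<lambda>X. X /\<^sub>R norm X)"

text \<open>
  Force at \<open>p\<close> due to a unit mass at \<open>x\<close>. The unit speed geodesic from \<open>p\<close> with initial velocity
  \<open>v\<close> is \<open>cos s p + sin s v\<close>, so the shortest geodesic to a point \<open>x\<close> at distance \<open>r\<close> has initial
  velocity \<open>(x - cos r p) / sin r\<close>. For \<open>x = p\<close> and \<open>x = - p\<close>, where no direction is determined,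
  division by zero gives the value 0.
\<close>

definition sph_attraction ::
    "'a::euclidean_space \<times> real \<Rightarrow> 'a \<times> real \<Rightarrow> 'a \<times> real" where
  "sph_attraction p x =
     (let r = sph_dist p x
      in (1 / sin r ^ (DIM('a) - 1)) *\<^sub>R ((x - cos r *\<^sub>R p) /\<^sub>R sin r))"

text \<open>A body is given by its mass distribution, a measure on the ambient space.\<close>

definition sph_field ::
    "('a::euclidean_space \<times> real) measure \<Rightarrow> 'a \<times> real \<Rightarrow> 'a \<times> real" where
  "sph_field M p = (\<integral>x. sph_attraction p x \<partial>M)"

definition sph_shell ::
    "real \<Rightarrow> real \<Rightarrow> real \<Rightarrow> 'a::euclidean_space \<times> real \<Rightarrow> ('a \<times> real) measure" where
  "sph_shell \<rho> r1 r2 c =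
     density sph_volume
       (\<lambda>x. ennreal \<rho> * indicator {x \<in> sphere 0 1. r1 \<le> sph_dist x c \<and> sph_dist x c \<le> r2} x)"

subsection \<open>Hyperbolic space\<close>

definition lorentz :: "'a::euclidean_space \<times> real \<Rightarrow> 'a \<times> real \<Rightarrow> real" where
  "lorentz x y = fst x \<bullet> fst y - snd x * snd y"

definition hyp_space :: "('a::euclidean_space \<times> real) set" where
  "hyp_space = {x. lorentz x x = -1 \<and> 0 < snd x}"

definition hyp_dist :: "'a::euclidean_space \<times> real \<Rightarrow> 'a \<times> real \<Rightarrow> real" where
  "hyp_dist x y = arcosh (- lorentz x y)"

text \<open>
  Riemannian volume, by the same cone formula: the position vector is a Lorentz unit normal, and
  Lebesgue measure is the volume of the Lorentz form, so it is \<open>s\<^sup>n ds dvol(\<xi>)\<close> in the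
  coordinates \<open>X = s \<xi>\<close>, \<open>\<xi>\<close> in hyperbolic space, of the open future cone.
\<close>

definition hyp_volume :: "('a::euclidean_space \<times> real) measure" where
  "hyp_volume =
     distr (density lborel
             (\<lambda>X. ennreal (real (DIM('a) + 1)) *
                  indicator {X. 0 < snd X \<and> 0 < - lorentz X X \<and> - lorentz X X \<le> 1} X))
           borel (\<lambda>X. X /\<^sub>R sqrt (- lorentz X X))"

text \<open>The unit speed geodesics from \<open>p\<close> are \<open>cosh s p + sinh s v\<close>.\<close>

definition hyp_attraction ::
    "'a::euclidean_space \<times> real \<Rightarrow> 'a \<times> real \<Rightarrow> 'a \<times> real" where
  "hyp_attraction p x =
     (let r = hyp_dist p x
      in (1 / sinh r ^ (DIM('a) - 1)) *\<^sub>R ((x - cosh r *\<^sub>R p) /\<^sub>R sinh r))"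

definition hyp_field ::
    "('a::euclidean_space \<times> real) measure \<Rightarrow> 'a \<times> real \<Rightarrow> 'a \<times> real" where
  "hyp_field M p = (\<integral>x. hyp_attraction p x \<partial>M)"

definition hyp_shell ::
    "real \<Rightarrow> real \<Rightarrow> real \<Rightarrow> 'a::euclidean_space \<times> real \<Rightarrow> ('a \<times> real) measure" where
  "hyp_shell \<rho> r1 r2 c =
     density hyp_volume
       (\<lambda>x. ennreal \<rho> * indicator {x \<in> hyp_space. r1 \<le> hyp_dist x c \<and> hyp_dist x c \<le> r2} x)"

end

theory Submission
  imports Defs
begin

text \<open>
  Put \<open>\<langle>x, y\<rangle> = snd x * snd y + \<kappa> * (fst x \<bullet> fst y)\<close>, so that both spaces are given by \<open>\<langle>x, x\<rangle> = 1\<close> with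
  \<open>\<kappa> = 1\<close> or \<open>\<kappa> = - 1\<close>, and a shell becomes a cone cut off at \<open>\<langle>x, x\<rangle> \<le> 1\<close>. Split a point of the
  cone into components \<open>\<beta>\<close> along \<open>p\<close>, \<open>\<alpha>\<close> along the direction \<open>e\<close> from \<open>p\<close> to \<open>c\<close>, and a rest of
  length \<open>t\<close>. The field at \<open>p\<close> is directed along \<open>e\<close>, because reflections fixing \<open>p\<close> and \<open>c\<close>
  preserve the cone. In the direction given by \<open>\<tau> = t / \<bar>\<alpha>\<bar>\<close> the inverse power law cancels the
  volume factor, and what remains is the integral over a half plane through \<open>p\<close> of a function that
  depends only on the norm and on the product with the projection \<open>c'\<close> of \<open>c\<close> to that plane.

  If \<open>p\<close> lies inside the shell, the reflection of the plane that fixes \<open>c'\<close> exchanges the two half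
  planes, so opposite directions cancel. If \<open>p\<close> lies outside, only the half plane towards \<open>c\<close>
  contributes, and the integral depends only on \<open>\<langle>c', c'\<rangle> = (1 + C\<^sup>2 \<tau>\<^sup>2) / (1 + \<tau>\<^sup>2)\<close> with
  \<open>C = \<langle>c, p\<rangle>\<close>. Slicing the mass of the shell by planes parallel to the plane of \<open>p\<close> and \<open>c\<close> gives
  the same integrals, up to a projective substitution in \<open>\<tau>\<close> that produces the factor \<open>S\<^sup>n\<^sup>-\<^sup>1\<close>,
  where \<open>S\<close> is the sine or hyperbolic sine of the distance from \<open>p\<close> to \<open>c\<close>.
\<close>

section \<open>Averaging integrals over translations and dilations\<close>

lemma nn_integral_lborel_translate:
  fixes c :: "'b::euclidean_space"
  assumes [measurable]: "g \<in> borel_measurable borel"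
  shows "(\<integral>\<^sup>+x. g (c + x) \<partial>lborel) = (\<integral>\<^sup>+x. g x \<partial>lborel)"
proof -
  have "(\<integral>\<^sup>+x. g x \<partial>lborel) = (\<integral>\<^sup>+x. g x \<partial>distr lborel borel ((+) c))"
    by (simp add: lborel_distr_plus)
  also have "\<dots> = (\<integral>\<^sup>+x. g (c + x) \<partial>lborel)"
    by (subst nn_integral_distr) simp_all
  finally show ?thesis by simp
qed

lemma nn_integral_lborel_scale:
  fixes g :: "'b::euclidean_space \<Rightarrow> ennreal"
  assumes [measurable]: "g \<in> borel_measurable borel" and "t \<noteq> 0"
  shows "(\<integral>\<^sup>+x. g x \<partial>lborel) = ennreal (\<bar>t\<bar> ^ DIM('b)) * (\<integral>\<^sup>+x. g (t *\<^sub>R x) \<partial>lborel)"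
proof -
  have "(\<integral>\<^sup>+x. g x \<partial>lborel) =
      (\<integral>\<^sup>+x. g x \<partial>density (distr lborel borel (\<lambda>x::'b. 0 + t *\<^sub>R x)) (\<lambda>_. \<bar>t\<bar>^DIM('b)))"
    using lborel_affine[OF assms(2), of "0::'b"] by simp
  also have "\<dots> = ennreal (\<bar>t\<bar> ^ DIM('b)) * (\<integral>\<^sup>+x. g (t *\<^sub>R x) \<partial>lborel)"
    by (simp add: nn_integral_density nn_integral_distr nn_integral_cmult)
  finally show ?thesis .
qed

lemma nn_integral_lborel_Fubini:
  fixes f :: "'b::euclidean_space \<Rightarrow> 'c::euclidean_space \<Rightarrow> ennreal"
  assumes "(\<lambda>(x, y). f x y) \<in> borel_measurable (lborel \<Otimes>\<^sub>M lborel)"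
  shows "(\<integral>\<^sup>+x. \<integral>\<^sup>+y. f x y \<partial>lborel \<partial>lborel) = (\<integral>\<^sup>+y. \<integral>\<^sup>+x. f x y \<partial>lborel \<partial>lborel)"
  using lborel_pair.Fubini'[OF assms] by simp

text \<open>Insert 1, written as the integral over \<open>t\<close> of the indicator of
  \<open>{0..1}\<close> at \<open>a x - t\<close>, exchange the integrals and shift \<open>x\<close>
  by \<open>t *\<^sub>R e\<close>. This integrates along the lines parallel to \<open>e\<close>
  without splitting the space into a product.\<close>

lemma nn_integral_slab:
  fixes e :: "'b::euclidean_space" and a :: "'b \<Rightarrow> real"
  assumes [measurable]: "a \<in> borel_measurable borel" "g \<in> borel_measurable borel"
    and a: "\<And>x t. a (x + t *\<^sub>R e) = a x + t"
  shows "(\<integral>\<^sup>+x. g x \<partial>lborel) = (\<integral>\<^sup>+x. indicator {0..1} (a x) * (\<integral>\<^sup>+t. g (x + t *\<^sub>R e) \<partial>lborel) \<partial>lborel)"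
proof -
  have 1: "(\<integral>\<^sup>+t. indicator {0..1::real} (a x - t) \<partial>lborel) = (1::ennreal)" for x
  proof -
    have "(\<integral>\<^sup>+t. indicator {0..1::real} (a x - t) \<partial>lborel) =
        (\<integral>\<^sup>+t. indicator {a x - 1..a x} t \<partial>lborel)"
      by (intro nn_integral_cong) (auto split: split_indicator)
    then show ?thesis by simp
  qed
  have "(\<integral>\<^sup>+x. g x \<partial>lborel) = (\<integral>\<^sup>+x. \<integral>\<^sup>+t. g x * indicator {0..1} (a x - t) \<partial>lborel \<partial>lborel)"
    by (simp add: nn_integral_cmult 1)
  also have "\<dots> = (\<integral>\<^sup>+t. \<integral>\<^sup>+x. g x * indicator {0..1} (a x - t) \<partial>lborel \<partial>lborel)"
    by (intro nn_integral_lborel_Fubini) measurable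
  also have "\<dots> = (\<integral>\<^sup>+t. \<integral>\<^sup>+x. g (x + t *\<^sub>R e) * indicator {0..1} (a x) \<partial>lborel \<partial>lborel)"
  proof (rule nn_integral_cong)
    fix t :: real
    have "(\<integral>\<^sup>+x. g x * indicator {0..1} (a x - t) \<partial>lborel) =
        (\<integral>\<^sup>+x. g (t *\<^sub>R e + x) * indicator {0..1} (a (t *\<^sub>R e + x) - t) \<partial>lborel)"
      by (subst nn_integral_lborel_translate[of "\<lambda>x. g x * indicator {0..1} (a x - t)" "t *\<^sub>R e"]) auto
    then show "(\<integral>\<^sup>+x. g x * indicator {0..1} (a x - t) \<partial>lborel) =
        (\<integral>\<^sup>+x. g (x + t *\<^sub>R e) * indicator {0..1} (a x) \<partial>lborel)"
      by (simp add: a add.commute[of "t *\<^sub>R e"])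
  qed
  also have "\<dots> = (\<integral>\<^sup>+x. \<integral>\<^sup>+t. g (x + t *\<^sub>R e) * indicator {0..1} (a x) \<partial>lborel \<partial>lborel)"
    by (intro nn_integral_lborel_Fubini) measurable
  also have "\<dots> = (\<integral>\<^sup>+x. indicator {0..1} (a x) * (\<integral>\<^sup>+t. g (x + t *\<^sub>R e) \<partial>lborel) \<partial>lborel)"
    by (simp add: nn_integral_cmult[symmetric] mult.commute)
  finally show ?thesis .
qed

text \<open>On every line parallel to \<open>d\<close> the map is an inversion
  \<open>t \<mapsto> const - t\<close> of the parameter, which preserves length. Slabs with
  \<open>a x = l \<bullet> x\<close> reduce the claim to these lines.\<close>

lemma nn_integral_reflection:
  fixes d :: "'b::euclidean_space"
  assumes [measurable]: "g \<in> borel_measurable borel" and l: "l \<bullet> d = 1"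
  shows "(\<integral>\<^sup>+x. g (x - (2 * (l \<bullet> x)) *\<^sub>R d) \<partial>lborel) = (\<integral>\<^sup>+x. g x \<partial>lborel)"
proof -
  have eq: "x + t *\<^sub>R d - (2 * (l \<bullet> (x + t *\<^sub>R d))) *\<^sub>R d = x + (- 2 * (l \<bullet> x) + (- 1) * t) *\<^sub>R d" for x t
  proof -
    have "x + t *\<^sub>R d - (2 * (l \<bullet> (x + t *\<^sub>R d))) *\<^sub>R d = x + (t - 2 * (l \<bullet> (x + t *\<^sub>R d))) *\<^sub>R d"
      by (simp add: scaleR_left_diff_distrib)
    also have "t - 2 * (l \<bullet> (x + t *\<^sub>R d)) = - 2 * (l \<bullet> x) + (- 1) * t"
      by (simp add: inner_simps l)
    finally show ?thesis .
  qed
  have "(\<integral>\<^sup>+x. g (x - (2 * (l \<bullet> x)) *\<^sub>R d) \<partial>lborel) =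
      (\<integral>\<^sup>+x. indicator {0..1} (l \<bullet> x) *
        (\<integral>\<^sup>+t. g (x + t *\<^sub>R d - (2 * (l \<bullet> (x + t *\<^sub>R d))) *\<^sub>R d) \<partial>lborel) \<partial>lborel)"
    by (rule nn_integral_slab) (auto simp: inner_simps l)
  also have "\<dots> = (\<integral>\<^sup>+x. indicator {0..1} (l \<bullet> x) *
        (\<integral>\<^sup>+t. g (x + (- 2 * (l \<bullet> x) + (- 1) * t) *\<^sub>R d) \<partial>lborel) \<partial>lborel)"
    by (simp only: eq)
  also have "\<dots> = (\<integral>\<^sup>+x. indicator {0..1} (l \<bullet> x) * (\<integral>\<^sup>+t. g (x + t *\<^sub>R d) \<partial>lborel) \<partial>lborel)"
    using nn_integral_real_affine[of "\<lambda>t. g (_ + t *\<^sub>R d)" "- 1"] by simp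
  also have "\<dots> = (\<integral>\<^sup>+x. g x \<partial>lborel)"
    by (rule nn_integral_slab[symmetric]) (auto simp: inner_simps l)
  finally show ?thesis .
qed

lemma nn_integral_inverse_square_tail:
  assumes "0 < (s::real)"
  shows "(\<integral>\<^sup>+t. ennreal (s / t\<^sup>2) * indicator {s..} t \<partial>lborel) = 1"
proof -
  have "DERIV (\<lambda>t. - s / t) t :> s / t\<^sup>2" if "s \<le> t" for t
    using assms that by (auto intro!: derivative_eq_intros simp: power2_eq_square)
  moreover have "((\<lambda>t. - s / t) \<longlongrightarrow> 0) at_top"
    by (intro tendsto_divide_0[OF tendsto_const] filterlim_at_top_imp_at_infinity filterlim_ident)
  ultimately show ?thesis
    using nn_integral_FTC_atLeast[of "\<lambda>t. s / t\<^sup>2" s "\<lambda>t. - s / t" 0] assms by simp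
qed

text \<open>Insert \<open>1 = \<integral>\<^sub>s\<^sup>\<infinity> s / t\<^sup>2 dt\<close> with \<open>s = s x\<close> and substitute \<open>x \<mapsto> t x\<close>.\<close>

lemma nn_integral_scaling_average:
  fixes g :: "'b::euclidean_space \<Rightarrow> ennreal" and s :: "'b \<Rightarrow> real"
  assumes [measurable]: "g \<in> borel_measurable borel" "s \<in> borel_measurable borel"
    and pos: "AE x in lborel. 0 < s x"
    and hom: "\<And>x t. 0 < t \<Longrightarrow> s (t *\<^sub>R x) = t * s x"
  shows "(\<integral>\<^sup>+x. g x \<partial>lborel) =
    (\<integral>\<^sup>+t. ennreal (t ^ (DIM('b) - 1)) * indicator {0<..} t *
       (\<integral>\<^sup>+x. ennreal (s x) * indicator {0<..1} (s x) * g (t *\<^sub>R x) \<partial>lborel) \<partial>lborel)"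
proof -
  have "(\<integral>\<^sup>+x. g x \<partial>lborel) = (\<integral>\<^sup>+x. \<integral>\<^sup>+t. g x * (ennreal (s x / t\<^sup>2) * of_bool (0 < s x \<and> s x \<le> t)) \<partial>lborel \<partial>lborel)"
  proof (rule nn_integral_cong_AE, use pos in eventually_elim)
    fix x assume s: "0 < s x"
    have "(\<integral>\<^sup>+t. g x * (ennreal (s x / t\<^sup>2) * of_bool (0 < s x \<and> s x \<le> t)) \<partial>lborel) =
        g x * (\<integral>\<^sup>+t. ennreal (s x / t\<^sup>2) * indicator {s x..} t \<partial>lborel)"
      by (subst nn_integral_cmult[symmetric]) (use s in \<open>auto intro!: nn_integral_cong split: split_indicator\<close>)
    then show "g x = (\<integral>\<^sup>+t. g x * (ennreal (s x / t\<^sup>2) * of_bool (0 < s x \<and> s x \<le> t)) \<partial>lborel)"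
      using nn_integral_inverse_square_tail[OF s] by simp
  qed
  also have "\<dots> = (\<integral>\<^sup>+t. \<integral>\<^sup>+x. g x * (ennreal (s x / t\<^sup>2) * of_bool (0 < s x \<and> s x \<le> t)) \<partial>lborel \<partial>lborel)"
    by (intro nn_integral_lborel_Fubini) measurable
  also have "\<dots> = (\<integral>\<^sup>+t. ennreal (t ^ (DIM('b) - 1)) * indicator {0<..} t *
       (\<integral>\<^sup>+x. ennreal (s x) * indicator {0<..1} (s x) * g (t *\<^sub>R x) \<partial>lborel) \<partial>lborel)"
  proof (rule nn_integral_cong)
    fix t :: real
    show "(\<integral>\<^sup>+x. g x * (ennreal (s x / t\<^sup>2) * of_bool (0 < s x \<and> s x \<le> t)) \<partial>lborel) =
      ennreal (t ^ (DIM('b) - 1)) * indicator {0<..} t *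
       (\<integral>\<^sup>+x. ennreal (s x) * indicator {0<..1} (s x) * g (t *\<^sub>R x) \<partial>lborel)"
    proof (cases "0 < t")
      case True
      have "(\<integral>\<^sup>+x. g x * (ennreal (s x / t\<^sup>2) * of_bool (0 < s x \<and> s x \<le> t)) \<partial>lborel) =
        ennreal (t ^ DIM('b)) * (\<integral>\<^sup>+x. g (t *\<^sub>R x) * (ennreal (t * s x / t\<^sup>2) * of_bool (0 < t * s x \<and> t * s x \<le> t)) \<partial>lborel)"
        by (subst nn_integral_lborel_scale[of _ t]) (use True in \<open>auto simp: hom\<close>)
      also have "(\<integral>\<^sup>+x. g (t *\<^sub>R x) * (ennreal (t * s x / t\<^sup>2) * of_bool (0 < t * s x \<and> t * s x \<le> t)) \<partial>lborel)
         = (\<integral>\<^sup>+x. ennreal (1 / t) * (ennreal (s x) * indicator {0<..1} (s x) * g (t *\<^sub>R x)) \<partial>lborel)"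
      proof (rule nn_integral_cong)
        fix x
        show "g (t *\<^sub>R x) * (ennreal (t * s x / t\<^sup>2) * of_bool (0 < t * s x \<and> t * s x \<le> t)) =
          ennreal (1 / t) * (ennreal (s x) * indicator {0<..1} (s x) * g (t *\<^sub>R x))"
        proof (cases "0 < s x \<and> s x \<le> 1")
          case in01: True
          then have "t * s x / t\<^sup>2 = (1 / t) * s x" using True by (simp add: power2_eq_square)
          then have "ennreal (t * s x / t\<^sup>2) = ennreal (1 / t) * ennreal (s x)"
            using True in01 by (simp add: ennreal_mult del: times_divide_eq_left)
          moreover have "0 < t * s x" "t * s x \<le> t" using True in01 by auto
          ultimately show ?thesis using in01 by (simp add: mult_ac)
        next
          case False
          then show ?thesis using True by (auto simp: zero_less_mult_iff split: split_indicator)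
        qed
      qed
      also have "\<dots> = ennreal (1 / t) * (\<integral>\<^sup>+x. ennreal (s x) * indicator {0<..1} (s x) * g (t *\<^sub>R x) \<partial>lborel)"
        by (subst nn_integral_cmult) auto
      also have "ennreal (t ^ DIM('b)) * \<dots> = ennreal (t ^ DIM('b) * (1 / t)) *
          (\<integral>\<^sup>+x. ennreal (s x) * indicator {0<..1} (s x) * g (t *\<^sub>R x) \<partial>lborel)"
        by (subst ennreal_mult) (use True in \<open>auto simp: mult.assoc\<close>)
      also have "t ^ DIM('b) * (1 / t) = t ^ (DIM('b) - 1)"
        using True by (simp add: power_diff)
      finally show ?thesis using True by simp
    next
      case False
      then have "of_bool (0 < s x \<and> s x \<le> t) = (0::ennreal)" for x by simp
      then show ?thesis using False by (simp only:) simp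
    qed
  qed
  finally show ?thesis .
qed

lemma nn_integral_radial_scale:
  fixes g :: "real \<Rightarrow> ennreal"
  assumes [measurable]: "g \<in> borel_measurable borel" and q: "0 < q"
  shows "(\<integral>\<^sup>+t. ennreal (t ^ m) * indicator {0<..} t * g t \<partial>lborel) =
    ennreal (q ^ (m + 1)) * (\<integral>\<^sup>+t. ennreal (t ^ m) * indicator {0<..} t * g (q * t) \<partial>lborel)"
proof -
  have "(\<integral>\<^sup>+t. ennreal (t ^ m) * indicator {0<..} t * g t \<partial>lborel) =
     ennreal q * (\<integral>\<^sup>+t. ennreal ((q * t) ^ m) * indicator {0<..} (q * t) * g (q * t) \<partial>lborel)"
    using q nn_integral_real_affine[of "\<lambda>t. ennreal (t ^ m) * indicator {0<..} t * g t" q 0] by simp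
  also have "(\<integral>\<^sup>+t. ennreal ((q * t) ^ m) * indicator {0<..} (q * t) * g (q * t) \<partial>lborel) =
    (\<integral>\<^sup>+t. ennreal (q ^ m) * (ennreal (t ^ m) * indicator {0<..} t * g (q * t)) \<partial>lborel)"
    using q by (intro nn_integral_cong)
      (auto simp: power_mult_distrib ennreal_mult zero_less_mult_iff mult_ac split: split_indicator)
  also have "\<dots> = ennreal (q ^ m) * (\<integral>\<^sup>+t. ennreal (t ^ m) * indicator {0<..} t * g (q * t) \<partial>lborel)"
    by (simp add: nn_integral_cmult)
  finally show ?thesis using q by (simp add: ennreal_mult mult.assoc)
qed

text \<open>
  The constant \<open>K\<close> plays the role of the area of the unit sphere transverse to \<open>e\<close> and \<open>f\<close>. Its value
  is irrelevant, and even its finiteness, since the two integrals to be compared carry the same \<open>K\<close>.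
\<close>

lemma nn_integral_cylindrical:
  fixes e f :: "'b::euclidean_space" and s a b :: "'b \<Rightarrow> real"
  assumes [measurable]: "s \<in> borel_measurable borel" "a \<in> borel_measurable borel" "b \<in> borel_measurable borel"
    and dim: "DIM('b) = m + 3"
    and pos: "AE x in lborel. 0 < s x"
    and hom: "\<And>x t. 0 < t \<Longrightarrow> s (t *\<^sub>R x) = t * s x" "\<And>x t. a (t *\<^sub>R x) = t * a x" "\<And>x t. b (t *\<^sub>R x) = t * b x"
    and e: "\<And>x t. s (x + t *\<^sub>R e) = s x" "\<And>x t. a (x + t *\<^sub>R e) = a x + t" "\<And>x t. b (x + t *\<^sub>R e) = b x"
    and f: "\<And>x t. s (x + t *\<^sub>R f) = s x" "\<And>x t. a (x + t *\<^sub>R f) = a x" "\<And>x t. b (x + t *\<^sub>R f) = b x + t"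
  obtains K :: ennreal where
    "\<And>\<gamma> :: real \<times> real \<times> real \<Rightarrow> ennreal. \<gamma> \<in> borel_measurable borel \<Longrightarrow>
      (\<integral>\<^sup>+x. \<gamma> (s x, a x, b x) \<partial>lborel) =
       K * (\<integral>\<^sup>+t. ennreal (t ^ m) * indicator {0<..} t * (\<integral>\<^sup>+\<alpha>. \<integral>\<^sup>+\<beta>. \<gamma> (t, \<alpha>, \<beta>) \<partial>lborel \<partial>lborel) \<partial>lborel)"
proof -
  \<comment> \<open>The weight that the averagings leave behind: translations along \<open>e\<close>
    and \<open>f\<close> confine \<open>a\<close> and \<open>b\<close> to unit intervals, and
    dilations contribute the factor \<open>s x\<close> with \<open>s x\<close> in
    \<open>{0<..1}\<close>.\<close>
  define w where "w x = indicator {0..1} (a x) * indicator {0..1} (b x) * (ennreal (s x) * indicator {0<..1} (s x))" for x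
  have [measurable]: "w \<in> borel_measurable borel" unfolding w_def by measurable
  define K where "K = (\<integral>\<^sup>+x. w x * ennreal (1 / s x ^ (m + 1)) \<partial>lborel)"
  have plane: "(\<integral>\<^sup>+x. g (s x, a x, b x) \<partial>lborel) = (\<integral>\<^sup>+x. indicator {0..1} (a x) * indicator {0..1} (b x) *
      (\<integral>\<^sup>+\<alpha>. \<integral>\<^sup>+\<beta>. g (s x, \<alpha>, \<beta>) \<partial>lborel \<partial>lborel) \<partial>lborel)"
    if [measurable]: "g \<in> borel_measurable borel" for g :: "real \<times> real \<times> real \<Rightarrow> ennreal"
  proof -
    have 1: "(\<integral>\<^sup>+t. g (u, v, w + t) \<partial>lborel) = (\<integral>\<^sup>+t. g (u, v, t) \<partial>lborel)" for u v w
      by (rule nn_integral_lborel_translate[of "\<lambda>t. g (u, v, t)"]) measurable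
    have 2: "(\<integral>\<^sup>+t. (\<integral>\<^sup>+\<beta>. g (u, w + t, \<beta>) \<partial>lborel) \<partial>lborel) = (\<integral>\<^sup>+t. (\<integral>\<^sup>+\<beta>. g (u, t, \<beta>) \<partial>lborel) \<partial>lborel)" for u w
      by (rule nn_integral_lborel_translate[of "\<lambda>t. \<integral>\<^sup>+\<beta>. g (u, t, \<beta>) \<partial>lborel"]) measurable
    have "(\<integral>\<^sup>+x. g (s x, a x, b x) \<partial>lborel) =
        (\<integral>\<^sup>+x. indicator {0..1} (b x) * (\<integral>\<^sup>+t. g (s x, a x, t) \<partial>lborel) \<partial>lborel)"
      by (subst nn_integral_slab[of b _ f])
        (auto simp: f 1)
    also have "\<dots> = (\<integral>\<^sup>+x. indicator {0..1} (a x) * (indicator {0..1} (b x) *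
        (\<integral>\<^sup>+\<alpha>. \<integral>\<^sup>+\<beta>. g (s x, \<alpha>, \<beta>) \<partial>lborel \<partial>lborel)) \<partial>lborel)"
      by (subst nn_integral_slab[of a _ e])
        (auto simp: e nn_integral_cmult 2)
    finally show ?thesis by (simp add: mult.assoc)
  qed
  show thesis
  proof (rule that[of K])
    fix \<gamma> :: "real \<times> real \<times> real \<Rightarrow> ennreal" assume [measurable]: "\<gamma> \<in> borel_measurable borel"
    define \<Gamma> where "\<Gamma> t = (\<integral>\<^sup>+\<alpha>. \<integral>\<^sup>+\<beta>. \<gamma> (t, \<alpha>, \<beta>) \<partial>lborel \<partial>lborel)" for t
    have [measurable]: "\<Gamma> \<in> borel_measurable borel" unfolding \<Gamma>_def by measurable
    have scale: "(\<integral>\<^sup>+\<alpha>. \<integral>\<^sup>+\<beta>. \<gamma> (t * u, t * \<alpha>, t * \<beta>) \<partial>lborel \<partial>lborel) = ennreal (1 / t\<^sup>2) * \<Gamma> (t * u)"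
      if "0 < t" for t u
    proof -
      have "\<Gamma> (t * u) = ennreal t * (\<integral>\<^sup>+\<alpha>. ennreal t * (\<integral>\<^sup>+\<beta>. \<gamma> (t * u, t * \<alpha>, t * \<beta>) \<partial>lborel) \<partial>lborel)"
        unfolding \<Gamma>_def using that
        nn_integral_real_affine[of "\<lambda>\<beta>. \<gamma> (t * u, _, \<beta>)" t 0]
        nn_integral_real_affine[of "\<lambda>\<alpha>. \<integral>\<^sup>+\<beta>. \<gamma> (t * u, \<alpha>, \<beta>) \<partial>lborel" t 0]
        by simp
      also have "\<dots> = ennreal (t\<^sup>2) * (\<integral>\<^sup>+\<alpha>. \<integral>\<^sup>+\<beta>. \<gamma> (t * u, t * \<alpha>, t * \<beta>) \<partial>lborel \<partial>lborel)"
        using that by (simp add: nn_integral_cmult power2_eq_square ennreal_mult mult.assoc)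
      finally have "ennreal (1 / t\<^sup>2) * \<Gamma> (t * u) =
          ennreal (1 / t\<^sup>2 * t\<^sup>2) * (\<integral>\<^sup>+\<alpha>. \<integral>\<^sup>+\<beta>. \<gamma> (t * u, t * \<alpha>, t * \<beta>) \<partial>lborel \<partial>lborel)"
        by (simp only: ennreal_mult mult.assoc zero_le_power2 zero_le_divide_1_iff)
      then show ?thesis using that by simp
    qed
    have inner: "(\<integral>\<^sup>+x. ennreal (s x) * indicator {0<..1} (s x) * \<gamma> (s (t *\<^sub>R x), a (t *\<^sub>R x), b (t *\<^sub>R x)) \<partial>lborel)
       = ennreal (1 / t\<^sup>2) * (\<integral>\<^sup>+x. w x * \<Gamma> (t * s x) \<partial>lborel)" if t: "0 < t" for t
    proof -
      have "(\<integral>\<^sup>+x. ennreal (s x) * indicator {0<..1} (s x) * \<gamma> (s (t *\<^sub>R x), a (t *\<^sub>R x), b (t *\<^sub>R x)) \<partial>lborel)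
        = (\<integral>\<^sup>+x. indicator {0..1} (a x) * indicator {0..1} (b x) * (\<integral>\<^sup>+\<alpha>. \<integral>\<^sup>+\<beta>. ennreal (s x) * indicator {0<..1} (s x) *
            \<gamma> (t * s x, t * \<alpha>, t * \<beta>) \<partial>lborel \<partial>lborel) \<partial>lborel)"
      proof -
        have "(\<lambda>(u, \<alpha>, \<beta>). ennreal u * indicator {0<..1} u * \<gamma> (t * u, t * \<alpha>, t * \<beta>)) \<in> borel_measurable borel"
          unfolding borel_prod[symmetric] by measurable
        from plane[OF this] show ?thesis using t by (simp add: hom)
      qed
      also have "\<dots> = (\<integral>\<^sup>+x. w x * (\<integral>\<^sup>+\<alpha>. \<integral>\<^sup>+\<beta>. \<gamma> (t * s x, t * \<alpha>, t * \<beta>) \<partial>lborel \<partial>lborel) \<partial>lborel)"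
        by (simp add: w_def nn_integral_cmult mult_ac)
      also have "\<dots> = (\<integral>\<^sup>+x. ennreal (1 / t\<^sup>2) * (w x * \<Gamma> (t * s x)) \<partial>lborel)"
        by (simp only: scale[OF t] mult.left_commute)
      finally show ?thesis by (simp add: nn_integral_cmult)
    qed
    \<comment> \<open>Replacing \<open>t\<close> by \<open>t / s x\<close> removes \<open>x\<close>
      from the argument of \<open>\<Gamma>\<close> at the cost of \<open>1 / s x ^ (m + 1)\<close>.
      What is left of the integral over \<open>x\<close> is the constant \<open>K\<close>.\<close>
    have wscale: "(\<integral>\<^sup>+t. ennreal (t ^ m) * indicator {0<..} t * (w x * \<Gamma> (t * s x)) \<partial>lborel) =
        w x * ennreal (1 / s x ^ (m + 1)) * (\<integral>\<^sup>+t. ennreal (t ^ m) * indicator {0<..} t * \<Gamma> t \<partial>lborel)" for x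
    proof (cases "0 < s x")
      case True
      define \<sigma> where "\<sigma> = s x"
      have \<sigma>: "0 < \<sigma>" using True by (simp add: \<sigma>_def)
      have "ennreal (1 / \<sigma> ^ (m + 1)) * ennreal (\<sigma> ^ (m + 1)) = 1"
        using \<sigma> by (subst ennreal_mult[symmetric]) auto
      then have *: "ennreal (1 / \<sigma> ^ (m + 1)) * (\<integral>\<^sup>+t. ennreal (t ^ m) * indicator {0<..} t * \<Gamma> t \<partial>lborel) =
         (\<integral>\<^sup>+t. ennreal (t ^ m) * indicator {0<..} t * \<Gamma> (t * \<sigma>) \<partial>lborel)"
        using nn_integral_radial_scale[of \<Gamma> \<sigma> m] \<sigma> by (simp add: mult.assoc[symmetric] mult.commute[of \<sigma>])
      have "(\<integral>\<^sup>+t. ennreal (t ^ m) * indicator {0<..} t * (w x * \<Gamma> (t * s x)) \<partial>lborel)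
        = w x * (\<integral>\<^sup>+t. ennreal (t ^ m) * indicator {0<..} t * \<Gamma> (t * \<sigma>) \<partial>lborel)"
        by (simp add: nn_integral_cmult[symmetric] \<sigma>_def mult_ac)
      then show ?thesis unfolding *[symmetric] by (simp only: mult.assoc \<sigma>_def)
    next
      case False
      then have "w x = 0" by (simp add: w_def)
      then show ?thesis by simp
    qed
    have "(\<integral>\<^sup>+x. \<gamma> (s x, a x, b x) \<partial>lborel) = (\<integral>\<^sup>+t. ennreal (t ^ (m + 2)) * indicator {0<..} t *
       (\<integral>\<^sup>+x. ennreal (s x) * indicator {0<..1} (s x) * \<gamma> (s (t *\<^sub>R x), a (t *\<^sub>R x), b (t *\<^sub>R x)) \<partial>lborel) \<partial>lborel)"
      by (subst nn_integral_scaling_average[of _ s]) (use pos hom dim in auto)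
    also have "\<dots> = (\<integral>\<^sup>+t. ennreal (t ^ m) * indicator {0<..} t * (\<integral>\<^sup>+x. w x * \<Gamma> (t * s x) \<partial>lborel) \<partial>lborel)"
    proof (rule nn_integral_cong)
      fix t :: real
      show "ennreal (t ^ (m + 2)) * indicator {0<..} t *
       (\<integral>\<^sup>+x. ennreal (s x) * indicator {0<..1} (s x) * \<gamma> (s (t *\<^sub>R x), a (t *\<^sub>R x), b (t *\<^sub>R x)) \<partial>lborel) =
       ennreal (t ^ m) * indicator {0<..} t * (\<integral>\<^sup>+x. w x * \<Gamma> (t * s x) \<partial>lborel)"
      proof (cases "0 < t")
        case True
        \<comment> \<open>Dimension \<open>m + 3\<close> gives \<open>t ^ (m + 2)\<close> in the
          average over dilations; rescaling \<alpha> and \<beta> takes away two powers.\<close>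
        have "ennreal (t ^ (m + 2)) * ennreal (1 / t\<^sup>2) = ennreal (t ^ m)"
          using True by (subst ennreal_mult[symmetric]) (auto simp: power2_eq_square)
        then show ?thesis using True by (simp add: inner mult.assoc[symmetric])
      qed simp
    qed
    also have "\<dots> = (\<integral>\<^sup>+t. \<integral>\<^sup>+x. ennreal (t ^ m) * indicator {0<..} t * (w x * \<Gamma> (t * s x)) \<partial>lborel \<partial>lborel)"
      by (simp add: nn_integral_cmult)
    also have "\<dots> = (\<integral>\<^sup>+x. \<integral>\<^sup>+t. ennreal (t ^ m) * indicator {0<..} t * (w x * \<Gamma> (t * s x)) \<partial>lborel \<partial>lborel)"
      by (intro nn_integral_lborel_Fubini) measurable
    also have "\<dots> = K * (\<integral>\<^sup>+t. ennreal (t ^ m) * indicator {0<..} t * \<Gamma> t \<partial>lborel)"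
      by (simp add: wscale K_def nn_integral_multc)
    finally show "(\<integral>\<^sup>+x. \<gamma> (s x, a x, b x) \<partial>lborel) =
       K * (\<integral>\<^sup>+t. ennreal (t ^ m) * indicator {0<..} t * (\<integral>\<^sup>+\<alpha>. \<integral>\<^sup>+\<beta>. \<gamma> (t, \<alpha>, \<beta>) \<partial>lborel \<partial>lborel) \<partial>lborel)"
      unfolding \<Gamma>_def .
  qed
qed

section \<open>Cones and reflections\<close>

text \<open>For \<open>\<kappa> = 1\<close> this is the inner product, for \<open>\<kappa> = - 1\<close> the negative of \<^const>\<open>lorentz\<close>.\<close>

definition form :: "real \<Rightarrow> 'b::euclidean_space \<times> real \<Rightarrow> 'b \<times> real \<Rightarrow> real" where
  "form \<kappa> x y = snd x * snd y + \<kappa> * (fst x \<bullet> fst y)"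

lemma form_simps:
  "form \<kappa> (x + y) z = form \<kappa> x z + form \<kappa> y z"
  "form \<kappa> z (x + y) = form \<kappa> z x + form \<kappa> z y"
  "form \<kappa> (x - y) z = form \<kappa> x z - form \<kappa> y z"
  "form \<kappa> z (x - y) = form \<kappa> z x - form \<kappa> z y"
  "form \<kappa> (t *\<^sub>R x) z = t * form \<kappa> x z"
  "form \<kappa> z (t *\<^sub>R x) = t * form \<kappa> z x"
  "form \<kappa> (- x) z = - form \<kappa> x z"
  "form \<kappa> z (- x) = - form \<kappa> z x"
  by (simp_all add: form_def inner_simps algebra_simps)

lemma form_commute: "form \<kappa> x y = form \<kappa> y x"
  by (simp add: form_def inner_commute mult.commute)

lemma form_real: "form \<kappa> (A, b) (S, C) = C * b + \<kappa> * (S * A)"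
  by (simp add: form_def)

lemma continuous_on_form [continuous_intros]:
  "continuous_on X f \<Longrightarrow> continuous_on X g \<Longrightarrow> continuous_on X (\<lambda>x. form \<kappa> (f x) (g x))"
  unfolding form_def by (intro continuous_intros)

lemma measurable_form [measurable (raw)]:
  assumes "f \<in> borel_measurable M" "g \<in> borel_measurable M"
  shows "(\<lambda>x. form \<kappa> (f x) (g x)) \<in> borel_measurable M"
proof -
  have "(\<lambda>(x, y). form \<kappa> x y) \<in> borel_measurable borel"
    by (intro borel_measurable_continuous_onI) (auto simp: case_prod_beta intro!: continuous_intros)
  from measurable_compose[OF borel_measurable_Pair[OF assms] this] show ?thesis by simp
qed

text \<open>The functional \<open>x \<mapsto> form \<kappa> x d / form \<kappa> d d\<close> is the
  inner product with a vector \<open>l\<close> satisfying \<open>l \<bullet> d = 1\<close>. Hence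
  the reflections of the form preserve Lebesgue measure even for \<kappa> = - 1, where they need not
  be Euclidean isometries.\<close>

lemma nn_integral_form_reflection:
  assumes [measurable]: "g \<in> borel_measurable borel" and "form \<kappa> d d \<noteq> 0"
  shows "(\<integral>\<^sup>+x. g (x - (2 * form \<kappa> x d / form \<kappa> d d) *\<^sub>R d) \<partial>lborel) = (\<integral>\<^sup>+x. g x \<partial>lborel)"
proof -
  define l where "l = (\<kappa> *\<^sub>R fst d, snd d) /\<^sub>R form \<kappa> d d"
  have l: "l \<bullet> x = form \<kappa> x d / form \<kappa> d d" for x
    by (simp add: l_def form_def inner_prod_def inner_commute divide_simps)
  have "l \<bullet> d = 1" using assms(2) by (simp add: l)
  from nn_integral_reflection[OF assms(1) this] show ?thesis by (simp add: l)
qed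

lemma form_reflection_reflection:
  assumes "form \<kappa> d d \<noteq> 0"
  shows "form \<kappa> (x - (2 * form \<kappa> x d / form \<kappa> d d) *\<^sub>R d) (y - (2 * form \<kappa> y d / form \<kappa> d d) *\<^sub>R d) = form \<kappa> x y"
proof -
  have "form \<kappa> (x - s *\<^sub>R d) (y - t *\<^sub>R d) = form \<kappa> x y - t * form \<kappa> x d - s * form \<kappa> y d + s * t * form \<kappa> d d" for s t
    by (simp add: form_simps form_commute[of \<kappa> d y] algebra_simps)
  then show ?thesis using assms by simp
qed

text \<open>The reflection along \<open>d = c + c'\<close> sends \<open>c'\<close> to
  \<open>- c\<close>; followed by \<open>x \<mapsto> - x\<close> it carries \<open>c'\<close> to
  \<open>c\<close> and preserves the form and the measure. The sum is used because the difference
  would vanish for \<open>c' = c\<close>. The condition \<open>ne\<close> says that \<open>d\<close>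
  is not isotropic.\<close>

lemma nn_integral_form_rotate:
  fixes c c' :: "'b::euclidean_space \<times> real" and g :: "real \<times> real \<Rightarrow> ennreal"
  assumes [measurable]: "g \<in> borel_measurable borel"
    and eq: "form \<kappa> c' c' = form \<kappa> c c" and ne: "form \<kappa> c c + form \<kappa> c' c \<noteq> 0"
  shows "(\<integral>\<^sup>+x. g (form \<kappa> x x, form \<kappa> x c') \<partial>lborel) = (\<integral>\<^sup>+x. g (form \<kappa> x x, form \<kappa> x c) \<partial>lborel)"
proof -
  define d where "d = c + c'"
  define R where "R x = x - (2 * form \<kappa> x d / form \<kappa> d d) *\<^sub>R d" for x
  have dd: "form \<kappa> d d = 2 * (form \<kappa> c c + form \<kappa> c' c)"
    by (simp add: d_def form_simps eq form_commute[of \<kappa> c c'])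
  with ne have d: "form \<kappa> d d \<noteq> 0" by simp
  have "2 * form \<kappa> c' d = form \<kappa> d d" by (simp add: dd) (simp add: d_def form_simps eq)
  then have "R c' = - c" using d by (simp add: R_def) (simp add: d_def)
  moreover have RR: "form \<kappa> (R x) (R y) = form \<kappa> x y" for x y
    unfolding R_def by (rule form_reflection_reflection[OF d])
  ultimately have R: "form \<kappa> x c' = - form \<kappa> (R x) c" for x
    by (simp add: form_simps flip: RR[of x c'])
  have "(\<integral>\<^sup>+x. g (form \<kappa> x x, form \<kappa> x c') \<partial>lborel) =
      (\<integral>\<^sup>+x. g (form \<kappa> (R x) (R x), - form \<kappa> (R x) c) \<partial>lborel)"
    by (simp only: R RR)
  also have "\<dots> = (\<integral>\<^sup>+x. g (form \<kappa> x x, - form \<kappa> x c) \<partial>lborel)"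
    unfolding R_def by (rule nn_integral_form_reflection[OF _ d, of "\<lambda>x. g (form \<kappa> x x, - form \<kappa> x c)"]) measurable
  also have "\<dots> = (\<integral>\<^sup>+x. g (form \<kappa> x x, form \<kappa> x c) \<partial>lborel)"
    using nn_integral_lborel_scale[of "\<lambda>x. g (form \<kappa> x x, - form \<kappa> x c)" "- 1"] by (simp add: form_simps)
  finally show ?thesis .
qed

section \<open>Cones over shells and their sections by planes\<close>

text \<open>For a unit \<open>c\<close>, the numbers \<open>k1\<close> and \<open>k2\<close> bound
  the cosine or hyperbolic cosine of the distance from \<open>c\<close>; thus \<open>k1\<close>
  belongs to the outer radius for \<kappa> = 1 and to the inner radius for \<kappa> = - 1. The
  vector \<open>c\<close> is left arbitrary because its projections to planes are not unit
  vectors.\<close>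

definition in_cone :: "real \<Rightarrow> real \<Rightarrow> real \<Rightarrow> 'b::euclidean_space \<times> real \<Rightarrow> 'b \<times> real \<Rightarrow> bool" where
  "in_cone \<kappa> k1 k2 c x \<longleftrightarrow> 0 < form \<kappa> x x \<and> form \<kappa> x x \<le> 1 \<and>
     k1 * sqrt (form \<kappa> x x) \<le> form \<kappa> x c \<and> form \<kappa> x c \<le> k2 * sqrt (form \<kappa> x x)"

lemma pred_in_cone [measurable]: "Measurable.pred borel (in_cone \<kappa> k1 k2 c)"
  unfolding in_cone_def by measurable

text \<open>The power \<open>m + 1\<close> of the norm is what field and mass both leave in a plane:
  in the field it comes from the homogeneity of the integrand, in the mass from the Jacobian of
  \<open>t = q * \<tau>\<close>.\<close>

definition cone_weight :: "real \<Rightarrow> real \<Rightarrow> real \<Rightarrow> nat \<Rightarrow> real \<times> real \<Rightarrow> real \<times> real \<Rightarrow> ennreal" where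
  "cone_weight \<kappa> k1 k2 m c x = of_bool (in_cone \<kappa> k1 k2 c x) * ennreal (sqrt (form \<kappa> x x) ^ (m + 1))"

lemma measurable_cone_weight [measurable]:
  "(\<lambda>x. cone_weight \<kappa> k1 k2 m (f x) (g x)) \<in> borel_measurable M"
  if [measurable]: "f \<in> borel_measurable M" "g \<in> borel_measurable M"
  unfolding cone_weight_def in_cone_def by measurable

text \<open>Time orientation: if \<open>b\<close> were nonpositive, then
  \<open>\<bar>A\<bar> \<le> - b\<close> and \<open>\<bar>S\<bar> < C\<close> would make the product
  \<open>C * b - S * A\<close> nonpositive.\<close>

lemma snd_pos_of_timelike:
  assumes "form (- 1) (A, b) (A, b) > 0" "0 < form (- 1) (A, b) (S, C)" "\<bar>S\<bar> < (C::real)"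
  shows "0 < (b::real)"
proof (rule ccontr)
  assume b: "\<not> 0 < b"
  have "A\<^sup>2 < b\<^sup>2" using assms(1) by (simp add: form_real power2_eq_square)
  then have "\<bar>A\<bar> \<le> - b" using b abs_le_square_iff[of A b] by auto
  then have "\<bar>S * A\<bar> \<le> C * - b" using assms(3) unfolding abs_mult by (intro mult_mono) auto
  then show False using assms(2) by (simp add: form_real)
qed

text \<open>With \<open>e\<close> the form of \<open>(A, b)\<close> with itself and \<open>E\<close>
  its product with \<open>(S, C)\<close>, one has
  \<open>C * e - E * b = \<kappa> * A * (A * C - b * S)\<close>. The cone condition compares
  \<open>E\<close> with \<open>C * sqrt e\<close>, and \<open>b\<close> is compared with
  \<open>sqrt e\<close>, which gives the sign. Geometrically, no point of the cone lies between the
  line of \<open>p\<close>, where \<open>A = 0\<close>, and the line of \<open>c\<close>, so being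
  on one side of either line means the same.\<close>

lemma in_cone_inside:
  assumes \<kappa>: "\<kappa> = 1 \<and> 0 < k1 \<and> k2 < C \<or> \<kappa> = - 1 \<and> C < k1 \<and> \<bar>S\<bar> < C"
    and c: "in_cone \<kappa> k1 k2 (S, C) (A, b)"
  shows "0 < A * (A * C - b * (S::real))"
proof (rule ccontr)
  assume "\<not> 0 < A * (A * C - b * S)"
  then have *: "A\<^sup>2 * C \<le> S * A * b" by (simp add: algebra_simps power2_eq_square)
  define e E where "e = form \<kappa> (A, b) (A, b)" and "E = form \<kappa> (A, b) (S, C)"
  have c': "0 < e" "k1 * sqrt e \<le> E" "E \<le> k2 * sqrt e"
    using c by (auto simp: in_cone_def e_def E_def)
  have e2: "sqrt e * sqrt e = e" and e0: "0 < sqrt e" using c'(1) by auto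
  show False using \<kappa>
  proof
    assume \<kappa>: "\<kappa> = 1 \<and> 0 < k1 \<and> k2 < C"
    have E: "0 < E" "E < C * sqrt e"
      using c' \<kappa> e0 by (auto intro: less_le_trans[of 0 "k1 * sqrt e"] le_less_trans[of E "k2 * sqrt e"])
    have "C * e \<le> E * b" using * \<kappa> by (simp add: e_def E_def form_real algebra_simps power2_eq_square)
    also have "b\<^sup>2 \<le> e" using \<kappa> by (simp add: e_def form_real power2_eq_square)
    then have "b \<le> sqrt e" by (rule real_le_rsqrt)
    then have "E * b \<le> E * sqrt e" using E by simp
    also have "\<dots> < C * sqrt e * sqrt e" using E e0 by simp
    finally show False using e2 by (simp add: mult.assoc)
  next
    assume \<kappa>: "\<kappa> = - 1 \<and> C < k1 \<and> \<bar>S\<bar> < C"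
    have E: "C * sqrt e < E" using c' \<kappa> e0 by (auto intro: less_le_trans[of _ "k1 * sqrt e"])
    then have "0 < E" using \<kappa> e0 by (smt (verit) mult_pos_pos)
    then have b: "0 < b"
      using snd_pos_of_timelike[of A b S C] \<kappa> c' by (auto simp: e_def E_def)
    have "C * e = C * sqrt e * sqrt e" using e2 by (simp add: mult.assoc)
    also have "\<dots> < E * sqrt e" using E e0 by simp
    also have "e \<le> b\<^sup>2" using \<kappa> by (simp add: e_def form_real power2_eq_square)
    then have "sqrt e \<le> b" using b by (simp add: real_le_lsqrt)
    then have "E * sqrt e \<le> E * b" using \<open>0 < E\<close> by simp
    also have "\<dots> \<le> C * e" using * \<kappa> by (simp add: e_def E_def form_real algebra_simps power2_eq_square)
    finally show False by simp
  qed
qed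

text \<open>On the half plane \<open>A \<le> 0\<close> the product with \<open>(S, C)\<close> is at
  most \<open>C * b\<close> for \<kappa> = 1, against the lower bound \<open>k1\<close>, and at
  least \<open>C * b\<close> for \<kappa> = - 1, against the upper bound \<open>k2\<close>. Seen
  from an outside point, the whole section lies on the side of \<open>c\<close>.\<close>

lemma in_cone_outside:
  assumes \<kappa>: "\<kappa> = 1 \<and> \<bar>C\<bar> < k1 \<or> \<kappa> = - 1 \<and> 0 < k1 \<and> 0 < k2 \<and> k2 < C \<and> S < C" and S: "0 \<le> (S::real)"
    and c: "in_cone \<kappa> k1 k2 (S, C) (A, b)"
  shows "0 < (A::real)"
proof (rule ccontr)
  assume "\<not> 0 < A"
  then have A: "S * A \<le> 0" using S by (simp add: mult_nonneg_nonpos)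
  define e E where "e = form \<kappa> (A, b) (A, b)" and "E = form \<kappa> (A, b) (S, C)"
  have c': "0 < e" "k1 * sqrt e \<le> E" "E \<le> k2 * sqrt e"
    using c by (auto simp: in_cone_def e_def E_def)
  have e2: "sqrt e * sqrt e = e" and e0: "0 < sqrt e" using c'(1) by auto
  show False using \<kappa>
  proof
    assume \<kappa>: "\<kappa> = 1 \<and> \<bar>C\<bar> < k1"
    have "b\<^sup>2 \<le> e" using \<kappa> by (simp add: e_def form_real power2_eq_square)
    then have b: "\<bar>b\<bar> \<le> sqrt e" by (intro real_le_rsqrt) simp
    have "E \<le> C * b" using A \<kappa> by (simp add: E_def form_real)
    also have "\<dots> \<le> \<bar>C\<bar> * \<bar>b\<bar>" by (metis abs_ge_self abs_mult)
    also have "\<dots> \<le> \<bar>C\<bar> * sqrt e" using b by (intro mult_left_mono) auto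
    also have "\<dots> < k1 * sqrt e" using \<kappa> e0 by simp
    finally show False using c' by simp
  next
    assume \<kappa>: "\<kappa> = - 1 \<and> 0 < k1 \<and> 0 < k2 \<and> k2 < C \<and> S < C"
    have "0 < E" using c' \<kappa> e0 by (auto intro: less_le_trans[of _ "k1 * sqrt e"])
    then have b: "0 < b"
      using snd_pos_of_timelike[of A b S C] \<kappa> c' S by (auto simp: e_def E_def)
    have "e \<le> b\<^sup>2" using \<kappa> by (simp add: e_def form_real power2_eq_square)
    then have "sqrt e \<le> b" using b by (simp add: real_le_lsqrt)
    then have "E \<le> k2 * b" using c' \<kappa> by (smt (verit) mult_left_mono)
    also have "\<dots> < C * b" using \<kappa> b by simp
    also have "\<dots> \<le> E" using A \<kappa> by (simp add: E_def form_real)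
    finally show False by simp
  qed
qed

text \<open>This is the Cauchy-Schwarz inequality, reversed for \<kappa> = - 1, obtained from the
  Lagrange identity \<open>id\<close>. It disposes of the planes that are too far from the center to
  meet the shell.\<close>

lemma in_cone_empty:
  assumes \<kappa>: "\<kappa> = 1 \<and> form \<kappa> c c < k1\<^sup>2 \<and> 0 < k1 \<or> \<kappa> = - 1 \<and> 0 < k1 \<and> k2\<^sup>2 < form \<kappa> c c \<and> 0 < snd c"
  shows "\<not> in_cone \<kappa> k1 k2 c (x :: real \<times> real)"
proof
  assume c: "in_cone \<kappa> k1 k2 c x"
  obtain S C A b where [simp]: "c = (S, C)" "x = (A, b)" by (cases c, cases x)
  define e E N where "e = form \<kappa> (A, b) (A, b)" and "E = form \<kappa> (A, b) (S, C)" and "N = form \<kappa> (S, C) (S, C)"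
  have c': "0 < e" "k1 * sqrt e \<le> E" "E \<le> k2 * sqrt e"
    using c by (auto simp: in_cone_def e_def E_def)
  have "0 < k1 * sqrt e" using \<kappa> c' by auto
  then have sq: "k1\<^sup>2 * e \<le> E\<^sup>2" "E\<^sup>2 \<le> k2\<^sup>2 * e"
    using power_mono[OF c'(2), of 2] power_mono[OF c'(3), of 2] c' by (auto simp: power_mult_distrib)
  have id: "E\<^sup>2 - N * e = - \<kappa> * (C * A - S * b)\<^sup>2"
    by (simp add: E_def e_def N_def form_real power2_eq_square algebra_simps)
  show False using \<kappa>
  proof
    assume \<kappa>: "\<kappa> = 1 \<and> form \<kappa> c c < k1\<^sup>2 \<and> 0 < k1"
    then have "N < k1\<^sup>2" by (auto simp: N_def)
    then have "N * e < k1\<^sup>2 * e" using c' by simp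
    moreover have "E\<^sup>2 - N * e \<le> 0" using id \<kappa> by simp
    ultimately show False using sq by simp
  next
    assume \<kappa>: "\<kappa> = - 1 \<and> 0 < k1 \<and> k2\<^sup>2 < form \<kappa> c c \<and> 0 < snd c"
    then have "k2\<^sup>2 < N" by (auto simp: N_def)
    then have "k2\<^sup>2 * e < N * e" using c' by simp
    moreover have "0 \<le> E\<^sup>2 - N * e" using id \<kappa> by simp
    ultimately show False using sq by simp
  qed
qed

text \<open>On the cone \<open>fst x\<close> has the same sign as \<open>s x\<close>, by
  \<open>in_cone_inside\<close>. So the half planes bounded by the line of \<open>p\<close> may be
  replaced by those bounded by the line of \<open>(S, C)\<close>, and the reflection that fixes
  \<open>(S, C)\<close> exchanges the latter.\<close>

lemma nn_integral_cone_weight_inside: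
  assumes \<kappa>: "\<kappa> = 1 \<and> 0 < k1 \<and> k2 < C \<or> \<kappa> = - 1 \<and> C < k1 \<and> \<bar>S\<bar> < C" and "0 < C"
  shows "(\<integral>\<^sup>+x. of_bool (0 < fst x) * cone_weight \<kappa> k1 k2 m (S, C) x \<partial>lborel) =
    (\<integral>\<^sup>+x. of_bool (fst x < 0) * cone_weight \<kappa> k1 k2 m (S, C) x \<partial>lborel)"
proof -
  define s where "s x = fst x * C - snd x * S" for x :: "real \<times> real"
  have [measurable]: "s \<in> borel_measurable borel"
    unfolding s_def by (intro borel_measurable_continuous_onI continuous_intros)
  have sgn: "0 < fst x * s x" if "in_cone \<kappa> k1 k2 (S, C) x" for x
    using in_cone_inside[OF \<kappa>, of "fst x" "snd x"] that by (simp add: s_def)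
  \<comment> \<open>A vector orthogonal to \<open>(S, C)\<close> for the form; the reflection along
    it fixes \<open>(S, C)\<close> and changes the sign of \<open>s\<close>.\<close>
  define d where "d = (C, - \<kappa> * S)"
  have \<kappa>1: "\<kappa> * \<kappa> = 1" using \<kappa> by auto
  have dd: "form \<kappa> d d = \<kappa> * (C\<^sup>2 + \<kappa> * S\<^sup>2)"
    using \<kappa>1 by (simp add: d_def form_real power2_eq_square algebra_simps)
  have pos: "0 < C\<^sup>2 + \<kappa> * S\<^sup>2"
    using \<kappa> \<open>0 < C\<close> power2_strict_mono[of S C] by (auto intro: add_pos_nonneg)
  have d: "form \<kappa> d d \<noteq> 0" using pos \<kappa> by (auto simp: dd)
  define R where "R x = x - (2 * form \<kappa> x d / form \<kappa> d d) *\<^sub>R d" for x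
  have xd: "form \<kappa> x d = \<kappa> * s x" for x
    by (cases x) (simp add: d_def s_def form_real algebra_simps)
  have s_lin: "s (x - t *\<^sub>R d) = s x - t * (C\<^sup>2 + \<kappa> * S\<^sup>2)" for x t
    by (simp add: s_def d_def power2_eq_square algebra_simps)
  have sR: "s (R x) = - s x" for x
  proof -
    have "R x = x - (2 * s x / (C\<^sup>2 + \<kappa> * S\<^sup>2)) *\<^sub>R d"
      unfolding R_def dd xd[of x] using \<kappa> by auto
    then show ?thesis using pos by (simp add: s_lin)
  qed
  have "form \<kappa> (S, C) d = 0" by (simp add: d_def form_real)
  then have Rc: "R (S, C) = (S, C)" by (simp add: R_def)
  have "form \<kappa> (R x) (S, C) = form \<kappa> x (S, C)" "form \<kappa> (R x) (R x) = form \<kappa> x x" for x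
    using form_reflection_reflection[OF d, of x "(S, C)"] form_reflection_reflection[OF d, of x x] Rc
    by (simp_all flip: R_def)
  then have wR: "cone_weight \<kappa> k1 k2 m (S, C) (R x) = cone_weight \<kappa> k1 k2 m (S, C) x" for x
    by (simp add: cone_weight_def in_cone_def)
  have "(\<integral>\<^sup>+x. of_bool (0 < fst x) * cone_weight \<kappa> k1 k2 m (S, C) x \<partial>lborel) =
      (\<integral>\<^sup>+x. of_bool (0 < s x) * cone_weight \<kappa> k1 k2 m (S, C) x \<partial>lborel)"
    using sgn by (intro nn_integral_cong) (force simp: cone_weight_def zero_less_mult_iff)
  also have "\<dots> = (\<integral>\<^sup>+x. of_bool (0 < s (R x)) * cone_weight \<kappa> k1 k2 m (S, C) (R x) \<partial>lborel)"
    unfolding R_def by (rule nn_integral_form_reflection[OF _ d, symmetric]) measurable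
  also have "\<dots> = (\<integral>\<^sup>+x. of_bool (s x < 0) * cone_weight \<kappa> k1 k2 m (S, C) x \<partial>lborel)"
    by (simp add: sR wR)
  also have "\<dots> = (\<integral>\<^sup>+x. of_bool (fst x < 0) * cone_weight \<kappa> k1 k2 m (S, C) x \<partial>lborel)"
    using sgn by (intro nn_integral_cong) (force simp: cone_weight_def zero_less_mult_iff)
  finally show ?thesis .
qed

section \<open>The field and the mass as integrals over planes\<close>

text \<open>
  Here \<open>\<alpha>\<close> and \<open>\<beta>\<close> are the components along two orthogonal directions \<open>e\<close> and \<open>p\<close>, and \<open>t\<close> is the
  length of the remaining component; \<open>c\<close> has the components \<open>S\<close>, \<open>C\<close> and \<open>0\<close>.
\<close>

definition cone_radius2 :: "real \<Rightarrow> real \<Rightarrow> real \<Rightarrow> real \<Rightarrow> real" where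
  "cone_radius2 \<kappa> t \<alpha> \<beta> = \<beta>\<^sup>2 + \<kappa> * (\<alpha>\<^sup>2 + t\<^sup>2)"

definition in_cone_coord :: "real \<Rightarrow> real \<Rightarrow> real \<Rightarrow> real \<Rightarrow> real \<Rightarrow> real \<Rightarrow> real \<Rightarrow> real \<Rightarrow> bool" where
  "in_cone_coord \<kappa> k1 k2 S C t \<alpha> \<beta> \<longleftrightarrow> 0 < cone_radius2 \<kappa> t \<alpha> \<beta> \<and> cone_radius2 \<kappa> t \<alpha> \<beta> \<le> 1 \<and>
     k1 * sqrt (cone_radius2 \<kappa> t \<alpha> \<beta>) \<le> C * \<beta> + \<kappa> * (S * \<alpha>) \<and>
     C * \<beta> + \<kappa> * (S * \<alpha>) \<le> k2 * sqrt (cone_radius2 \<kappa> t \<alpha> \<beta>)"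

text \<open>The coefficient along \<open>e\<close> of the attraction exerted at \<open>p\<close> by
  the radial projection of a point of the cone. The length of the component orthogonal to
  \<open>p\<close> is \<open>sqrt (t\<^sup>2 + \<alpha>\<^sup>2)\<close>, and the projection to norm
  1 accounts for the power \<open>m + 1\<close> of the norm.\<close>

definition field_coord :: "real \<Rightarrow> real \<Rightarrow> real \<Rightarrow> nat \<Rightarrow> real \<Rightarrow> real \<Rightarrow> real \<Rightarrow> real \<Rightarrow> real \<Rightarrow> real" where
  "field_coord \<kappa> k1 k2 m S C t \<alpha> \<beta> = of_bool (in_cone_coord \<kappa> k1 k2 S C t \<alpha> \<beta>) *
     sqrt (cone_radius2 \<kappa> t \<alpha> \<beta>) ^ (m + 1) * \<alpha> / sqrt (t\<^sup>2 + \<alpha>\<^sup>2) ^ (m + 2)"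

lemma measurable_in_cone_coord [measurable (raw)]:
  assumes [measurable]: "f \<in> borel_measurable M" "g \<in> borel_measurable M" "h \<in> borel_measurable M"
  shows "Measurable.pred M (\<lambda>x. in_cone_coord \<kappa> k1 k2 S C (f x) (g x) (h x))"
  unfolding in_cone_coord_def cone_radius2_def by measurable

lemma measurable_field_coord [measurable (raw)]:
  assumes [measurable]: "f \<in> borel_measurable M" "g \<in> borel_measurable M" "h \<in> borel_measurable M"
  shows "(\<lambda>x. field_coord \<kappa> k1 k2 m S C (f x) (g x) (h x)) \<in> borel_measurable M"
  unfolding field_coord_def cone_radius2_def by measurable

lemma nn_integral_plane:
  fixes g :: "real \<times> real \<Rightarrow> ennreal"
  assumes "g \<in> borel_measurable borel"
  shows "(\<integral>\<^sup>+x. g x \<partial>lborel) = (\<integral>\<^sup>+\<alpha>. \<integral>\<^sup>+\<beta>. g (\<alpha>, \<beta>) \<partial>lborel \<partial>lborel)"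
  using lborel.nn_integral_fst[of g lborel] assms by (simp add: lborel_prod)

section \<open>The field through half planes containing the point\<close>

text \<open>With \<open>t = \<bar>\<alpha>\<bar> * \<tau>\<close> the distance in the denominator
  becomes \<open>\<bar>\<alpha>\<bar> * \<nu>\<close> for
  \<open>\<nu> = sqrt (1 + \<tau>\<^sup>2)\<close>, so all powers of
  \<open>\<bar>\<alpha>\<bar>\<close> cancel. The point turns into the planar vector
  \<open>(\<nu> * \<alpha>, \<beta>)\<close>, and \<open>(S / \<nu>, C)\<close> is the projection of
  \<open>c\<close> to that plane.\<close>

lemma field_coord_scaled:
  assumes \<sigma>: "\<sigma> = 1 \<or> \<sigma> = - 1" and pos: "0 < \<sigma> * \<alpha>"
  shows "ennreal (\<bar>\<alpha>\<bar> ^ (m + 1)) * ennreal (\<sigma> * field_coord \<kappa> k1 k2 m S C (\<bar>\<alpha>\<bar> * \<tau>) \<alpha> \<beta>) =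
    ennreal (1 / sqrt (1 + \<tau>\<^sup>2) ^ (m + 2)) *
    cone_weight \<kappa> k1 k2 m (S / sqrt (1 + \<tau>\<^sup>2), C) (sqrt (1 + \<tau>\<^sup>2) * \<alpha>, \<beta>)"
proof -
  define \<nu> where "\<nu> = sqrt (1 + \<tau>\<^sup>2)"
  have "0 < 1 + \<tau>\<^sup>2" by (simp add: add_pos_nonneg)
  then have \<nu>: "0 < \<nu>" "\<nu> * \<nu> = 1 + \<tau>\<^sup>2" by (simp_all add: \<nu>_def)
  have \<alpha>: "\<alpha> \<noteq> 0" and sgn: "\<sigma> * \<alpha> = \<bar>\<alpha>\<bar>" using pos \<sigma> by auto
  have e: "cone_radius2 \<kappa> (\<bar>\<alpha>\<bar> * \<tau>) \<alpha> \<beta> = form \<kappa> (\<nu> * \<alpha>, \<beta>) (\<nu> * \<alpha>, \<beta>)"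
  proof -
    have "form \<kappa> (\<nu> * \<alpha>, \<beta>) (\<nu> * \<alpha>, \<beta>) = \<beta>\<^sup>2 + \<kappa> * ((\<nu> * \<nu>) * \<alpha>\<^sup>2)"
      by (simp add: form_real power2_eq_square algebra_simps)
    then show ?thesis by (simp add: \<nu>(2) cone_radius2_def power_mult_distrib algebra_simps)
  qed
  have E: "form \<kappa> (\<nu> * \<alpha>, \<beta>) (S / \<nu>, C) = C * \<beta> + \<kappa> * (S * \<alpha>)"
    using \<nu> by (simp add: form_real)
  have "(\<bar>\<alpha>\<bar> * \<tau>)\<^sup>2 + \<alpha>\<^sup>2 = (\<bar>\<alpha>\<bar> * \<nu>)\<^sup>2"
    using \<nu>(2) by (simp add: power_mult_distrib power2_eq_square[of \<nu>] algebra_simps)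
  then have den: "sqrt ((\<bar>\<alpha>\<bar> * \<tau>)\<^sup>2 + \<alpha>\<^sup>2) = \<bar>\<alpha>\<bar> * \<nu>"
    using \<nu> by (simp add: real_sqrt_mult)
  have P: "in_cone_coord \<kappa> k1 k2 S C (\<bar>\<alpha>\<bar> * \<tau>) \<alpha> \<beta> = in_cone \<kappa> k1 k2 (S / \<nu>, C) (\<nu> * \<alpha>, \<beta>)"
    by (simp add: in_cone_coord_def in_cone_def e E)
  show ?thesis
  proof (cases "in_cone \<kappa> k1 k2 (S / \<nu>, C) (\<nu> * \<alpha>, \<beta>)")
    case True
    define r where "r = sqrt (form \<kappa> (\<nu> * \<alpha>, \<beta>) (\<nu> * \<alpha>, \<beta>))"
    have r: "0 \<le> r" using True by (simp add: r_def in_cone_def)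
    have "\<bar>\<alpha>\<bar> ^ (m + 1) * (\<sigma> * field_coord \<kappa> k1 k2 m S C (\<bar>\<alpha>\<bar> * \<tau>) \<alpha> \<beta>) =
        \<bar>\<alpha>\<bar> ^ (m + 1) * (r ^ (m + 1) * (\<sigma> * \<alpha>) / (\<bar>\<alpha>\<bar> * \<nu>) ^ (m + 2))"
      using True by (simp add: field_coord_def P den e r_def)
    also have "\<dots> = 1 / \<nu> ^ (m + 2) * r ^ (m + 1)"
      unfolding sgn using \<alpha> \<nu> by (simp add: power_mult_distrib)
    finally have "ennreal (\<bar>\<alpha>\<bar> ^ (m + 1)) * ennreal (\<sigma> * field_coord \<kappa> k1 k2 m S C (\<bar>\<alpha>\<bar> * \<tau>) \<alpha> \<beta>) =
        ennreal (1 / \<nu> ^ (m + 2)) * ennreal (r ^ (m + 1))"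
      using \<nu> r by (simp only: ennreal_mult'[symmetric] zero_le_power abs_ge_zero zero_le_divide_1_iff less_imp_le)
    then show ?thesis using True by (simp add: cone_weight_def r_def flip: \<nu>_def)
  next
    case False
    then show ?thesis by (simp add: field_coord_def P cone_weight_def flip: \<nu>_def)
  qed
qed

text \<open>Substitute \<open>t = \<bar>\<alpha>\<bar> * \<tau>\<close> at fixed \<alpha>, then
  stretch \<alpha> at fixed \<tau>; the stretching raises the exponent from \<open>m + 2\<close> to
  \<open>m + 3\<close>. The sign \<sigma> selects the positive or negative part of the field
  coefficient and thereby one of the two half planes.\<close>

lemma nn_integral_field_coord:
  assumes \<sigma>: "\<sigma> = 1 \<or> \<sigma> = - 1"
  shows "(\<integral>\<^sup>+t. ennreal (t ^ m) * indicator {0<..} t *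
      (\<integral>\<^sup>+\<alpha>. \<integral>\<^sup>+\<beta>. ennreal (\<sigma> * field_coord \<kappa> k1 k2 m S C t \<alpha> \<beta>) \<partial>lborel \<partial>lborel) \<partial>lborel) =
    (\<integral>\<^sup>+\<tau>. ennreal (\<tau> ^ m) * indicator {0<..} \<tau> * (ennreal (1 / sqrt (1 + \<tau>\<^sup>2) ^ (m + 3)) *
      (\<integral>\<^sup>+x. of_bool (0 < \<sigma> * fst x) * cone_weight \<kappa> k1 k2 m (S / sqrt (1 + \<tau>\<^sup>2), C) x \<partial>lborel)) \<partial>lborel)"
proof -
  define H where "H t \<alpha> = (\<integral>\<^sup>+\<beta>. ennreal (\<sigma> * field_coord \<kappa> k1 k2 m S C t \<alpha> \<beta>) \<partial>lborel)" for t \<alpha>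
  have [measurable]: "(\<lambda>x. H (f x) (g x)) \<in> borel_measurable M"
    if [measurable]: "f \<in> borel_measurable M" "g \<in> borel_measurable M" for f g and M :: "'z measure"
    unfolding H_def by measurable
  define W where "W \<tau> \<alpha> = of_bool (0 < \<sigma> * \<alpha>) *
      (\<integral>\<^sup>+\<beta>. cone_weight \<kappa> k1 k2 m (S / sqrt (1 + \<tau>\<^sup>2), C) (\<alpha>, \<beta>) \<partial>lborel)" for \<tau> \<alpha>
  have [measurable]: "(\<lambda>x. W (f x) (g x)) \<in> borel_measurable M"
    if [measurable]: "f \<in> borel_measurable M" "g \<in> borel_measurable M" for f g and M :: "'z measure"
    unfolding W_def by measurable
  have H: "(\<integral>\<^sup>+t. ennreal (t ^ m) * indicator {0<..} t * H t \<alpha> \<partial>lborel) =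
      (\<integral>\<^sup>+\<tau>. ennreal (\<tau> ^ m) * indicator {0<..} \<tau> *
        (ennreal (1 / sqrt (1 + \<tau>\<^sup>2) ^ (m + 2)) * W \<tau> (sqrt (1 + \<tau>\<^sup>2) * \<alpha>)) \<partial>lborel)" for \<alpha>
  proof (cases "0 < \<sigma> * \<alpha>")
    case True
    then have "0 < \<bar>\<alpha>\<bar>" by auto
    have "ennreal (\<bar>\<alpha>\<bar> ^ (m + 1)) * H (\<bar>\<alpha>\<bar> * \<tau>) \<alpha> =
        ennreal (1 / sqrt (1 + \<tau>\<^sup>2) ^ (m + 2)) * W \<tau> (sqrt (1 + \<tau>\<^sup>2) * \<alpha>)" for \<tau>
    proof -
      have "0 < sqrt (1 + \<tau>\<^sup>2)" by (simp add: add_pos_nonneg)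
      then have "0 < \<sigma> * (sqrt (1 + \<tau>\<^sup>2) * \<alpha>)" using True by (simp add: mult.left_commute[of \<sigma>])
      then show ?thesis
        unfolding H_def W_def
        by (simp add: nn_integral_cmult[symmetric] field_coord_scaled[OF \<sigma> True, unfolded Suc_eq_plus1[symmetric] add_2_eq_Suc'] del: power_Suc)
    qed
    note this[unfolded Suc_eq_plus1[symmetric] add_2_eq_Suc', simp]
    show ?thesis
      by (subst nn_integral_radial_scale[OF _ \<open>0 < \<bar>\<alpha>\<bar>\<close>])
        (simp_all add: nn_integral_cmult[symmetric] mult.left_commute[of "ennreal (\<bar>\<alpha>\<bar> ^ Suc m)"] del: power_Suc)
  next
    case False
    have "0 < sqrt (1 + \<tau>\<^sup>2)" for \<tau> :: real by (simp add: add_pos_nonneg)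
    then have "\<not> 0 < \<sigma> * (sqrt (1 + \<tau>\<^sup>2) * \<alpha>)" for \<tau>
      using False mult_nonneg_nonpos[of "sqrt (1 + \<tau>\<^sup>2)" "\<sigma> * \<alpha>"]
      by (simp add: mult.left_commute[of \<sigma>] not_less less_imp_le)
    then have "W \<tau> (sqrt (1 + \<tau>\<^sup>2) * \<alpha>) = 0" for \<tau> by (simp add: W_def)
    moreover have "\<sigma> * field_coord \<kappa> k1 k2 m S C t \<alpha> \<beta> \<le> 0" for t \<beta>
    proof -
      have "\<sigma> * field_coord \<kappa> k1 k2 m S C t \<alpha> \<beta> = (of_bool (in_cone_coord \<kappa> k1 k2 S C t \<alpha> \<beta>) *
        sqrt (cone_radius2 \<kappa> t \<alpha> \<beta>) ^ (m + 1) / sqrt (t\<^sup>2 + \<alpha>\<^sup>2) ^ (m + 2)) * (\<sigma> * \<alpha>)"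
        by (simp add: field_coord_def)
      also have "\<dots> \<le> 0" using False
        by - (rule mult_nonneg_nonpos, auto simp: in_cone_coord_def)
      finally show ?thesis .
    qed
    then have "H t \<alpha> = 0" for t unfolding H_def by (simp add: ennreal_neg)
    ultimately show ?thesis by simp
  qed
  have W: "(\<integral>\<^sup>+\<alpha>. W \<tau> (sqrt (1 + \<tau>\<^sup>2) * \<alpha>) \<partial>lborel) = ennreal (1 / sqrt (1 + \<tau>\<^sup>2)) *
      (\<integral>\<^sup>+x. of_bool (0 < \<sigma> * fst x) * cone_weight \<kappa> k1 k2 m (S / sqrt (1 + \<tau>\<^sup>2), C) x \<partial>lborel)" for \<tau>
  proof -
    define \<nu> where "\<nu> = sqrt (1 + \<tau>\<^sup>2)"
    have \<nu>: "0 < \<nu>" by (simp add: \<nu>_def add_pos_nonneg)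
    have "(\<integral>\<^sup>+x. of_bool (0 < \<sigma> * fst x) * cone_weight \<kappa> k1 k2 m (S / sqrt (1 + \<tau>\<^sup>2), C) x \<partial>lborel) =
        (\<integral>\<^sup>+\<alpha>. W \<tau> \<alpha> \<partial>lborel)"
    proof -
      define p :: "real \<times> real \<Rightarrow> real" where "p x = \<sigma> * fst x" for x
      have [measurable]: "p \<in> borel_measurable borel"
        unfolding p_def by (intro borel_measurable_continuous_onI continuous_intros)
      have "(\<lambda>x. of_bool (0 < p x) * cone_weight \<kappa> k1 k2 m (S / sqrt (1 + \<tau>\<^sup>2), C) x) \<in> borel_measurable borel"
        by measurable
      then have "(\<lambda>x. of_bool (0 < \<sigma> * fst x) * cone_weight \<kappa> k1 k2 m (S / sqrt (1 + \<tau>\<^sup>2), C) x) \<in> borel_measurable borel"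
        by (simp only: p_def)
      then show ?thesis
        by (subst nn_integral_plane) (auto simp: W_def nn_integral_cmult intro!: nn_integral_cong)
    qed
    also have "\<dots> = ennreal \<nu> * (\<integral>\<^sup>+\<alpha>. W \<tau> (\<nu> * \<alpha>) \<partial>lborel)"
      using nn_integral_real_affine[of "W \<tau>" \<nu> 0] \<nu> by simp
    also have "ennreal (1 / \<nu>) * \<dots> = ennreal (1 / \<nu> * \<nu>) * (\<integral>\<^sup>+\<alpha>. W \<tau> (\<nu> * \<alpha>) \<partial>lborel)"
      using \<nu> by (simp only: ennreal_mult mult.assoc less_imp_le zero_le_divide_1_iff)
    finally show ?thesis using \<nu> by (simp flip: \<nu>_def)
  qed
  have "(\<integral>\<^sup>+t. ennreal (t ^ m) * indicator {0<..} t *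
      (\<integral>\<^sup>+\<alpha>. \<integral>\<^sup>+\<beta>. ennreal (\<sigma> * field_coord \<kappa> k1 k2 m S C t \<alpha> \<beta>) \<partial>lborel \<partial>lborel) \<partial>lborel) =
      (\<integral>\<^sup>+t. \<integral>\<^sup>+\<alpha>. ennreal (t ^ m) * indicator {0<..} t * H t \<alpha> \<partial>lborel \<partial>lborel)"
    by (simp add: H_def[symmetric] nn_integral_cmult)
  also have "\<dots> = (\<integral>\<^sup>+\<alpha>. \<integral>\<^sup>+t. ennreal (t ^ m) * indicator {0<..} t * H t \<alpha> \<partial>lborel \<partial>lborel)"
    by (rule nn_integral_lborel_Fubini) measurable
  also have "\<dots> = (\<integral>\<^sup>+\<alpha>. \<integral>\<^sup>+\<tau>. ennreal (\<tau> ^ m) * indicator {0<..} \<tau> *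
        (ennreal (1 / sqrt (1 + \<tau>\<^sup>2) ^ (m + 2)) * W \<tau> (sqrt (1 + \<tau>\<^sup>2) * \<alpha>)) \<partial>lborel \<partial>lborel)"
    by (simp only: H)
  also have "\<dots> = (\<integral>\<^sup>+\<tau>. \<integral>\<^sup>+\<alpha>. ennreal (\<tau> ^ m) * indicator {0<..} \<tau> *
        (ennreal (1 / sqrt (1 + \<tau>\<^sup>2) ^ (m + 2)) * W \<tau> (sqrt (1 + \<tau>\<^sup>2) * \<alpha>)) \<partial>lborel \<partial>lborel)"
    by (rule nn_integral_lborel_Fubini) measurable
  also have "\<dots> = (\<integral>\<^sup>+\<tau>. ennreal (\<tau> ^ m) * indicator {0<..} \<tau> * (ennreal (1 / sqrt (1 + \<tau>\<^sup>2) ^ (m + 2)) *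
      (ennreal (1 / sqrt (1 + \<tau>\<^sup>2)) *
      (\<integral>\<^sup>+x. of_bool (0 < \<sigma> * fst x) * cone_weight \<kappa> k1 k2 m (S / sqrt (1 + \<tau>\<^sup>2), C) x \<partial>lborel))) \<partial>lborel)"
    by (simp add: nn_integral_cmult W)
  also have "\<dots> = (\<integral>\<^sup>+\<tau>. ennreal (\<tau> ^ m) * indicator {0<..} \<tau> * (ennreal (1 / sqrt (1 + \<tau>\<^sup>2) ^ (m + 3)) *
      (\<integral>\<^sup>+x. of_bool (0 < \<sigma> * fst x) * cone_weight \<kappa> k1 k2 m (S / sqrt (1 + \<tau>\<^sup>2), C) x \<partial>lborel)) \<partial>lborel)"
  proof (rule nn_integral_cong)
    fix \<tau> :: real
    have "1 / sqrt (1 + \<tau>\<^sup>2) ^ (m + 3) = 1 / sqrt (1 + \<tau>\<^sup>2) ^ (m + 2) * (1 / sqrt (1 + \<tau>\<^sup>2))"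
      by (simp add: power_add eval_nat_numeral)
    then have "ennreal (1 / sqrt (1 + \<tau>\<^sup>2) ^ (m + 3)) = ennreal (1 / sqrt (1 + \<tau>\<^sup>2) ^ (m + 2)) * ennreal (1 / sqrt (1 + \<tau>\<^sup>2))"
      by (simp only:) (rule ennreal_mult, auto)
    then show "ennreal (\<tau> ^ m) * indicator {0<..} \<tau> * (ennreal (1 / sqrt (1 + \<tau>\<^sup>2) ^ (m + 2)) *
      (ennreal (1 / sqrt (1 + \<tau>\<^sup>2)) *
      (\<integral>\<^sup>+x. of_bool (0 < \<sigma> * fst x) * cone_weight \<kappa> k1 k2 m (S / sqrt (1 + \<tau>\<^sup>2), C) x \<partial>lborel))) =
      ennreal (\<tau> ^ m) * indicator {0<..} \<tau> * (ennreal (1 / sqrt (1 + \<tau>\<^sup>2) ^ (m + 3)) *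
      (\<integral>\<^sup>+x. of_bool (0 < \<sigma> * fst x) * cone_weight \<kappa> k1 k2 m (S / sqrt (1 + \<tau>\<^sup>2), C) x \<partial>lborel))"
      by (simp only: mult.assoc)
  qed
  finally show ?thesis .
qed

section \<open>The mass through parallel planes\<close>

text \<open>For \<open>t = q x * \<tau>\<close>, with \<open>q x\<close> the norm of the planar
  part, the full norm squared is that of \<open>x\<close> times
  \<open>1 + \<kappa> * \<tau>\<^sup>2\<close>. Dilating the plane restores the cut-off at 1 and
  moves the factor to \<open>c\<close>; the area and the weight together contribute the exponent
  \<open>m + 3\<close>.\<close>

lemma nn_integral_cone_coord:
  assumes \<kappa>: "\<kappa> = 1 \<or> \<kappa> = - 1" and k1: "0 < k1"
  shows "(\<integral>\<^sup>+t. ennreal (t ^ m) * indicator {0<..} t *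
      (\<integral>\<^sup>+\<alpha>. \<integral>\<^sup>+\<beta>. of_bool (in_cone_coord \<kappa> k1 k2 S C t \<alpha> \<beta>) \<partial>lborel \<partial>lborel) \<partial>lborel) =
    (\<integral>\<^sup>+\<tau>. ennreal (\<tau> ^ m) * indicator {0<..} \<tau> * (of_bool (0 < 1 + \<kappa> * \<tau>\<^sup>2) *
      ennreal (1 / sqrt (1 + \<kappa> * \<tau>\<^sup>2) ^ (m + 3)) *
      (\<integral>\<^sup>+x. cone_weight \<kappa> k1 k2 m (S / sqrt (1 + \<kappa> * \<tau>\<^sup>2), C / sqrt (1 + \<kappa> * \<tau>\<^sup>2)) x \<partial>lborel)) \<partial>lborel)"
proof -
  define P where "P t x = (of_bool (in_cone_coord \<kappa> k1 k2 S C t (fst x) (snd x)) :: ennreal)" for t and x :: "real \<times> real"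
  have [measurable]: "(\<lambda>x. P (f x) (g x)) \<in> borel_measurable M"
    if [measurable]: "f \<in> borel_measurable M" "g \<in> borel_measurable M" for f g and M :: "'z measure"
  proof -
    have "g \<in> M \<rightarrow>\<^sub>M borel \<Otimes>\<^sub>M borel" using that by (simp add: borel_prod)
    note [measurable] = this
    show ?thesis unfolding P_def by measurable
  qed
  have e: "cone_radius2 \<kappa> t (fst x) (snd x) = form \<kappa> x x + \<kappa> * t\<^sup>2" for t x
    by (cases x) (simp add: cone_radius2_def form_real power2_eq_square algebra_simps)
  have E: "C * snd x + \<kappa> * (S * fst x) = form \<kappa> x (S, C)" for x
    by (cases x) (simp add: form_real)
  \<comment> \<open>As \<open>sqrt\<close> is negative on negative numbers, \<open>0 < q x\<close>
    is equivalent to \<open>0 < form \<kappa> x x\<close>.\<close>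
  define q where "q x = sqrt (form \<kappa> x x)" for x :: "real \<times> real"
  have [measurable]: "(\<lambda>x. q (f x)) \<in> borel_measurable M"
    if [measurable]: "f \<in> borel_measurable M" for f and M :: "'z measure"
    unfolding q_def by measurable
  have 1: "(\<integral>\<^sup>+t. ennreal (t ^ m) * indicator {0<..} t * P t x \<partial>lborel) =
     (\<integral>\<^sup>+\<tau>. ennreal (\<tau> ^ m) * indicator {0<..} \<tau> *
        (of_bool (0 < q x) * ennreal (q x ^ (m + 1)) * P (q x * \<tau>) x) \<partial>lborel)" for x
  proof (cases "0 < q x")
    case True
    then show ?thesis
      by (subst nn_integral_radial_scale[OF _ True])
        (simp_all add: nn_integral_cmult[symmetric] mult.left_commute[of "ennreal (q x ^ Suc m)"] del: power_Suc)
  next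
    case False
    then have x: "form \<kappa> x x \<le> 0" by (simp add: q_def)
    \<comment> \<open>A planar part of nonpositive norm yields no point of the cone. For \<kappa> =
      1 it is zero, so its product with \<open>c\<close> vanishes and violates the positive lower
      bound; for \<kappa> = - 1 the full norm is nonpositive.\<close>
    have "P t x = 0" if "0 < t" for t
    proof -
      have "\<not> in_cone_coord \<kappa> k1 k2 S C t (fst x) (snd x)" using \<kappa>
      proof
        assume \<kappa>: "\<kappa> = 1"
        obtain A b where [simp]: "x = (A, b)" by (cases x)
        have "A\<^sup>2 + b\<^sup>2 \<le> 0" using x \<kappa> by (simp add: form_real power2_eq_square)
        then have "A = 0" "b = 0" by (auto simp: sum_power2_le_zero_iff)
        moreover have "0 < k1 * sqrt (t\<^sup>2)" using k1 that by simp
        ultimately show ?thesis using \<kappa> by (simp add: in_cone_coord_def cone_radius2_def)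
      next
        assume \<kappa>: "\<kappa> = - 1"
        have "form \<kappa> x x + \<kappa> * t\<^sup>2 \<le> 0" using x \<kappa> by (simp add: order_trans[OF _ zero_le_power2])
        then show ?thesis by (simp add: in_cone_coord_def e)
      qed
      then show ?thesis by (simp add: P_def)
    qed
    then have "ennreal (t ^ m) * indicator {0<..} t * P t x = 0" for t by (cases "0 < t") auto
    then show ?thesis using False by (simp only:) simp
  qed
  have 2: "(\<integral>\<^sup>+x. of_bool (0 < q x) * ennreal (q x ^ (m + 1)) * P (q x * \<tau>) x \<partial>lborel) =
     of_bool (0 < 1 + \<kappa> * \<tau>\<^sup>2) * ennreal (1 / sqrt (1 + \<kappa> * \<tau>\<^sup>2) ^ (m + 3)) *
      (\<integral>\<^sup>+x. cone_weight \<kappa> k1 k2 m (S / sqrt (1 + \<kappa> * \<tau>\<^sup>2), C / sqrt (1 + \<kappa> * \<tau>\<^sup>2)) x \<partial>lborel)" for \<tau>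
  proof (cases "0 < 1 + \<kappa> * \<tau>\<^sup>2")
    case False
    have "of_bool (0 < q x) * ennreal (q x ^ (m + 1)) * P (q x * \<tau>) x = 0" for x
    proof (cases "0 < q x")
      case True
      then have "form \<kappa> x x + \<kappa> * (q x * \<tau>)\<^sup>2 = form \<kappa> x x * (1 + \<kappa> * \<tau>\<^sup>2)"
        by (simp add: q_def power_mult_distrib algebra_simps)
      also have "\<dots> \<le> 0" using True False by (intro mult_nonneg_nonpos) (auto simp: q_def)
      finally show ?thesis by (simp add: P_def in_cone_coord_def e)
    qed simp
    then show ?thesis using False by (simp only:) simp
  next
    case True
    define \<nu> where "\<nu> = sqrt (1 + \<kappa> * \<tau>\<^sup>2)"
    have \<nu>: "0 < \<nu>" "\<nu> * \<nu> = 1 + \<kappa> * \<tau>\<^sup>2" using True by (simp_all add: \<nu>_def)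
    have sc: "of_bool (0 < q y) * ennreal (q y ^ (m + 1)) * P (q y * \<tau>) y =
      ennreal (1 / \<nu> ^ (m + 1)) * cone_weight \<kappa> k1 k2 m (S / \<nu>, C / \<nu>) x"
      if y: "y = (1 / \<nu>) *\<^sub>R x" for x y
    proof -
      have q: "q y = q x / \<nu>" using \<nu>(1) by (simp add: q_def y form_simps real_sqrt_divide real_sqrt_mult)
      have "cone_radius2 \<kappa> (q y * \<tau>) (fst y) (snd y) = form \<kappa> x x" if "0 < q x"
      proof -
        have "form \<kappa> x x = (q x)\<^sup>2" using that by (simp add: q_def)
        then have "cone_radius2 \<kappa> (q y * \<tau>) (fst y) (snd y) = (q x)\<^sup>2 / (\<nu> * \<nu>) * (1 + \<kappa> * \<tau>\<^sup>2)"
          by (simp add: e q) (simp add: y form_simps power2_eq_square algebra_simps add_divide_distrib)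
        then show ?thesis using \<nu>(1) \<open>form \<kappa> x x = (q x)\<^sup>2\<close> unfolding \<nu>(2)[symmetric] by simp
      qed
      moreover have "form \<kappa> y (S, C) = form \<kappa> x (S / \<nu>, C / \<nu>)"
        by (simp add: y form_simps) (simp add: form_def add_divide_distrib)
      ultimately have "0 < q x \<Longrightarrow> in_cone_coord \<kappa> k1 k2 S C (q y * \<tau>) (fst y) (snd y) = in_cone \<kappa> k1 k2 (S / \<nu>, C / \<nu>) x"
        by (simp add: in_cone_coord_def in_cone_def E)
      moreover have "0 < q y \<longleftrightarrow> 0 < q x" using \<nu> by (simp add: q zero_less_divide_iff)
      moreover have "\<not> 0 < q x \<Longrightarrow> \<not> in_cone \<kappa> k1 k2 (S / \<nu>, C / \<nu>) x"
        by (simp add: q_def in_cone_def)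
      moreover have "0 < q x \<Longrightarrow> ennreal (q y ^ (m + 1)) = ennreal (1 / \<nu> ^ (m + 1)) * ennreal (q x ^ (m + 1))"
        using \<nu> by (subst ennreal_mult[symmetric]) (auto simp: q power_divide)
      ultimately show ?thesis
        by (cases "0 < q x") (simp_all add: P_def cone_weight_def q_def[symmetric] mult_ac del: power_Suc)
    qed
    have "(\<integral>\<^sup>+x. of_bool (0 < q x) * ennreal (q x ^ (m + 1)) * P (q x * \<tau>) x \<partial>lborel) =
       ennreal (\<bar>1 / \<nu>\<bar> ^ DIM(real \<times> real)) *
         (\<integral>\<^sup>+x. of_bool (0 < q ((1 / \<nu>) *\<^sub>R x)) * ennreal (q ((1 / \<nu>) *\<^sub>R x) ^ (m + 1)) *
           P (q ((1 / \<nu>) *\<^sub>R x) * \<tau>) ((1 / \<nu>) *\<^sub>R x) \<partial>lborel)"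
      by (rule nn_integral_lborel_scale) (measurable, use \<nu>(1) in simp)
    also have "(\<integral>\<^sup>+x. of_bool (0 < q ((1 / \<nu>) *\<^sub>R x)) * ennreal (q ((1 / \<nu>) *\<^sub>R x) ^ (m + 1)) *
           P (q ((1 / \<nu>) *\<^sub>R x) * \<tau>) ((1 / \<nu>) *\<^sub>R x) \<partial>lborel) =
         ennreal (1 / \<nu> ^ (m + 1)) * (\<integral>\<^sup>+x. cone_weight \<kappa> k1 k2 m (S / \<nu>, C / \<nu>) x \<partial>lborel)"
      by (simp only: sc[OF refl]) (rule nn_integral_cmult, measurable)
    also have "ennreal (\<bar>1 / \<nu>\<bar> ^ DIM(real \<times> real)) * \<dots> = ennreal (\<bar>1 / \<nu>\<bar> ^ DIM(real \<times> real) * (1 / \<nu> ^ (m + 1))) *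
         (\<integral>\<^sup>+x. cone_weight \<kappa> k1 k2 m (S / \<nu>, C / \<nu>) x \<partial>lborel)"
      using \<nu>(1) by (simp only: ennreal_mult mult.assoc zero_le_power abs_ge_zero zero_le_divide_1_iff less_imp_le)
    also have "\<bar>1 / \<nu>\<bar> ^ DIM(real \<times> real) * (1 / \<nu> ^ (m + 1)) = 1 / \<nu> ^ (m + 3)"
      using \<nu>(1) by (simp add: power_add eval_nat_numeral)
    finally show ?thesis using True by (simp flip: \<nu>_def)
  qed
  have "(\<integral>\<^sup>+t. ennreal (t ^ m) * indicator {0<..} t *
      (\<integral>\<^sup>+\<alpha>. \<integral>\<^sup>+\<beta>. of_bool (in_cone_coord \<kappa> k1 k2 S C t \<alpha> \<beta>) \<partial>lborel \<partial>lborel) \<partial>lborel) =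
     (\<integral>\<^sup>+t. \<integral>\<^sup>+x. ennreal (t ^ m) * indicator {0<..} t * P t x \<partial>lborel \<partial>lborel)"
    by (simp add: nn_integral_cmult nn_integral_plane) (simp add: P_def)
  also have "\<dots> = (\<integral>\<^sup>+x. \<integral>\<^sup>+t. ennreal (t ^ m) * indicator {0<..} t * P t x \<partial>lborel \<partial>lborel)"
    by (rule nn_integral_lborel_Fubini) measurable
  also have "\<dots> = (\<integral>\<^sup>+x. \<integral>\<^sup>+\<tau>. ennreal (\<tau> ^ m) * indicator {0<..} \<tau> *
        (of_bool (0 < q x) * ennreal (q x ^ (m + 1)) * P (q x * \<tau>) x) \<partial>lborel \<partial>lborel)"
    by (simp only: 1)
  also have "\<dots> = (\<integral>\<^sup>+\<tau>. \<integral>\<^sup>+x. ennreal (\<tau> ^ m) * indicator {0<..} \<tau> *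
        (of_bool (0 < q x) * ennreal (q x ^ (m + 1)) * P (q x * \<tau>) x) \<partial>lborel \<partial>lborel)"
    by (rule nn_integral_lborel_Fubini) measurable
  also have "\<dots> = (\<integral>\<^sup>+\<tau>. ennreal (\<tau> ^ m) * indicator {0<..} \<tau> *
        (\<integral>\<^sup>+x. of_bool (0 < q x) * ennreal (q x ^ (m + 1)) * P (q x * \<tau>) x \<partial>lborel) \<partial>lborel)"
    by (simp add: nn_integral_cmult)
  finally show ?thesis by (simp only: 2)
qed

section \<open>Comparison of field and mass\<close>

text \<open>By \<open>in_cone_outside\<close> the restriction to a half plane is automatic. Without
  it the integral depends on the projected center only through its norm, so the center can be
  rotated to the multiple of \<open>(S, C)\<close> of the same norm, the shape in which centers
  occur in \<open>nn_integral_cone_coord\<close>. The two vectors have positive product, so the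
  rotation exists.\<close>

lemma nn_integral_cone_weight_rotate:
  assumes S: "0 < S" and unit: "C\<^sup>2 + \<kappa> * S\<^sup>2 = 1"
    and \<kappa>: "\<kappa> = 1 \<and> \<bar>C\<bar> < k1 \<or> \<kappa> = - 1 \<and> 0 < k1 \<and> 0 < k2 \<and> k2 < C"
  shows "(\<integral>\<^sup>+x. of_bool (0 < fst x) * cone_weight \<kappa> k1 k2 m (S / sqrt (1 + \<tau>\<^sup>2), C) x \<partial>lborel) =
    (\<integral>\<^sup>+x. cone_weight \<kappa> k1 k2 m (sqrt (1 + C\<^sup>2 * \<tau>\<^sup>2) / sqrt (1 + \<tau>\<^sup>2) * S, sqrt (1 + C\<^sup>2 * \<tau>\<^sup>2) / sqrt (1 + \<tau>\<^sup>2) * C) x \<partial>lborel)"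
proof -
  define \<nu> \<mu> where "\<nu> = sqrt (1 + \<tau>\<^sup>2)" and "\<mu> = sqrt (1 + C\<^sup>2 * \<tau>\<^sup>2) / sqrt (1 + \<tau>\<^sup>2)"
  have 1: "1 \<le> \<nu>" by (simp add: \<nu>_def)
  have \<nu>2: "\<nu>\<^sup>2 = 1 + \<tau>\<^sup>2" by (simp add: \<nu>_def)
  have "0 < 1 + C\<^sup>2 * \<tau>\<^sup>2" by (simp add: add_pos_nonneg)
  then have \<mu>: "0 < \<mu>" "\<mu>\<^sup>2 = (1 + C\<^sup>2 * \<tau>\<^sup>2) / \<nu>\<^sup>2"
    using 1 by (simp_all add: \<mu>_def power_divide \<nu>_def add_pos_nonneg)
  have S': "0 < S / \<nu>" "S / \<nu> \<le> S" using 1 S by (simp_all add: divide_simps mult_le_cancel_left1)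
  have SC: "S < C" if "\<kappa> = - 1"
  proof -
    have "S\<^sup>2 < C\<^sup>2" using unit that by simp
    then show ?thesis using that \<kappa> by (auto intro: power2_less_imp_less)
  qed
  have fst: "0 < fst x" if "in_cone \<kappa> k1 k2 (S / \<nu>, C) x" for x
    using in_cone_outside[of \<kappa> C k1 k2 "S / \<nu>" "fst x" "snd x"] that S' \<kappa> SC by auto
  have "(\<integral>\<^sup>+x. of_bool (0 < fst x) * cone_weight \<kappa> k1 k2 m (S / \<nu>, C) x \<partial>lborel) =
      (\<integral>\<^sup>+x. cone_weight \<kappa> k1 k2 m (S / \<nu>, C) x \<partial>lborel)"
    using fst by (intro nn_integral_cong) (auto simp: cone_weight_def)
  also have "\<dots> = (\<integral>\<^sup>+x. cone_weight \<kappa> k1 k2 m (\<mu> * S, \<mu> * C) x \<partial>lborel)"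
  proof -
    have "form \<kappa> (\<mu> * S, \<mu> * C) (\<mu> * S, \<mu> * C) = \<mu>\<^sup>2 * (C\<^sup>2 + \<kappa> * S\<^sup>2)"
      by (simp add: form_real power2_eq_square algebra_simps)
    then have n: "form \<kappa> (\<mu> * S, \<mu> * C) (\<mu> * S, \<mu> * C) = \<mu>\<^sup>2" by (simp add: unit)
    have "form \<kappa> (S / \<nu>, C) (S / \<nu>, C) = (C\<^sup>2 * \<nu>\<^sup>2 + \<kappa> * S\<^sup>2) / \<nu>\<^sup>2"
      using 1 by (simp add: form_real power2_eq_square field_simps)
    also have "C\<^sup>2 * \<nu>\<^sup>2 + \<kappa> * S\<^sup>2 = 1 + C\<^sup>2 * \<tau>\<^sup>2" using unit by (simp add: \<nu>2 algebra_simps)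
    finally have n': "form \<kappa> (S / \<nu>, C) (S / \<nu>, C) = \<mu>\<^sup>2" by (simp add: \<mu>)
    have "0 < C * C + \<kappa> * (S / \<nu> * S)" using \<kappa>
    proof
      assume "\<kappa> = 1 \<and> \<bar>C\<bar> < k1"
      then show ?thesis using mult_pos_pos[OF S'(1) S] zero_le_square[of C] by (simp add: add_nonneg_pos)
    next
      assume "\<kappa> = - 1 \<and> 0 < k1 \<and> 0 < k2 \<and> k2 < C"
      moreover have "S / \<nu> * S \<le> S * S" using S S' by (intro mult_right_mono) auto
      ultimately show ?thesis using unit by (simp add: power2_eq_square)
    qed
    then have "0 < \<mu> * (C * C + \<kappa> * (S / \<nu> * S))" using \<mu> by simp
    also have "\<dots> = form \<kappa> (S / \<nu>, C) (\<mu> * S, \<mu> * C)" by (simp add: form_real algebra_simps)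
    finally have p: "0 < form \<kappa> (S / \<nu>, C) (\<mu> * S, \<mu> * C)" .
    have ne: "form \<kappa> (\<mu> * S, \<mu> * C) (\<mu> * S, \<mu> * C) + form \<kappa> (S / \<nu>, C) (\<mu> * S, \<mu> * C) \<noteq> 0"
      using p unfolding n by (smt (verit) zero_le_power2)
    define g :: "real \<times> real \<Rightarrow> ennreal" where
      "g z = of_bool (0 < fst z \<and> fst z \<le> 1 \<and> k1 * sqrt (fst z) \<le> snd z \<and> snd z \<le> k2 * sqrt (fst z)) *
        ennreal (sqrt (fst z) ^ (m + 1))" for z
    have "g \<in> borel_measurable (borel \<Otimes>\<^sub>M borel)" unfolding g_def by measurable
    then have "g \<in> borel_measurable borel" by (simp add: borel_prod)
    from nn_integral_form_rotate[OF this _ ne] show ?thesis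
      by (simp add: n n' g_def cone_weight_def in_cone_def)
  qed
  finally show ?thesis by (simp add: \<nu>_def \<mu>_def)
qed

text \<open>The quotient rule produces the numerator
  \<open>S * (w * w - C\<^sup>2 * \<tau>\<^sup>2)\<close>, in which the bracket is 1.\<close>

lemma has_real_derivative_projective:
  "((\<lambda>\<tau>. S * \<tau> / sqrt (1 + C\<^sup>2 * \<tau>\<^sup>2)) has_real_derivative S / sqrt (1 + C\<^sup>2 * \<tau>\<^sup>2) ^ 3) (at \<tau>)"
proof -
  define w where "w = sqrt (1 + C\<^sup>2 * \<tau>\<^sup>2)"
  have p: "0 < 1 + C\<^sup>2 * \<tau>\<^sup>2" by (simp add: add_pos_nonneg)
  then have w: "0 < w" "w * w = 1 + C\<^sup>2 * \<tau>\<^sup>2" by (simp_all add: w_def)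
  have "((\<lambda>\<tau>. S * \<tau> / sqrt (1 + C\<^sup>2 * \<tau>\<^sup>2)) has_real_derivative
      (S * w - S * \<tau> * (inverse w / 2 * (C\<^sup>2 * (2 * \<tau>)))) / (w * w)) (at \<tau>)"
    unfolding w_def by (rule derivative_eq_intros refl p | use p in simp)+
  also have "(S * w - S * \<tau> * (inverse w / 2 * (C\<^sup>2 * (2 * \<tau>)))) / (w * w) = S * (w * w - C\<^sup>2 * \<tau>\<^sup>2) / w ^ 3"
    using w(1) by (simp add: field_simps eval_nat_numeral)
  also have "\<dots> = S / w ^ 3" by (simp add: w)
  finally show ?thesis by (simp add: w_def)
qed

text \<open>
  With \<open>t = \<bar>\<alpha>\<bar> \<tau>\<close> in the field and \<open>t = q \<tau>'\<close> in the mass, \<open>q\<close> being the norm of the planar part, the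
  planar integrals depend on \<open>(1 + C\<^sup>2 \<tau>\<^sup>2) / (1 + \<tau>\<^sup>2)\<close> and on \<open>1 / (1 + \<kappa> \<tau>'\<^sup>2)\<close>. Equating the two
  gives the substitution \<open>\<tau>' = S \<tau> / sqrt (1 + C\<^sup>2 \<tau>\<^sup>2)\<close>; beyond \<open>\<tau> = T\<close> both integrands vanish.
\<close>

lemma cone_coord_integral_outside:
  assumes S: "0 < S" and unit: "C\<^sup>2 + \<kappa> * S\<^sup>2 = 1"
    and \<kappa>: "\<kappa> = 1 \<and> \<bar>C\<bar> < k1 \<and> k1 < 1 \<or> \<kappa> = - 1 \<and> 0 < k1 \<and> 1 < k2 \<and> k2 < C"
  shows "ennreal (S ^ (m + 1)) * (\<integral>\<^sup>+t. ennreal (t ^ m) * indicator {0<..} t *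
      (\<integral>\<^sup>+\<alpha>. \<integral>\<^sup>+\<beta>. ennreal (field_coord \<kappa> k1 k2 m S C t \<alpha> \<beta>) \<partial>lborel \<partial>lborel) \<partial>lborel) =
    (\<integral>\<^sup>+t. ennreal (t ^ m) * indicator {0<..} t *
      (\<integral>\<^sup>+\<alpha>. \<integral>\<^sup>+\<beta>. of_bool (in_cone_coord \<kappa> k1 k2 S C t \<alpha> \<beta>) \<partial>lborel \<partial>lborel) \<partial>lborel)"
proof -
  define W where "W \<mu> = (\<integral>\<^sup>+x. cone_weight \<kappa> k1 k2 m (\<mu> * S, \<mu> * C) x \<partial>lborel)" for \<mu>
  have [measurable]: "(\<lambda>x. W (f x)) \<in> borel_measurable M"
    if [measurable]: "f \<in> borel_measurable M" for f and M :: "'z measure"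
    unfolding W_def by measurable
  \<comment> \<open>The bound that fails for distant planes: the lower one for \<kappa> = 1, the
    upper one for \<kappa> = - 1.\<close>
  define k where "k = (if \<kappa> = 1 then k1 else k2)"
  have k: "0 < k" using \<kappa> by (auto simp: k_def)
  have C: "C\<^sup>2 < k\<^sup>2 \<and> k\<^sup>2 < 1" if "\<kappa> = 1"
    using that \<kappa> power2_strict_mono[of C k] power2_strict_mono[of k 1] by (auto simp: k_def)
  have C': "k\<^sup>2 < C\<^sup>2 \<and> 1 < k\<^sup>2" if "\<kappa> = - 1"
    using that \<kappa> power2_strict_mono[of k C] power2_strict_mono[of 1 k] by (auto simp: k_def)
  have \<kappa>1: "\<kappa> = 1 \<or> \<kappa> = - 1" using \<kappa> by auto
  have W0: "W \<mu> = 0" if "0 < \<mu>" "\<kappa> * \<mu>\<^sup>2 < \<kappa> * k\<^sup>2" for \<mu>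
  proof -
    have "form \<kappa> (\<mu> * S, \<mu> * C) (\<mu> * S, \<mu> * C) = \<mu>\<^sup>2 * (C\<^sup>2 + \<kappa> * S\<^sup>2)"
      by (simp add: form_real power2_eq_square algebra_simps)
    then have "form \<kappa> (\<mu> * S, \<mu> * C) (\<mu> * S, \<mu> * C) = \<mu>\<^sup>2" by (simp add: unit)
    then have "\<not> in_cone \<kappa> k1 k2 (\<mu> * S, \<mu> * C) x" for x
      using that \<kappa> by (intro in_cone_empty) (auto simp: k_def)
    then show ?thesis by (simp add: W_def cone_weight_def)
  qed
  \<comment> \<open>\<open>T\<close> solves
    \<open>(1 + C\<^sup>2 * T\<^sup>2) / (1 + T\<^sup>2) = k\<^sup>2\<close>, that is, the projected
    center has norm exactly \<open>k\<close>. Numerator and denominator of the radicand are both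
    positive for \<kappa> = 1 and both negative for \<kappa> = - 1.\<close>
  define T where "T = sqrt ((1 - k\<^sup>2) / (k\<^sup>2 - C\<^sup>2))"
  have "0 < (1 - k\<^sup>2) / (k\<^sup>2 - C\<^sup>2)" using \<kappa>1 C C' by (auto simp: zero_less_divide_iff)
  then have T: "0 < T" "T\<^sup>2 = (1 - k\<^sup>2) / (k\<^sup>2 - C\<^sup>2)" by (simp_all add: T_def)
  define w \<nu> where "w \<tau> = sqrt (1 + C\<^sup>2 * \<tau>\<^sup>2)" and "\<nu> \<tau> = sqrt (1 + \<tau>\<^sup>2)" for \<tau>
  have w: "0 < w \<tau>" "(w \<tau>)\<^sup>2 = 1 + C\<^sup>2 * \<tau>\<^sup>2" and \<nu>: "0 < \<nu> \<tau>" "(\<nu> \<tau>)\<^sup>2 = 1 + \<tau>\<^sup>2" for \<tau>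
    by (simp_all add: w_def \<nu>_def add_pos_nonneg)
  have [measurable]: "w \<in> borel_measurable borel" "\<nu> \<in> borel_measurable borel"
    unfolding w_def \<nu>_def by measurable
  define g where "g \<tau> = S * \<tau> / w \<tau>" for \<tau>
  \<comment> \<open>The relation \<open>C\<^sup>2 + \<kappa> * S\<^sup>2 = 1\<close> enters here: it
    matches the scaling factor of the center in the mass at \<open>g \<tau>\<close> with the one in
    the field at \<tau>.\<close>
  have g2: "1 + \<kappa> * (g \<tau>)\<^sup>2 = (\<nu> \<tau> / w \<tau>)\<^sup>2" for \<tau>
  proof -
    have "1 + \<kappa> * (g \<tau>)\<^sup>2 = (1 + (C\<^sup>2 + \<kappa> * S\<^sup>2) * \<tau>\<^sup>2) / (w \<tau>)\<^sup>2"
      using w(1)[of \<tau>] by (simp add: g_def power_divide divide_simps) (simp add: w(2) power_mult_distrib algebra_simps)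
    then show ?thesis by (simp add: unit power_divide \<nu>(2))
  qed
  have \<mu>T: "\<kappa> * (w \<tau> / \<nu> \<tau>)\<^sup>2 < \<kappa> * k\<^sup>2" if "T < \<tau>" for \<tau>
  proof -
    have "T\<^sup>2 < \<tau>\<^sup>2" using that T by (intro power_strict_mono) auto
    then have "(1 - k\<^sup>2) / (k\<^sup>2 - C\<^sup>2) < \<tau>\<^sup>2" by (simp add: T)
    then have "\<kappa> * (1 + C\<^sup>2 * \<tau>\<^sup>2) < \<kappa> * k\<^sup>2 * (1 + \<tau>\<^sup>2)"
      using \<kappa>1 C C' by (auto simp: pos_divide_less_eq neg_divide_less_eq algebra_simps)
    moreover have "0 < 1 + \<tau>\<^sup>2" by (simp add: add_pos_nonneg)
    ultimately show ?thesis by (simp add: power_divide w(2) \<nu>(2) divide_simps)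
  qed
  have wT: "(w T / \<nu> T)\<^sup>2 = k\<^sup>2"
  proof -
    have "k\<^sup>2 \<noteq> C\<^sup>2" using \<kappa>1 C C' by auto
    then have "T\<^sup>2 * (k\<^sup>2 - C\<^sup>2) = 1 - k\<^sup>2" by (simp add: T)
    then have "1 + C\<^sup>2 * T\<^sup>2 = k\<^sup>2 * (1 + T\<^sup>2)" by (simp add: algebra_simps)
    moreover have "0 < 1 + T\<^sup>2" by (simp add: add_pos_nonneg)
    ultimately show ?thesis by (simp add: power_divide w(2) \<nu>(2))
  qed
  define \<Psi> where "\<Psi> \<tau> = ennreal (\<tau> ^ m) * indicator {0<..} \<tau> * (of_bool (0 < 1 + \<kappa> * \<tau>\<^sup>2) *
      ennreal (1 / sqrt (1 + \<kappa> * \<tau>\<^sup>2) ^ (m + 3)) * W (1 / sqrt (1 + \<kappa> * \<tau>\<^sup>2)))" for \<tau>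
  have [measurable]: "\<Psi> \<in> borel_measurable borel" unfolding \<Psi>_def by measurable
  have mass: "(\<integral>\<^sup>+t. ennreal (t ^ m) * indicator {0<..} t *
      (\<integral>\<^sup>+\<alpha>. \<integral>\<^sup>+\<beta>. of_bool (in_cone_coord \<kappa> k1 k2 S C t \<alpha> \<beta>) \<partial>lborel \<partial>lborel) \<partial>lborel) = (\<integral>\<^sup>+\<tau>. \<Psi> \<tau> \<partial>lborel)"
  proof -
    have "0 < k1" using \<kappa> by auto
    then show ?thesis
      unfolding \<Psi>_def W_def
      by (simp only: nn_integral_cone_coord[OF \<kappa>1] times_divide_eq_left mult_1)
  qed
  have supp: "\<Psi> \<tau> = 0" if "\<not> (0 \<le> \<tau> \<and> \<tau> \<le> g T)" for \<tau>
  proof (cases "0 < \<tau> \<and> 0 < 1 + \<kappa> * \<tau>\<^sup>2")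
    case True
    then have "g T < \<tau>" using that by auto
    moreover have "0 \<le> g T" using S T w[of T] by (simp add: g_def)
    ultimately have "(g T)\<^sup>2 < \<tau>\<^sup>2" by (intro power_strict_mono) auto
    moreover have "1 + \<kappa> * (g T)\<^sup>2 = 1 / k\<^sup>2"
    proof -
      have "(\<nu> T / w T)\<^sup>2 = 1 / (w T / \<nu> T)\<^sup>2" by (simp add: power_divide)
      then show ?thesis by (simp only: g2 wT)
    qed
    ultimately have "\<kappa> * (1 / k\<^sup>2) < \<kappa> * (1 + \<kappa> * \<tau>\<^sup>2)" using \<kappa>1 by auto
    then have "\<kappa> * (1 / (1 + \<kappa> * \<tau>\<^sup>2)) < \<kappa> * k\<^sup>2" using \<kappa>1 True k by (auto simp: field_simps)
    then have "W (1 / sqrt (1 + \<kappa> * \<tau>\<^sup>2)) = 0"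
      using True by (intro W0) (auto simp: power_divide)
    then show ?thesis by (simp add: \<Psi>_def)
  qed (auto simp: \<Psi>_def)
  have field: "(\<integral>\<^sup>+t. ennreal (t ^ m) * indicator {0<..} t *
      (\<integral>\<^sup>+\<alpha>. \<integral>\<^sup>+\<beta>. ennreal (field_coord \<kappa> k1 k2 m S C t \<alpha> \<beta>) \<partial>lborel \<partial>lborel) \<partial>lborel) =
    (\<integral>\<^sup>+\<tau>. ennreal (\<tau> ^ m) * indicator {0<..} \<tau> * (ennreal (1 / \<nu> \<tau> ^ (m + 3)) * W (w \<tau> / \<nu> \<tau>)) \<partial>lborel)"
  proof -
    have "(\<integral>\<^sup>+x. of_bool (0 < fst x) * cone_weight \<kappa> k1 k2 m (S / sqrt (1 + \<tau>\<^sup>2), C) x \<partial>lborel) = W (w \<tau> / \<nu> \<tau>)" for \<tau>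
      unfolding W_def w_def \<nu>_def using \<kappa> by (intro nn_integral_cone_weight_rotate[OF S unit]) auto
    then show ?thesis using nn_integral_field_coord[of 1 m \<kappa> k1 k2 S C] by (simp add: \<nu>_def)
  qed
  have eq: "\<Psi> (g \<tau>) * ennreal (S / w \<tau> ^ 3) * indicator {0..T} \<tau> =
      ennreal (S ^ (m + 1)) * (ennreal (\<tau> ^ m) * indicator {0<..} \<tau> * (ennreal (1 / \<nu> \<tau> ^ (m + 3)) * W (w \<tau> / \<nu> \<tau>)))" for \<tau>
  proof (cases "0 < \<tau> \<and> \<tau> \<le> T")
    case False
    then consider "\<tau> \<le> 0" | "T < \<tau>" by linarith
    then show ?thesis
    proof cases
      case 1
      then have "g \<tau> \<le> 0" using S w(1)[of \<tau>] by (auto simp: g_def divide_nonpos_pos mult_nonneg_nonpos)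
      then show ?thesis using 1 by (auto simp: \<Psi>_def)
    next
      case 2
      have "W (w \<tau> / \<nu> \<tau>) = 0" using \<mu>T[OF 2] w[of \<tau>] \<nu>[of \<tau>] by (intro W0) auto
      then show ?thesis using 2 by simp
    qed
  next
    case True
    have g0: "0 < g \<tau>" using True S w[of \<tau>] by (simp add: g_def)
    have r: "sqrt (1 + \<kappa> * (g \<tau>)\<^sup>2) = \<nu> \<tau> / w \<tau>" "0 < 1 + \<kappa> * (g \<tau>)\<^sup>2"
      using w[of \<tau>] \<nu>[of \<tau>] by (simp_all add: g2)
    \<comment> \<open>The \<open>m + 3\<close> powers of \<open>w \<tau>\<close> cancel against
      \<open>m\<close> from \<open>g \<tau> ^ m\<close> and 3 from the derivative, and
      \<open>S ^ (m + 1)\<close> collects \<open>m\<close> powers from \<open>g\<close> and one from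
      the derivative.\<close>
    have "g \<tau> ^ m * (1 / (\<nu> \<tau> / w \<tau>) ^ (m + 3)) * (S / w \<tau> ^ 3) = S ^ (m + 1) * (\<tau> ^ m * (1 / \<nu> \<tau> ^ (m + 3)))"
      using w(1)[of \<tau>] \<nu>(1)[of \<tau>] by (simp add: g_def power_divide power_mult_distrib power_add field_simps)
    then have A: "ennreal (g \<tau> ^ m) * ennreal (1 / (\<nu> \<tau> / w \<tau>) ^ (m + 3)) * ennreal (S / w \<tau> ^ 3) =
        ennreal (S ^ (m + 1)) * (ennreal (\<tau> ^ m) * ennreal (1 / \<nu> \<tau> ^ (m + 3)))"
      using g0 True w(1)[of \<tau>] \<nu>(1)[of \<tau>] S by (simp add: ennreal_mult[symmetric] del: power_Suc)
    have "\<Psi> (g \<tau>) = ennreal (g \<tau> ^ m) * ennreal (1 / (\<nu> \<tau> / w \<tau>) ^ (m + 3)) * W (w \<tau> / \<nu> \<tau>)"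
      unfolding \<Psi>_def r(1) using g0 r(2) by (simp add: mult.assoc)
    then have "\<Psi> (g \<tau>) * ennreal (S / w \<tau> ^ 3) =
        ennreal (g \<tau> ^ m) * ennreal (1 / (\<nu> \<tau> / w \<tau>) ^ (m + 3)) * ennreal (S / w \<tau> ^ 3) * W (w \<tau> / \<nu> \<tau>)"
      by (simp only: mult_ac)
    then show ?thesis unfolding A using True by (simp add: mult.assoc del: power_Suc)
  qed
  have "(\<integral>\<^sup>+\<tau>. \<Psi> \<tau> \<partial>lborel) = (\<integral>\<^sup>+\<tau>. \<Psi> \<tau> * indicator {g 0..g T} \<tau> \<partial>lborel)"
    using supp by (intro nn_integral_cong) (auto simp: g_def split: split_indicator)
  also have "\<dots> = (\<integral>\<^sup>+\<tau>. \<Psi> (g \<tau>) * ennreal (S / w \<tau> ^ 3) * indicator {0..T} \<tau> \<partial>lborel)"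
  \<comment> \<open>The substitution rule is applied on the compact interval from 0 to
    \<open>T\<close>, which suffices because of \<open>supp\<close> and \<open>eq\<close>.\<close>
  proof (rule nn_integral_substitution_aux)
    show "(g has_real_derivative S / w \<tau> ^ 3) (at \<tau>)" for \<tau>
      unfolding g_def w_def by (rule has_real_derivative_projective)
    show "continuous_on {0..T} (\<lambda>\<tau>. S / w \<tau> ^ 3)"
      using w(1) unfolding w_def by (intro continuous_intros) (auto simp: less_imp_neq[symmetric])
    show "0 \<le> S / w \<tau> ^ 3" for \<tau> using S w(1)[of \<tau>] by simp
  qed (use T in auto)
  also have "\<dots> = ennreal (S ^ (m + 1)) * (\<integral>\<^sup>+\<tau>. ennreal (\<tau> ^ m) * indicator {0<..} \<tau> * (ennreal (1 / \<nu> \<tau> ^ (m + 3)) * W (w \<tau> / \<nu> \<tau>)) \<partial>lborel)"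
    by (simp only: eq) (rule nn_integral_cmult, measurable)
  finally show ?thesis by (simp only: mass field)
qed

text \<open>For each \<tau> the shortened \<open>S / sqrt (1 + \<tau>\<^sup>2)\<close> still meets
  the hypotheses of \<open>nn_integral_cone_weight_inside\<close>, so the positive and negative
  parts agree already for each direction \<tau>.\<close>

lemma cone_coord_integral_inside:
  assumes \<kappa>: "\<kappa> = 1 \<and> 0 < k1 \<and> k2 < C \<or> \<kappa> = - 1 \<and> C < k1 \<and> \<bar>S\<bar> < C" and "0 < C"
  shows "(\<integral>\<^sup>+t. ennreal (t ^ m) * indicator {0<..} t *
      (\<integral>\<^sup>+\<alpha>. \<integral>\<^sup>+\<beta>. ennreal (field_coord \<kappa> k1 k2 m S C t \<alpha> \<beta>) \<partial>lborel \<partial>lborel) \<partial>lborel) =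
    (\<integral>\<^sup>+t. ennreal (t ^ m) * indicator {0<..} t *
      (\<integral>\<^sup>+\<alpha>. \<integral>\<^sup>+\<beta>. ennreal (- field_coord \<kappa> k1 k2 m S C t \<alpha> \<beta>) \<partial>lborel \<partial>lborel) \<partial>lborel)"
proof -
  have "(\<integral>\<^sup>+x. of_bool (0 < fst x) * cone_weight \<kappa> k1 k2 m (S / sqrt (1 + \<tau>\<^sup>2), C) x \<partial>lborel) =
    (\<integral>\<^sup>+x. of_bool (fst x < 0) * cone_weight \<kappa> k1 k2 m (S / sqrt (1 + \<tau>\<^sup>2), C) x \<partial>lborel)" for \<tau>
  proof (rule nn_integral_cone_weight_inside[OF _ \<open>0 < C\<close>])
    have "\<bar>S / sqrt (1 + \<tau>\<^sup>2)\<bar> \<le> \<bar>S\<bar>"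
      by (simp add: abs_divide divide_le_eq mult_le_cancel_left1 add_pos_nonneg)
    then show "\<kappa> = 1 \<and> 0 < k1 \<and> k2 < C \<or> \<kappa> = - 1 \<and> C < k1 \<and> \<bar>S / sqrt (1 + \<tau>\<^sup>2)\<bar> < C"
      using \<kappa> by auto
  qed
  then show ?thesis
    using nn_integral_field_coord[of 1 m \<kappa> k1 k2 S C] nn_integral_field_coord[of "- 1" m \<kappa> k1 k2 S C] by simp
qed

text \<open>The negative part is an integral over half planes pointing away from \<open>c\<close>,
  and by \<open>in_cone_outside\<close> these miss the cone for every \<tau>.\<close>

lemma cone_coord_integral_negative:
  assumes S: "0 < S" and unit: "C\<^sup>2 + \<kappa> * S\<^sup>2 = 1"
    and \<kappa>: "\<kappa> = 1 \<and> \<bar>C\<bar> < k1 \<or> \<kappa> = - 1 \<and> 0 < k1 \<and> 0 < k2 \<and> k2 < C"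
  shows "(\<integral>\<^sup>+t. ennreal (t ^ m) * indicator {0<..} t *
      (\<integral>\<^sup>+\<alpha>. \<integral>\<^sup>+\<beta>. ennreal (- field_coord \<kappa> k1 k2 m S C t \<alpha> \<beta>) \<partial>lborel \<partial>lborel) \<partial>lborel) = 0"
proof -
  have SC: "S < C" if "\<kappa> = - 1"
  proof -
    have "S\<^sup>2 < C\<^sup>2" using unit that by simp
    then show ?thesis using that \<kappa> by (auto intro: power2_less_imp_less)
  qed
  have z: "of_bool (fst x < 0) * cone_weight \<kappa> k1 k2 m (S / sqrt (1 + \<tau>\<^sup>2), C) x = 0" for \<tau> and x :: "real \<times> real"
  proof -
    define \<nu> where "\<nu> = sqrt (1 + \<tau>\<^sup>2)"
    have "1 \<le> \<nu>" by (simp add: \<nu>_def)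
    then have "0 \<le> S / \<nu>" "S / \<nu> \<le> S"
      using S by (simp_all add: divide_simps mult_le_cancel_left1)
    then have "0 \<le> S / sqrt (1 + \<tau>\<^sup>2)" "S / sqrt (1 + \<tau>\<^sup>2) \<le> S"
      by (simp_all only: \<nu>_def)
    then have "in_cone \<kappa> k1 k2 (S / sqrt (1 + \<tau>\<^sup>2), C) x \<Longrightarrow> 0 < fst x"
      using in_cone_outside[of \<kappa> C k1 k2 "S / sqrt (1 + \<tau>\<^sup>2)" "fst x" "snd x"] \<kappa> SC by auto
    then show ?thesis by (auto simp: cone_weight_def)
  qed
  show ?thesis
    using nn_integral_field_coord[of "- 1" m \<kappa> k1 k2 S C] by (simp add: z)
qed

section \<open>The field of a cone\<close>

text \<open>For points of the space the square root is the sine or hyperbolic sine of the distance.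
  Of its \<open>m + 2\<close> powers, \<open>m + 1\<close> come from the law of attraction and one
  normalises the direction.\<close>

definition attraction :: "real \<Rightarrow> nat \<Rightarrow> 'b::euclidean_space \<times> real \<Rightarrow> 'b \<times> real \<Rightarrow> 'b \<times> real" where
  "attraction \<kappa> m p x = (1 / sqrt (\<kappa> * (1 - (form \<kappa> x p)\<^sup>2)) ^ (m + 2)) *\<^sub>R (x - form \<kappa> x p *\<^sub>R p)"

definition unit_point :: "real \<Rightarrow> 'b::euclidean_space \<times> real \<Rightarrow> bool" where
  "unit_point \<kappa> p \<longleftrightarrow> form \<kappa> p p = 1 \<and> (\<kappa> = - 1 \<longrightarrow> 0 < snd p)"

lemma form_one: "form 1 x y = x \<bullet> y"
  by (simp add: form_def inner_prod_def add.commute)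

lemma norm_fst_less_snd:
  assumes "unit_point (- 1) p"
  shows "norm (fst p) < snd p"
proof -
  have "(norm (fst p))\<^sup>2 < (snd p)\<^sup>2"
    unfolding power2_norm_eq_inner using assms by (simp add: unit_point_def form_def power2_eq_square)
  then show ?thesis using assms by (auto simp: unit_point_def intro: power2_less_imp_less)
qed

text \<open>The form is definite on the tangent space at \<open>p\<close>. For \<kappa> = - 1,
  orthogonality turns \<open>snd z * snd p\<close> into \<open>fst z \<bullet> fst p\<close>, and
  Cauchy-Schwarz together with \<open>norm (fst p) < snd p\<close> makes \<open>snd z\<close>
  smaller in absolute value than \<open>norm (fst z)\<close>.\<close>

lemma form_orthogonal_pos:
  assumes \<kappa>: "\<kappa> = 1 \<or> \<kappa> = - 1" and p: "unit_point \<kappa> p" and z: "form \<kappa> z p = 0" "z \<noteq> 0"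
  shows "0 < \<kappa> * form \<kappa> z z"
  using \<kappa>
proof
  assume "\<kappa> = 1"
  then show ?thesis using z(2) by (simp add: form_one)
next
  assume \<kappa>: "\<kappa> = - 1"
  then have np: "norm (fst p) < snd p" using norm_fst_less_snd p by blast
  then have sp: "0 < snd p" using norm_ge_zero[of "fst p"] by linarith
  have eq: "snd z * snd p = fst z \<bullet> fst p" using z(1) \<kappa> by (simp add: form_def)
  have "fst z \<noteq> 0"
  proof
    assume "fst z = 0"
    with eq np norm_ge_zero[of "fst p"] have "snd z = 0" by auto
    with \<open>fst z = 0\<close> z(2) show False by (simp add: prod_eq_iff)
  qed
  have "\<bar>snd z\<bar> * snd p = \<bar>fst z \<bullet> fst p\<bar>"
    unfolding eq[symmetric] using sp by (simp add: abs_mult)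
  also have "\<dots> \<le> norm (fst z) * norm (fst p)" by (rule Cauchy_Schwarz_ineq2)
  also have "\<dots> < norm (fst z) * snd p" using np \<open>fst z \<noteq> 0\<close> by simp
  finally have "\<bar>snd z\<bar> < norm (fst z)" using sp by (simp add: mult_less_cancel_right)
  then have "(snd z)\<^sup>2 < (norm (fst z))\<^sup>2" using power2_strict_mono[of "snd z" "norm (fst z)"] by simp
  then show ?thesis using \<kappa> unfolding power2_norm_eq_inner by (simp add: form_def power2_eq_square)
qed

text \<open>Normalise the component of \<open>c\<close> orthogonal to \<open>p\<close>. If it
  vanishes, any orthogonal direction serves and \<open>S = 0\<close>. For a point \<open>c\<close>
  of the space, \<open>S\<close> is the sine or hyperbolic sine of its distance from
  \<open>p\<close>.\<close>

lemma obtain_transverse_direction: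
  fixes p c :: "'b::euclidean_space \<times> real"
  assumes \<kappa>: "\<kappa> = 1 \<or> \<kappa> = - 1" and p: "unit_point \<kappa> p"
  obtains e S where "form \<kappa> e p = 0" "form \<kappa> e e = \<kappa>" "0 \<le> S" "c = form \<kappa> c p *\<^sub>R p + S *\<^sub>R e"
proof -
  have pp: "form \<kappa> p p = 1" using p by (simp add: unit_point_def)
  obtain z :: "'b \<times> real" and t where z: "form \<kappa> z p = 0" "z \<noteq> 0" "0 \<le> t" "c - form \<kappa> c p *\<^sub>R p = t *\<^sub>R z"
  proof (cases "c - form \<kappa> c p *\<^sub>R p = 0")
    case True
    have "2 \<le> DIM('b \<times> real)" using DIM_positive[where 'a = 'b] by simp
    then obtain z :: "'b \<times> real" where "z \<noteq> 0" "orthogonal (\<kappa> *\<^sub>R fst p, snd p) z"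
      using orthogonal_to_vector_exists by metis
    moreover from this(2) have "form \<kappa> z p = 0"
      by (simp add: orthogonal_def form_def inner_prod_def inner_commute mult.commute)
    ultimately show ?thesis by (intro that[of z 0]) (simp_all add: True)
  next
    case False
    then show ?thesis
      by (intro that[of "c - form \<kappa> c p *\<^sub>R p" 1]) (auto simp: form_simps pp)
  qed
  define l where "l = sqrt (\<kappa> * form \<kappa> z z)"
  have zz: "0 < \<kappa> * form \<kappa> z z" using form_orthogonal_pos[OF \<kappa> p z(1,2)] .
  then have l: "0 < l" "l * l = \<kappa> * form \<kappa> z z" by (simp_all add: l_def)
  show thesis
  proof (rule that[of "(1 / l) *\<^sub>R z" "t * l"])
    have "form \<kappa> z z = \<kappa> * (l * l)" unfolding l(2) using \<kappa> by auto
    then show "form \<kappa> ((1 / l) *\<^sub>R z) ((1 / l) *\<^sub>R z) = \<kappa>"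
      using l(1) by (simp add: form_simps)
    show "c = form \<kappa> c p *\<^sub>R p + (t * l) *\<^sub>R (1 / l) *\<^sub>R z"
      using l z(4) by (simp add: algebra_simps)
  qed (use z l in \<open>auto simp: form_simps\<close>)
qed

lemma integral_form_left:
  assumes "integrable M f"
  shows "integrable M (\<lambda>x. form \<kappa> (f x) z)" "form \<kappa> (\<integral>x. f x \<partial>M) z = (\<integral>x. form \<kappa> (f x) z \<partial>M)"
proof -
  define l where "l = (\<kappa> *\<^sub>R fst z, snd z)"
  have l: "form \<kappa> x z = x \<bullet> l" for x
    by (simp add: l_def form_def inner_prod_def)
  show "integrable M (\<lambda>x. form \<kappa> (f x) z)" unfolding l using assms by simp
  show "form \<kappa> (\<integral>x. f x \<partial>M) z = (\<integral>x. form \<kappa> (f x) z \<partial>M)"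
    unfolding l using assms by (simp add: integral_inner_left)
qed

text \<open>The attraction pulled back to the cone by radial projection. Up to a constant factor,
  its Lebesgue integral is the field of the shell.\<close>

definition cone_field :: "real \<Rightarrow> real \<Rightarrow> real \<Rightarrow> nat \<Rightarrow> 'b::euclidean_space \<times> real \<Rightarrow> 'b \<times> real \<Rightarrow> 'b \<times> real \<Rightarrow> 'b \<times> real" where
  "cone_field \<kappa> k1 k2 m c p x = of_bool (in_cone \<kappa> k1 k2 c x) *\<^sub>R attraction \<kappa> m p (x /\<^sub>R sqrt (form \<kappa> x x))"

lemma cone_field_eq:
  assumes \<kappa>: "\<kappa> = 1 \<or> \<kappa> = - 1"
  shows "cone_field \<kappa> k1 k2 m c p x =
    (of_bool (in_cone \<kappa> k1 k2 c x) * sqrt (form \<kappa> x x) ^ (m + 1) / sqrt (\<kappa> * (form \<kappa> x x - (form \<kappa> x p)\<^sup>2)) ^ (m + 2)) *\<^sub>R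
      (x - form \<kappa> x p *\<^sub>R p)"
proof (cases "in_cone \<kappa> k1 k2 c x")
  case True
  define r where "r = sqrt (form \<kappa> x x)"
  have r: "0 < r" "r * r = form \<kappa> x x" using True by (simp_all add: r_def in_cone_def)
  have "\<kappa> * (1 - (form \<kappa> x p / r)\<^sup>2) = \<kappa> * (form \<kappa> x x - (form \<kappa> x p)\<^sup>2) / r\<^sup>2"
    using r by (simp add: power_divide field_simps) (simp add: power2_eq_square)
  moreover have "form \<kappa> (x /\<^sub>R r) p = form \<kappa> x p / r" by (simp add: form_simps divide_inverse mult.commute)
  ultimately have s: "sqrt (\<kappa> * (1 - (form \<kappa> (x /\<^sub>R r) p)\<^sup>2)) = sqrt (\<kappa> * (form \<kappa> x x - (form \<kappa> x p)\<^sup>2)) / r"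
    using r(1) by (simp add: real_sqrt_divide)
  have "x /\<^sub>R r - form \<kappa> (x /\<^sub>R r) p *\<^sub>R p = (1 / r) *\<^sub>R (x - form \<kappa> x p *\<^sub>R p)"
    by (simp add: form_simps algebra_simps divide_inverse)
  then show ?thesis
    using True r(1) by (simp add: cone_field_def attraction_def r_def[symmetric] s power_divide)
qed (simp add: cone_field_def)

text \<open>Reflection in the hyperplane orthogonal to \<open>u\<close> preserves the cone and the point \<open>p\<close>.\<close>

lemma form_integral_cone_field_orthogonal:
  assumes \<kappa>: "\<kappa> = 1 \<or> \<kappa> = - 1" and int: "integrable lborel (cone_field \<kappa> k1 k2 m c p)"
    and u: "form \<kappa> u u \<noteq> 0" "form \<kappa> u p = 0" "form \<kappa> u c = 0"
  shows "form \<kappa> (\<integral>x. cone_field \<kappa> k1 k2 m c p x \<partial>lborel) u = 0"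
proof -
  define h where "h x = form \<kappa> (cone_field \<kappa> k1 k2 m c p x) u" for x
  define R where "R x = x - (2 * form \<kappa> x u / form \<kappa> u u) *\<^sub>R u" for x
  have RR: "form \<kappa> (R x) (R y) = form \<kappa> x y" for x y
    unfolding R_def by (rule form_reflection_reflection[OF u(1)])
  have R: "form \<kappa> (R x) p = form \<kappa> x p" "form \<kappa> (R x) c = form \<kappa> x c" "form \<kappa> (R x) u = - form \<kappa> x u" for x
    using u by (simp_all add: R_def form_simps)
  have hR: "h (R x) = - h x" for x
    unfolding h_def cone_field_eq[OF \<kappa>]
    by (simp add: form_simps R RR u(2) form_commute[of \<kappa> p u] in_cone_def)
  have h: "integrable lborel h" unfolding h_def by (rule integral_form_left[OF int])
  then have [measurable]: "h \<in> borel_measurable borel" by auto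
  have "(\<integral>\<^sup>+x. ennreal (h x) \<partial>lborel) = (\<integral>\<^sup>+x. ennreal (h (R x)) \<partial>lborel)"
    unfolding R_def by (rule nn_integral_form_reflection[OF _ u(1), symmetric]) measurable
  also have "\<dots> = (\<integral>\<^sup>+x. ennreal (- h x) \<partial>lborel)" by (simp only: hR)
  finally have "(\<integral>x. h x \<partial>lborel) = 0" using h by (simp add: real_lebesgue_integral_def)
  then show ?thesis by (simp add: h_def integral_form_left[OF int])
qed

text \<open>Reversed Cauchy-Schwarz: the component of \<open>c\<close> orthogonal to
  \<open>p\<close> has form \<open>1 - (form \<kappa> c p)\<^sup>2\<close>, which is nonpositive.
  Both points lie on the upper sheet, so the product is positive.\<close>

lemma form_unit_pos:
  assumes \<kappa>: "\<kappa> = - 1" and "unit_point \<kappa> p" "unit_point \<kappa> c"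
  shows "1 \<le> form \<kappa> c p"
proof -
  have pp: "form \<kappa> p p = 1" and cc: "form \<kappa> c c = 1" using assms by (auto simp: unit_point_def)
  define z where "z = c - form \<kappa> c p *\<^sub>R p"
  have zp: "form \<kappa> z p = 0" by (simp add: z_def form_simps pp)
  have "form \<kappa> z z = 1 - (form \<kappa> c p)\<^sup>2"
    by (simp add: z_def form_simps pp cc form_commute[of \<kappa> p c] power2_eq_square algebra_simps)
  moreover have "form \<kappa> z z \<le> 0"
    using form_orthogonal_pos[of \<kappa> p z] \<kappa> assms zp by (cases "z = 0") (auto simp: form_def)
  ultimately have "1 \<le> \<bar>form \<kappa> c p\<bar>" using abs_le_square_iff[of 1 "form \<kappa> c p"] by simp
  moreover have "0 < form \<kappa> c p"
  proof -
    have n: "norm (fst p) < snd p" "norm (fst c) < snd c" using assms norm_fst_less_snd by blast+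
    have "fst c \<bullet> fst p \<le> norm (fst c) * norm (fst p)" by (rule norm_cauchy_schwarz)
    also have "\<dots> < snd c * snd p" using n by (intro mult_strict_mono') auto
    finally show ?thesis using \<kappa> by (simp add: form_def)
  qed
  ultimately show ?thesis by simp
qed

text \<open>Attraction is tangent at \<open>p\<close>, so the integral \<open>Y\<close> has no
  component along \<open>p\<close>, and reflections remove every component orthogonal to
  \<open>p\<close> and \<open>c\<close>. The coefficient along \<open>e\<close> splits into positive
  and negative parts, which \<open>nn_integral_cylindrical\<close> evaluates with the same constant
  \<open>K\<close> as the mass. Inside, the parts cancel; outside, the negative part vanishes and
  the positive part is the mass divided by \<open>S ^ (m + 1)\<close>.\<close>

lemma cone_field_integral:
  fixes c p :: "'b::euclidean_space \<times> real"
  assumes dim: "DIM('b) = m + 2" and \<kappa>: "\<kappa> = 1 \<or> \<kappa> = - 1"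
    and p: "unit_point \<kappa> p" and c: "unit_point \<kappa> c"
    and int: "integrable lborel (cone_field \<kappa> k1 k2 m c p)"
  shows "\<kappa> = 1 \<and> 0 < k1 \<and> 0 < k2 \<and> k2 < form \<kappa> c p \<or> \<kappa> = - 1 \<and> form \<kappa> c p < k1 \<Longrightarrow>
      (\<integral>x. cone_field \<kappa> k1 k2 m c p x \<partial>lborel) = 0" (is "?inside \<Longrightarrow> _")
    and "\<kappa> = 1 \<and> \<bar>form \<kappa> c p\<bar> < k1 \<and> k1 < 1 \<or> \<kappa> = - 1 \<and> 0 < k1 \<and> 1 < k2 \<and> k2 < form \<kappa> c p \<Longrightarrow>
      (\<integral>x. cone_field \<kappa> k1 k2 m c p x \<partial>lborel) =
        measure lborel {x. in_cone \<kappa> k1 k2 c x} *\<^sub>R attraction \<kappa> m p c" (is "?outside \<Longrightarrow> _")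
proof -
  define C where "C = form \<kappa> c p"
  obtain e S where e: "form \<kappa> e p = 0" "form \<kappa> e e = \<kappa>" and S: "0 \<le> S" and ceq: "c = C *\<^sub>R p + S *\<^sub>R e"
    unfolding C_def by (rule obtain_transverse_direction[OF \<kappa> p])
  have \<kappa>2: "\<kappa> * \<kappa> = 1" using \<kappa> by auto
  have \<kappa>\<kappa>: "\<kappa> * (\<kappa> * t) = t" for t using \<kappa>2 by (simp flip: mult.assoc)
  have pp: "form \<kappa> p p = 1" and cc: "form \<kappa> c c = 1" using p c by (auto simp: unit_point_def)
  have pe: "form \<kappa> p e = 0" using e(1) by (simp add: form_commute)
  have "form \<kappa> (C *\<^sub>R p + S *\<^sub>R e) (C *\<^sub>R p + S *\<^sub>R e) = C\<^sup>2 + \<kappa> * S\<^sup>2"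
    by (simp add: form_simps pp e pe power2_eq_square)
  then have unit: "C\<^sup>2 + \<kappa> * S\<^sup>2 = 1" by (simp flip: ceq add: cc)
  \<comment> \<open>The coefficients of \<open>x\<close> along \<open>e\<close> and
    \<open>p\<close>, the remaining component and its length. The factor \<kappa> in
    \<open>a\<close> compensates for \<open>form \<kappa> e e = \<kappa>\<close>.\<close>
  define a b y s where "a x = \<kappa> * form \<kappa> x e" and "b x = form \<kappa> x p"
    and "y x = x - a x *\<^sub>R e - b x *\<^sub>R p" and "s x = sqrt (\<kappa> * form \<kappa> (y x) (y x))" for x
  have a: "a (x + t *\<^sub>R e) = a x + t" "a (x + t *\<^sub>R p) = a x" "a (t *\<^sub>R x) = t * a x" for x t
    by (simp_all add: a_def form_simps e pe algebra_simps \<kappa>2)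
  have b: "b (x + t *\<^sub>R e) = b x" "b (x + t *\<^sub>R p) = b x + t" "b (t *\<^sub>R x) = t * b x" for x t
    by (simp_all add: b_def form_simps e pp)
  have y: "y (x + t *\<^sub>R e) = y x" "y (x + t *\<^sub>R p) = y x" "y (t *\<^sub>R x) = t *\<^sub>R y x" for x t
    by (simp_all add: y_def a b algebra_simps)
  have yp: "form \<kappa> (y x) p = 0" and ye: "form \<kappa> (y x) e = 0" for x
    using \<kappa>2 by (simp_all add: y_def form_simps e pe pp b_def a_def algebra_simps)
  have ypos: "0 < \<kappa> * form \<kappa> (y x) (y x)" if "y x \<noteq> 0" for x
    using form_orthogonal_pos[OF \<kappa> p yp that] .
  have ynn: "0 \<le> \<kappa> * form \<kappa> (y x) (y x)" for x
    using ypos[of x] by (cases "y x = 0") (auto simp: form_def)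
  have [measurable]: "(\<lambda>x. form \<kappa> (f x) z) \<in> borel_measurable M" if [measurable]: "f \<in> borel_measurable M" for f z and M :: "'z measure"
    by measurable
  have [measurable]: "a \<in> borel_measurable borel" "b \<in> borel_measurable borel" "s \<in> borel_measurable borel"
    unfolding a_def b_def y_def s_def by measurable
  have s2: "(s x)\<^sup>2 = \<kappa> * form \<kappa> (y x) (y x)" for x using ynn[of x] by (simp add: s_def)
  have rad: "form \<kappa> x x = cone_radius2 \<kappa> (s x) (a x) (b x)" for x
  proof -
    have "x = y x + a x *\<^sub>R e + b x *\<^sub>R p" by (simp add: y_def)
    then have "form \<kappa> x x = form \<kappa> (y x + a x *\<^sub>R e + b x *\<^sub>R p) (y x + a x *\<^sub>R e + b x *\<^sub>R p)" by simp
    also have "\<dots> = form \<kappa> (y x) (y x) + (a x)\<^sup>2 * \<kappa> + (b x)\<^sup>2"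
      by (simp add: form_simps e pe pp yp ye form_commute[of \<kappa> p "y x"] form_commute[of \<kappa> e "y x"] power2_eq_square)
    finally show ?thesis by (simp add: cone_radius2_def s2 algebra_simps \<kappa>\<kappa>)
  qed
  have xc: "form \<kappa> x c = C * b x + \<kappa> * (S * a x)" for x
  proof -
    have "form \<kappa> x c = C * b x + S * form \<kappa> x e" unfolding ceq b_def by (simp add: form_simps)
    then show ?thesis by (simp add: a_def mult.left_commute[of S \<kappa>] \<kappa>\<kappa>)
  qed
  have cone: "in_cone \<kappa> k1 k2 c x = in_cone_coord \<kappa> k1 k2 S C (s x) (a x) (b x)" for x
    by (simp add: in_cone_def in_cone_coord_def rad xc)
  have comp: "\<kappa> * form \<kappa> (cone_field \<kappa> k1 k2 m c p x) e = field_coord \<kappa> k1 k2 m S C (s x) (a x) (b x)" for x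
  proof -
    have den: "\<kappa> * (form \<kappa> x x - (form \<kappa> x p)\<^sup>2) = (s x)\<^sup>2 + (a x)\<^sup>2"
      by (simp add: rad cone_radius2_def b_def[symmetric] \<kappa>\<kappa> add.commute)
    have "\<kappa> * form \<kappa> (cone_field \<kappa> k1 k2 m c p x) e = (of_bool (in_cone \<kappa> k1 k2 c x) *
        sqrt (form \<kappa> x x) ^ (m + 1) / sqrt (\<kappa> * (form \<kappa> x x - (form \<kappa> x p)\<^sup>2)) ^ (m + 2)) * a x"
      by (simp add: cone_field_eq[OF \<kappa>] form_simps pe a_def)
    then show ?thesis
      by (simp only: field_coord_def cone rad[symmetric] den times_divide_eq_left)
  qed
  \<comment> \<open>The length \<open>s\<close> vanishes only on the span of \<open>e\<close> and
    \<open>p\<close>, which is null in dimension \<open>m + 3\<close>.\<close>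
  have pos: "AE x in lborel. 0 < s x"
  proof -
    have "negligible (span {e, p})"
    proof (rule negligible_lowdim)
      have "dim (span {e, p}) \<le> card {e, p}" unfolding dim_span by (rule dim_le_card') simp
      also have "\<dots> \<le> 2" by (simp add: card_insert_if)
      finally show "dim (span {e, p}) < DIM('b \<times> real)" using dim by simp
    qed
    then have "AE x in lebesgue. x \<notin> span {e, p}"
      by (simp add: negligible_iff_null_sets AE_not_in)
    then have "AE x in lebesgue. 0 < s x"
    proof eventually_elim
      case (elim x)
      have "a x *\<^sub>R e + b x *\<^sub>R p \<in> span {e, p}" by (intro span_add span_scale span_base) auto
      with elim have "y x \<noteq> 0" by (auto simp: y_def algebra_simps)
      then show ?case using ypos[of x] by (simp add: s_def)
    qed
    then show ?thesis by (simp add: AE_completion_iff)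
  qed
  obtain K :: ennreal where K: "\<And>\<gamma> :: real \<times> real \<times> real \<Rightarrow> ennreal. \<gamma> \<in> borel_measurable borel \<Longrightarrow>
      (\<integral>\<^sup>+x. \<gamma> (s x, a x, b x) \<partial>lborel) =
       K * (\<integral>\<^sup>+t. ennreal (t ^ m) * indicator {0<..} t * (\<integral>\<^sup>+\<alpha>. \<integral>\<^sup>+\<beta>. \<gamma> (t, \<alpha>, \<beta>) \<partial>lborel \<partial>lborel) \<partial>lborel)"
    by (rule nn_integral_cylindrical[of s a b m e p])
      (use dim pos in \<open>auto simp: a b s_def y form_simps real_sqrt_mult mult.left_commute[of \<kappa>]\<close>)
  define Y where "Y = (\<integral>x. cone_field \<kappa> k1 k2 m c p x \<partial>lborel)"
  define f where "f x = field_coord \<kappa> k1 k2 m S C (s x) (a x) (b x)" for x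
  have "f = (\<lambda>x. \<kappa> * form \<kappa> (cone_field \<kappa> k1 k2 m c p x) e)" by (simp add: fun_eq_iff f_def comp)
  then have f_int: "integrable lborel f" and Ye: "\<kappa> * form \<kappa> Y e = (\<integral>x. f x \<partial>lborel)"
    using integral_form_left[OF int, of \<kappa> e] by (simp_all add: Y_def)
  have Phi: "(\<integral>\<^sup>+x. ennreal (\<sigma> * f x) \<partial>lborel) = K * (\<integral>\<^sup>+t. ennreal (t ^ m) * indicator {0<..} t *
      (\<integral>\<^sup>+\<alpha>. \<integral>\<^sup>+\<beta>. ennreal (\<sigma> * field_coord \<kappa> k1 k2 m S C t \<alpha> \<beta>) \<partial>lborel \<partial>lborel) \<partial>lborel)" for \<sigma>
  proof -
    have "(\<lambda>(t, \<alpha>, \<beta>). ennreal (\<sigma> * field_coord \<kappa> k1 k2 m S C t \<alpha> \<beta>)) \<in> borel_measurable borel"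
      unfolding borel_prod[symmetric] by measurable
    from K[OF this] show ?thesis by (simp add: f_def)
  qed
  have mass: "emeasure lborel {x. in_cone \<kappa> k1 k2 c x} = K * (\<integral>\<^sup>+t. ennreal (t ^ m) * indicator {0<..} t *
      (\<integral>\<^sup>+\<alpha>. \<integral>\<^sup>+\<beta>. of_bool (in_cone_coord \<kappa> k1 k2 S C t \<alpha> \<beta>) \<partial>lborel \<partial>lborel) \<partial>lborel)"
  proof -
    have "{x. in_cone \<kappa> k1 k2 c x} \<in> sets borel" by measurable
    then have "emeasure lborel {x. in_cone \<kappa> k1 k2 c x} = (\<integral>\<^sup>+x. indicator {x. in_cone \<kappa> k1 k2 c x} x \<partial>lborel)"
      by simp
    also have "\<dots> = (\<integral>\<^sup>+x. of_bool (in_cone \<kappa> k1 k2 c x) \<partial>lborel)"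
      by (rule nn_integral_cong) (simp add: indicator_def)
    finally have "emeasure lborel {x. in_cone \<kappa> k1 k2 c x} = (\<integral>\<^sup>+x. of_bool (in_cone \<kappa> k1 k2 c x) \<partial>lborel)" .
    moreover have "(\<lambda>(t, \<alpha>, \<beta>). of_bool (in_cone_coord \<kappa> k1 k2 S C t \<alpha> \<beta>) :: ennreal) \<in> borel_measurable borel"
      unfolding borel_prod[symmetric] by measurable
    from K[OF this] have "(\<integral>\<^sup>+x. of_bool (in_cone \<kappa> k1 k2 c x) \<partial>lborel) = K * (\<integral>\<^sup>+t. ennreal (t ^ m) * indicator {0<..} t *
      (\<integral>\<^sup>+\<alpha>. \<integral>\<^sup>+\<beta>. of_bool (in_cone_coord \<kappa> k1 k2 S C t \<alpha> \<beta>) \<partial>lborel \<partial>lborel) \<partial>lborel)"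
      by (simp add: cone)
    ultimately show ?thesis by simp
  qed
  have Yint: "\<kappa> * form \<kappa> Y e = enn2real (\<integral>\<^sup>+x. ennreal (f x) \<partial>lborel) - enn2real (\<integral>\<^sup>+x. ennreal (- f x) \<partial>lborel)"
    using f_int Ye by (simp add: real_lebesgue_integral_def)
  have Yp: "form \<kappa> Y p = 0"
    unfolding Y_def integral_form_left[OF int] cone_field_eq[OF \<kappa>] by (simp add: form_simps pp)
  \<comment> \<open>A remainder \<open>u\<close> of \<open>Y\<close> after removing its
    \<open>e\<close> component would be orthogonal to \<open>p\<close> and \<open>c\<close>, hence
    to \<open>Y\<close> by reflection; but then
    \<open>form \<kappa> u u = form \<kappa> Y u = 0\<close>, against definiteness.\<close>
  have Ydir: "Y = (\<kappa> * form \<kappa> Y e) *\<^sub>R e"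
  proof (rule ccontr)
    define u where "u = Y - (\<kappa> * form \<kappa> Y e) *\<^sub>R e"
    assume "Y \<noteq> (\<kappa> * form \<kappa> Y e) *\<^sub>R e"
    then have "u \<noteq> 0" by (simp add: u_def)
    have up: "form \<kappa> u p = 0" by (simp add: u_def form_simps Yp e)
    have ue: "form \<kappa> u e = 0"
      using \<kappa>\<kappa>[of "form \<kappa> Y e"] by (simp add: u_def form_simps e mult.commute mult.left_commute)
    have uu: "form \<kappa> u u \<noteq> 0" using form_orthogonal_pos[OF \<kappa> p up \<open>u \<noteq> 0\<close>] by auto
    have "form \<kappa> u c = 0" unfolding ceq by (simp add: form_simps up ue)
    from form_integral_cone_field_orthogonal[OF \<kappa> int uu up this] have "form \<kappa> Y u = 0"
      by (simp add: Y_def)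
    moreover have "form \<kappa> u u = form \<kappa> Y u"
      by (subst (1) u_def) (simp add: form_simps form_commute[of \<kappa> e u] ue)
    ultimately show False using uu by simp
  qed
  {
    assume ?inside
    moreover have "0 < C \<and> \<bar>S\<bar> < C" if "\<kappa> = - 1"
    proof -
      have "1 \<le> C" using form_unit_pos[OF that p c] by (simp add: C_def)
      moreover have "S\<^sup>2 < C\<^sup>2" using unit that by simp
      ultimately show ?thesis using S by (auto intro: power2_less_imp_less)
    qed
    ultimately have "(\<integral>\<^sup>+x. ennreal (f x) \<partial>lborel) = (\<integral>\<^sup>+x. ennreal (- f x) \<partial>lborel)"
      using Phi[of 1] Phi[of "- 1"] cone_coord_integral_inside[of \<kappa> k1 k2 C S m] by (auto simp: C_def)
    then show "(\<integral>x. cone_field \<kappa> k1 k2 m c p x \<partial>lborel) = 0"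
      using Ydir Yint by (simp flip: Y_def)
  next
    assume out: ?outside
    then have out': "\<kappa> = 1 \<and> \<bar>C\<bar> < k1 \<and> k1 < 1 \<or> \<kappa> = - 1 \<and> 0 < k1 \<and> 1 < k2 \<and> k2 < C" by (simp add: C_def)
    \<comment> \<open>\<open>S = 0\<close> would mean that \<open>p\<close> is the center or its
      antipode, which the strict bounds on \<open>C\<close> exclude.\<close>
    have "S \<noteq> 0"
    proof
      assume "S = 0"
      then have "\<bar>C\<bar> = 1" using unit by (auto simp: power2_eq_1_iff)
      then show False using out' by auto
    qed
    with S have S: "0 < S" by simp
    have "(\<integral>\<^sup>+x. ennreal (- f x) \<partial>lborel) = 0"
      using Phi[of "- 1"] cone_coord_integral_negative[OF S unit, of k1 k2 m] out' by auto
    then have Ye': "\<kappa> * form \<kappa> Y e = enn2real (\<integral>\<^sup>+x. ennreal (f x) \<partial>lborel)"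
      by (simp add: Yint)
    have "ennreal (S ^ (m + 1)) * (\<integral>\<^sup>+x. ennreal (f x) \<partial>lborel) = emeasure lborel {x. in_cone \<kappa> k1 k2 c x}"
      unfolding mass cone_coord_integral_outside[OF S unit out', symmetric]
      using Phi[of 1] by (simp add: mult.left_commute[of K])
    then have "S ^ (m + 1) * (\<kappa> * form \<kappa> Y e) = measure lborel {x. in_cone \<kappa> k1 k2 c x}"
      unfolding Ye' measure_def using S by (metis enn2real_mult enn2real_ennreal zero_le_power less_imp_le)
    then have "\<kappa> * form \<kappa> Y e = measure lborel {x. in_cone \<kappa> k1 k2 c x} / S ^ (m + 1)"
      using S by (simp add: nonzero_eq_divide_eq mult.commute del: power_Suc)
    with Ydir have "Y = (measure lborel {x. in_cone \<kappa> k1 k2 c x} / S ^ (m + 1)) *\<^sub>R e"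
      by metis
    moreover have "attraction \<kappa> m p c = (1 / S ^ (m + 1)) *\<^sub>R e"
    proof -
      have "1 - C\<^sup>2 = \<kappa> * S\<^sup>2" using unit by simp
      then have "\<kappa> * (1 - C\<^sup>2) = S\<^sup>2" by (simp only: \<kappa>\<kappa>)
      moreover have "c - C *\<^sub>R p = S *\<^sub>R e" using ceq by (simp add: algebra_simps)
      ultimately show ?thesis using S by (simp add: attraction_def C_def[symmetric])
    qed
    ultimately show "(\<integral>x. cone_field \<kappa> k1 k2 m c p x \<partial>lborel) =
        measure lborel {x. in_cone \<kappa> k1 k2 c x} *\<^sub>R attraction \<kappa> m p c"
      by (simp flip: Y_def)
  }
qed

section \<open>Integrability, and passage from cones to mass distributions\<close>

text \<open>For \<kappa> = - 1 the positive product with \<open>c\<close> puts \<open>x\<close> on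
  the upper sheet. There the product is at least \<open>snd x * (snd c - norm (fst c))\<close>, so
  \<open>k2\<close> bounds \<open>snd x\<close>, which in turn bounds
  \<open>norm (fst x)\<close>.\<close>

lemma bounded_cone_section:
  assumes \<kappa>: "\<kappa> = 1 \<or> \<kappa> = - 1" and c: "unit_point \<kappa> c" and k1: "0 < k1"
  shows "bounded {x. form \<kappa> x x = 1 \<and> k1 \<le> form \<kappa> x c \<and> form \<kappa> x c \<le> k2}"
  using \<kappa>
proof
  assume "\<kappa> = 1"
  then have "norm x \<le> 1" if "form \<kappa> x x = 1" for x :: "'a \<times> real"
    using that by (simp add: form_one norm_eq_sqrt_inner)
  then show ?thesis by (intro boundedI[of _ 1]) auto
next
  assume \<kappa>: "\<kappa> = - 1"
  then have n: "norm (fst c) < snd c" using c norm_fst_less_snd by blast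
  define q where "q = k2 / (snd c - norm (fst c))"
  have "norm x \<le> q + q" if x: "form \<kappa> x x = 1" "k1 \<le> form \<kappa> x c" "form \<kappa> x c \<le> k2" for x
  proof -
    have "(norm (fst x))\<^sup>2 < (snd x)\<^sup>2"
      unfolding power2_norm_eq_inner using x(1) \<kappa> by (simp add: form_def power2_eq_square)
    then have fs: "norm (fst x) < \<bar>snd x\<bar>" by (simp add: power2_less_imp_less)
    have cs: "- (norm (fst x) * norm (fst c)) \<le> fst x \<bullet> fst c" "fst x \<bullet> fst c \<le> norm (fst x) * norm (fst c)"
      using Cauchy_Schwarz_ineq2[of "fst x" "fst c"] by linarith+
    have "0 < snd x"
    proof (rule ccontr)
      assume "\<not> 0 < snd x"
      then have "norm (fst x) \<le> - snd x" using fs by simp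
      moreover from this have "0 \<le> - snd x" using norm_ge_zero[of "fst x"] by linarith
      ultimately have "norm (fst x) * norm (fst c) \<le> - snd x * snd c"
        using n by (intro mult_mono) auto
      then have "form \<kappa> x c \<le> 0" using cs \<kappa> by (simp add: form_def)
      then show False using x k1 by simp
    qed
    with fs have "norm (fst x) * norm (fst c) \<le> snd x * norm (fst c)" by (intro mult_right_mono) auto
    then have "snd x * (snd c - norm (fst c)) \<le> k2"
      using x(3) cs \<kappa> by (simp add: form_def algebra_simps)
    then have "snd x \<le> q" using n by (simp add: q_def pos_le_divide_eq)
    moreover have "norm x \<le> norm (fst x) + norm (snd x)"
      using norm_triangle_ineq[of "(fst x, 0)" "(0, snd x)"] by (simp add: norm_Pair)
    ultimately show ?thesis using fs \<open>0 < snd x\<close> by simp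
  qed
  then show ?thesis by (intro boundedI[of _ "q + q"]) auto
qed

lemma measurable_attraction [measurable]: "attraction \<kappa> m p \<in> borel_measurable borel"
  unfolding attraction_def[abs_def] by measurable

text \<open>The radial projections of the cone lie in the compact set \<open>Z\<close>. By
  \<open>ne\<close> neither \<open>p\<close> nor \<open>- p\<close> belongs to \<open>Z\<close>, so
  the attraction is continuous there and hence bounded. The cone itself is bounded because the
  projection only lengthens its vectors.\<close>

lemma integrable_cone_field:
  fixes c p :: "'b::euclidean_space \<times> real"
  assumes \<kappa>: "\<kappa> = 1 \<or> \<kappa> = - 1" and p: "unit_point \<kappa> p" and c: "unit_point \<kappa> c" and k1: "0 < k1"
    and ne: "\<And>\<sigma>. \<sigma> = 1 \<or> \<sigma> = - 1 \<Longrightarrow> \<not> (k1 \<le> \<sigma> * form \<kappa> p c \<and> \<sigma> * form \<kappa> p c \<le> k2)"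
  shows "emeasure lborel {x. in_cone \<kappa> k1 k2 c x} < \<infinity>"
    and "integrable lborel (cone_field \<kappa> k1 k2 m c p)"
proof -
  define Z where "Z = {x. form \<kappa> x x = 1 \<and> k1 \<le> form \<kappa> x c \<and> form \<kappa> x c \<le> k2}"
  have pp: "form \<kappa> p p = 1" using p by (simp add: unit_point_def)
  have bdd: "bounded Z" unfolding Z_def by (rule bounded_cone_section[OF \<kappa> c k1])
  have "closed Z"
    unfolding Z_def by (intro closed_Collect_conj closed_Collect_eq closed_Collect_le continuous_intros)
  with bdd have "compact Z" by (simp add: compact_eq_bounded_closed)
  have dir: "x /\<^sub>R sqrt (form \<kappa> x x) \<in> Z" if "in_cone \<kappa> k1 k2 c x" for x
  proof -
    define r where "r = sqrt (form \<kappa> x x)"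
    have r: "0 < r" "r * r = form \<kappa> x x" "k1 * r \<le> form \<kappa> x c" "form \<kappa> x c \<le> k2 * r"
      using that by (simp_all add: in_cone_def r_def)
    have "form \<kappa> (x /\<^sub>R r) (x /\<^sub>R r) = 1"
      using r(1) by (simp add: form_simps field_simps r(2)[symmetric])
    moreover have "form \<kappa> (x /\<^sub>R r) c = form \<kappa> x c / r" by (simp add: form_simps divide_inverse mult.commute)
    ultimately show ?thesis
      using r(1,3,4) by (simp add: Z_def pos_le_divide_eq pos_divide_le_eq flip: r_def)
  qed
  have "bounded (attraction \<kappa> m p ` Z)"
  proof (intro compact_imp_bounded compact_continuous_image \<open>compact Z\<close>)
    \<comment> \<open>A zero denominator forces the component of \<open>x\<close> orthogonal to
      \<open>p\<close> to vanish, by definiteness. Then \<open>x\<close> is \<open>p\<close> or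
      \<open>- p\<close>, contrary to \<open>ne\<close>.\<close>
    have "\<kappa> * (1 - (form \<kappa> x p)\<^sup>2) \<noteq> 0" if "x \<in> Z" for x
    proof
      assume 0: "\<kappa> * (1 - (form \<kappa> x p)\<^sup>2) = 0"
      define z where "z = x - form \<kappa> x p *\<^sub>R p"
      have x: "form \<kappa> x x = 1" "k1 \<le> form \<kappa> x c" "form \<kappa> x c \<le> k2" using that by (auto simp: Z_def)
      have "form \<kappa> z z = 1 - (form \<kappa> x p)\<^sup>2"
        by (simp add: z_def form_simps pp x form_commute[of \<kappa> p x] power2_eq_square)
      moreover have "form \<kappa> z p = 0" by (simp add: z_def form_simps pp)
      ultimately have "z = 0" using form_orthogonal_pos[OF \<kappa> p, of z] 0 by auto
      then have "x = form \<kappa> x p *\<^sub>R p" by (simp add: z_def)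
      then have "form \<kappa> x c = form \<kappa> x p * form \<kappa> p c" by (metis form_simps(5))
      moreover have "form \<kappa> x p = 1 \<or> form \<kappa> x p = - 1" using 0 \<kappa> by (auto simp: power2_eq_1_iff)
      ultimately show False using ne x by metis
    qed
    then show "continuous_on Z (attraction \<kappa> m p)"
      unfolding attraction_def[abs_def] by (intro continuous_intros) auto
  qed
  then obtain B where B: "\<And>x. x \<in> Z \<Longrightarrow> norm (attraction \<kappa> m p x) \<le> B"
    by (auto simp: bounded_iff)
  obtain L where L: "\<And>x. x \<in> Z \<Longrightarrow> norm x \<le> L" using bdd by (auto simp: bounded_iff)
  have "norm x \<le> L" if "in_cone \<kappa> k1 k2 c x" for x
  proof -
    define r where "r = sqrt (form \<kappa> x x)"
    have r: "0 < r" "r \<le> 1" using that by (simp_all add: in_cone_def r_def)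
    have "norm (x /\<^sub>R r) \<le> L" using L[OF dir[OF that]] by (simp add: r_def)
    moreover have "norm x = r * norm (x /\<^sub>R r)" using r by simp
    moreover have "\<dots> \<le> 1 * norm (x /\<^sub>R r)" using r by (intro mult_right_mono) auto
    ultimately show ?thesis by linarith
  qed
  then have "bounded {x. in_cone \<kappa> k1 k2 c x}" by (auto simp: bounded_iff)
  then show fin: "emeasure lborel {x. in_cone \<kappa> k1 k2 c x} < \<infinity>"
    by (rule emeasure_bounded_finite)
  have [measurable]: "{x. in_cone \<kappa> k1 k2 c x} \<in> sets borel" by measurable
  have "integrable lborel (\<lambda>x. indicator {x. in_cone \<kappa> k1 k2 c x} x *\<^sub>R B)"
    using fin by (intro integrable_scaleR_left) simp
  then show "integrable lborel (cone_field \<kappa> k1 k2 m c p)"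
  proof (rule Bochner_Integration.integrable_bound)
    show "cone_field \<kappa> k1 k2 m c p \<in> borel_measurable lborel"
      unfolding cone_field_def[abs_def] by measurable
    show "AE x in lborel. norm (cone_field \<kappa> k1 k2 m c p x) \<le> norm (indicator {x. in_cone \<kappa> k1 k2 c x} x *\<^sub>R B)"
    proof (rule AE_I2)
      fix x
      show "norm (cone_field \<kappa> k1 k2 m c p x) \<le> norm (indicator {x. in_cone \<kappa> k1 k2 c x} x *\<^sub>R B)"
      proof (cases "in_cone \<kappa> k1 k2 c x")
        case True
        then show ?thesis using B[OF dir[OF True]] by (simp add: cone_field_def)
      qed (simp add: cone_field_def)
    qed
  qed
qed

text \<open>Unfolding density, image measure and density turns integrals over a shell into Lebesgue
  integrals over its cone. The densities are first rewritten as real functions so that the rules for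
  Bochner integrals apply.\<close>

lemma integral_radial_projection:
  fixes g :: "'v::euclidean_space \<Rightarrow> 'c::{banach, second_countable_topology}"
  assumes [measurable]: "D \<in> sets borel" "A \<in> sets borel" "pr \<in> borel_measurable borel" "g \<in> borel_measurable borel"
    and "0 \<le> n" "0 \<le> \<rho>"
    and "M = density (distr (density lborel (\<lambda>x. ennreal n * indicator D x)) borel pr) (\<lambda>x. ennreal \<rho> * indicator A x)"
  shows "integrable M g \<longleftrightarrow> integrable lborel (\<lambda>x. (n * \<rho> * of_bool (x \<in> D \<and> pr x \<in> A)) *\<^sub>R g (pr x))"
    and "integral\<^sup>L M g = (\<integral>x. (n * \<rho> * of_bool (x \<in> D \<and> pr x \<in> A)) *\<^sub>R g (pr x) \<partial>lborel)"
proof -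
  have 1: "ennreal n * indicator D x = ennreal (n * indicator D x)" for x
    by (auto split: split_indicator)
  have 2: "ennreal \<rho> * indicator A x = ennreal (\<rho> * indicator A x)" for x
    by (auto split: split_indicator)
  have 3: "n * indicator D x * (\<rho> * indicator A (pr x)) = n * \<rho> * of_bool (x \<in> D \<and> pr x \<in> A)" for x
    by (auto split: split_indicator)
  show "integrable M g \<longleftrightarrow> integrable lborel (\<lambda>x. (n * \<rho> * of_bool (x \<in> D \<and> pr x \<in> A)) *\<^sub>R g (pr x))"
    unfolding assms(7) 1 2 using assms(5,6)
    by (subst integrable_density, simp, simp, simp, subst integrable_distr_eq, simp, simp,
        subst integrable_density) (simp_all add: 3)
  show "integral\<^sup>L M g = (\<integral>x. (n * \<rho> * of_bool (x \<in> D \<and> pr x \<in> A)) *\<^sub>R g (pr x) \<partial>lborel)"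
    unfolding assms(7) 1 2 using assms(5,6)
    by (subst integral_density, simp, simp, simp, subst integral_distr, simp, simp,
        subst integral_density) (simp_all add: 3)
qed

text \<open>Both geometries at once: \<open>M\<close> has the common shape of the two shells, and
  \<open>F\<close> stands for the concrete attraction, which has to agree with
  \<open>attraction\<close> only on the shell and at the center. The total mass is computed with the
  same transfer lemma, applied to the constant 1.\<close>

lemma shell_theorem:
  fixes c p :: "'b::euclidean_space \<times> real" and F :: "'b \<times> real \<Rightarrow> 'b \<times> real"
  assumes dim: "DIM('b) = m + 2" and \<kappa>: "\<kappa> = 1 \<or> \<kappa> = - 1"
    and p: "unit_point \<kappa> p" and c: "unit_point \<kappa> c" and k: "0 < k1" "k1 < k2"
    and meas: "D \<in> sets borel" "A \<in> sets borel" "pr \<in> borel_measurable borel" "F \<in> borel_measurable borel"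
    and n: "0 \<le> n" and \<rho>: "0 \<le> \<rho>"
    and M: "M = density (distr (density lborel (\<lambda>x. ennreal n * indicator D x)) borel pr) (\<lambda>x. ennreal \<rho> * indicator A x)"
    and cone: "\<And>x. x \<in> D \<and> pr x \<in> A \<longleftrightarrow> in_cone \<kappa> k1 k2 c x"
    and pr: "\<And>x. in_cone \<kappa> k1 k2 c x \<Longrightarrow> pr x = x /\<^sub>R sqrt (form \<kappa> x x)"
    and F: "\<And>x. in_cone \<kappa> k1 k2 c x \<Longrightarrow> F (pr x) = attraction \<kappa> m p (pr x)" "F c = attraction \<kappa> m p c"
  shows "\<kappa> = 1 \<and> k2 < form \<kappa> c p \<or> \<kappa> = - 1 \<and> form \<kappa> c p < k1 \<Longrightarrow>
      integrable M F \<and> (\<integral>x. F x \<partial>M) = 0" (is "?inside \<Longrightarrow> _")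
    and "\<kappa> = 1 \<and> \<bar>form \<kappa> c p\<bar> < k1 \<and> k1 < 1 \<or> \<kappa> = - 1 \<and> 1 < k2 \<and> k2 < form \<kappa> c p \<Longrightarrow>
      integrable M F \<and> (\<integral>x. F x \<partial>M) = measure M UNIV *\<^sub>R F c" (is "?outside \<Longrightarrow> _")
proof -
  have eq: "(n * \<rho> * of_bool (x \<in> D \<and> pr x \<in> A)) *\<^sub>R F (pr x) = (n * \<rho>) *\<^sub>R cone_field \<kappa> k1 k2 m c p x" for x
    unfolding cone cone_field_def using F(1)[of x] pr[of x]
    by (cases "in_cone \<kappa> k1 k2 c x") simp_all
  note tr = integral_radial_projection[OF meas n \<rho> M, unfolded eq]
  have pc: "form \<kappa> p c = form \<kappa> c p" by (rule form_commute)
  have "(?inside \<or> ?outside) \<Longrightarrow> emeasure lborel {x. in_cone \<kappa> k1 k2 c x} < \<infinity> \<and> integrable lborel (cone_field \<kappa> k1 k2 m c p)"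
  proof -
    assume io: "?inside \<or> ?outside"
    \<comment> \<open>Neither \<open>p\<close> nor its negative belongs to the shell. For \<kappa> =
      - 1 the sign - 1 gives a negative product, by \<open>form_unit_pos\<close>.\<close>
    have "\<not> (k1 \<le> \<sigma> * form \<kappa> p c \<and> \<sigma> * form \<kappa> p c \<le> k2)" if "\<sigma> = 1 \<or> \<sigma> = - 1" for \<sigma>
      using io that k form_unit_pos[OF _ p c] unfolding pc by auto
    from integrable_cone_field[OF \<kappa> p c k(1) this] show ?thesis by auto
  qed
  note fin = this
  have mass: "measure M UNIV = n * \<rho> * measure lborel {x. in_cone \<kappa> k1 k2 c x}"
  proof -
    have [measurable]: "{x. in_cone \<kappa> k1 k2 c x} \<in> sets borel" by measurable
    have "measure M UNIV = (\<integral>x. 1 \<partial>M)" by (simp add: M)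
    also have "\<dots> = (\<integral>x. (n * \<rho>) * indicator {x. in_cone \<kappa> k1 k2 c x} x \<partial>lborel)"
      using integral_radial_projection(2)[OF meas(1-3) _ n \<rho> M, of "\<lambda>_. 1::real"]
      by (simp add: cone indicator_def of_bool_def)
    finally show ?thesis by simp
  qed
  show "integrable M F \<and> (\<integral>x. F x \<partial>M) = 0" if ?inside
    using cone_field_integral(1)[OF dim \<kappa> p c, of k1 k2] fin that k by (auto simp: tr)
  show "integrable M F \<and> (\<integral>x. F x \<partial>M) = measure M UNIV *\<^sub>R F c" if ?outside
    using cone_field_integral(2)[OF dim \<kappa> p c, of k1 k2] fin that k by (auto simp: tr mass F(2))
qed

section \<open>Shells in the two spaces\<close>

text \<open>Outside \<open>{-1..1}\<close> the defining description is satisfied by no number, so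
  \<open>arccos\<close> takes a single value there; on the interval it is continuous.\<close>

lemma borel_measurable_arccos [measurable]: "arccos \<in> borel_measurable borel"
proof -
  have "arccos y = (THE x :: real. False)" if "y \<notin> {-1..1}" for y
  proof -
    have *: "(0 \<le> x \<and> x \<le> pi \<and> cos x = y) = False" for x using that by auto
    show ?thesis by (simp only: arccos_def *)
  qed
  then have "arccos = (\<lambda>y. if y \<in> {-1..1} then arccos y else (THE x :: real. False))" by auto
  moreover have "(\<lambda>y. if y \<in> {-1..1} then arccos y else (THE x :: real. False)) \<in> borel_measurable borel"
    by (intro borel_measurable_continuous_on_if continuous_on_arccos' continuous_intros) auto
  ultimately show ?thesis by simp
qed

lemma borel_measurable_arcosh [measurable]: "(arcosh :: real \<Rightarrow> real) \<in> borel_measurable borel"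
  unfolding arcosh_def[abs_def] by measurable

lemma lorentz_eq_form: "lorentz x y = - form (- 1) x y"
  by (simp add: lorentz_def form_def)

lemma borel_measurable_lorentz [measurable (raw)]:
  assumes [measurable]: "f \<in> borel_measurable M" "g \<in> borel_measurable M"
  shows "(\<lambda>x. lorentz (f x) (g x)) \<in> borel_measurable M"
  unfolding lorentz_eq_form by measurable

lemma borel_measurable_sinh_cosh [measurable]:
  "(sinh :: real \<Rightarrow> real) \<in> borel_measurable borel" "(cosh :: real \<Rightarrow> real) \<in> borel_measurable borel"
  by (intro borel_measurable_continuous_onI continuous_intros)+

lemma measurable_sph_attraction [measurable]: "sph_attraction p \<in> borel_measurable borel"
  unfolding sph_attraction_def[abs_def] sph_dist_def Let_def by measurable

lemma measurable_hyp_attraction [measurable]: "hyp_attraction p \<in> borel_measurable borel"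
  unfolding hyp_attraction_def[abs_def] hyp_dist_def Let_def by measurable

lemma unit_point_sphere: "unit_point 1 p \<longleftrightarrow> p \<in> sphere 0 1"
  by (simp add: unit_point_def form_one norm_eq_1)

lemma unit_point_hyp_space: "unit_point (- 1) p \<longleftrightarrow> p \<in> hyp_space"
  by (simp add: unit_point_def hyp_space_def lorentz_eq_form)

lemma abs_inner_sphere_le: "x \<in> sphere 0 1 \<Longrightarrow> y \<in> sphere 0 1 \<Longrightarrow> \<bar>x \<bullet> y\<bar> \<le> 1"
  using Cauchy_Schwarz_ineq2[of x y] by simp

lemma sph_attraction_eq_attraction:
  fixes p x :: "'a::euclidean_space \<times> real"
  assumes dim: "DIM('a) = m + 2" and "p \<in> sphere 0 1" "x \<in> sphere 0 1"
  shows "sph_attraction p x = attraction 1 m p x"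
proof -
  have b: "\<bar>p \<bullet> x\<bar> \<le> 1" using assms abs_inner_sphere_le by blast
  then have "sin (arccos (p \<bullet> x)) = sqrt (1 - (p \<bullet> x)\<^sup>2)" "cos (arccos (p \<bullet> x)) = p \<bullet> x"
    by (auto simp: sin_arccos_abs)
  then show ?thesis
    by (simp add: sph_attraction_def sph_dist_def Let_def attraction_def form_one dim inner_commute[of x p] divide_inverse mult_ac)
qed

lemma hyp_attraction_eq_attraction:
  fixes p x :: "'a::euclidean_space \<times> real"
  assumes dim: "DIM('a) = m + 2" and "p \<in> hyp_space" "x \<in> hyp_space"
  shows "hyp_attraction p x = attraction (- 1) m p x"
proof -
  have "1 \<le> form (- 1) x p" using assms form_unit_pos[of "- 1" p x] by (simp add: unit_point_hyp_space)
  then have "sinh (arcosh (form (- 1) x p)) = sqrt ((form (- 1) x p)\<^sup>2 - 1)" "cosh (arcosh (form (- 1) x p)) = form (- 1) x p"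
    by (simp_all add: sinh_arcosh_real)
  then show ?thesis
    by (simp add: hyp_attraction_def hyp_dist_def Let_def attraction_def lorentz_eq_form dim form_commute[of _ p x] divide_inverse mult_ac)
qed

lemma radial_projection_form:
  assumes "0 < form \<kappa> x x"
  shows "form \<kappa> (x /\<^sub>R sqrt (form \<kappa> x x)) (x /\<^sub>R sqrt (form \<kappa> x x)) = 1"
    and "form \<kappa> (x /\<^sub>R sqrt (form \<kappa> x x)) c = form \<kappa> x c / sqrt (form \<kappa> x x)"
proof -
  define r where "r = sqrt (form \<kappa> x x)"
  have r: "0 < r" "form \<kappa> x x = r * r" using assms by (simp_all add: r_def)
  show "form \<kappa> (x /\<^sub>R sqrt (form \<kappa> x x)) (x /\<^sub>R sqrt (form \<kappa> x x)) = 1"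
    unfolding r_def[symmetric] using r by (simp add: form_simps field_simps)
  show "form \<kappa> (x /\<^sub>R sqrt (form \<kappa> x x)) c = form \<kappa> x c / sqrt (form \<kappa> x x)"
    by (simp add: form_simps divide_inverse mult.commute)
qed

text \<open>Since \<open>arccos\<close> is decreasing, the outer radius \<open>r2\<close> yields the
  lower bound \<open>cos r2\<close>. At the origin both sides are false.\<close>

lemma sph_cone_iff:
  assumes c: "c \<in> sphere 0 1" and r: "0 < r1" "r1 < r2" "r2 < pi / 2"
  shows "x \<in> {X. 0 < norm X \<and> norm X \<le> 1} \<and>
      x /\<^sub>R norm x \<in> {x \<in> sphere 0 1. r1 \<le> sph_dist x c \<and> sph_dist x c \<le> r2} \<longleftrightarrow>
    in_cone 1 (cos r2) (cos r1) c x"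
proof (cases "x = 0")
  case False
  define z where "z = x /\<^sub>R norm x"
  have nx: "norm x = sqrt (form 1 x x)" by (simp add: form_one norm_eq_sqrt_inner)
  have pos: "0 < form 1 x x" using False by (simp add: form_one)
  have z: "z \<in> sphere 0 1" using False by (simp add: z_def)
  have t: "\<bar>z \<bullet> c\<bar> \<le> 1" using abs_inner_sphere_le[OF z c] .
  have zc: "z \<bullet> c = form 1 x c / sqrt (form 1 x x)"
    using radial_projection_form(2)[OF pos, of c] by (simp add: z_def nx form_one)
  have "r1 \<le> arccos (z \<bullet> c) \<longleftrightarrow> z \<bullet> c \<le> cos r1"
    using arccos_le_mono[of "cos r1" "z \<bullet> c"] t r by (simp add: arccos_cos)
  moreover have "arccos (z \<bullet> c) \<le> r2 \<longleftrightarrow> cos r2 \<le> z \<bullet> c"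
    using arccos_le_mono[of "z \<bullet> c" "cos r2"] t r by (simp add: arccos_cos)
  moreover have "norm x \<le> 1 \<longleftrightarrow> form 1 x x \<le> 1" by (simp add: nx)
  ultimately show ?thesis
    using False z pos unfolding z_def[symmetric]
    by (auto simp: in_cone_def sph_dist_def zc pos_le_divide_eq pos_divide_le_eq)
qed (simp add: in_cone_def form_def)

text \<open>Reduction to two dimensions: replacing \<open>fst x\<close> by its norm and
  \<open>fst c\<close> by the negative of its norm can only increase the product, by
  Cauchy-Schwarz.\<close>

lemma snd_pos_of_form_pos:
  assumes "unit_point (- 1) c" "0 < form (- 1) x x" "0 < form (- 1) x c"
  shows "0 < snd x"
proof (rule snd_pos_of_timelike)
  show "0 < form (- 1) (norm (fst x), snd x) (norm (fst x), snd x)"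
    using assms(2) by (simp add: form_def norm_eq_sqrt_inner)
  have "- (norm (fst x) * norm (fst c)) \<le> fst x \<bullet> fst c"
    using Cauchy_Schwarz_ineq2[of "fst x" "fst c"] by linarith
  then show "0 < form (- 1) (norm (fst x), snd x) (- norm (fst c), snd c)"
    using assms(3) by (simp add: form_def)
  show "\<bar>- norm (fst c)\<bar> < snd c" using norm_fst_less_snd[OF assms(1)] by simp
qed

text \<open>The cone condition does not mention the sheet; it is determined by the product with
  \<open>c\<close>, whose lower bound \<open>cosh r1\<close> is positive.\<close>

lemma hyp_cone_iff:
  assumes c: "c \<in> hyp_space" and r: "0 < r1" "r1 < r2"
  shows "x \<in> {X. 0 < snd X \<and> 0 < - lorentz X X \<and> - lorentz X X \<le> 1} \<and>
      x /\<^sub>R sqrt (- lorentz x x) \<in> {x \<in> hyp_space. r1 \<le> hyp_dist x c \<and> hyp_dist x c \<le> r2} \<longleftrightarrow>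
    in_cone (- 1) (cosh r1) (cosh r2) c x"
proof (cases "0 < form (- 1) x x \<and> 0 < snd x")
  case True
  define z where "z = x /\<^sub>R sqrt (form (- 1) x x)"
  have up: "unit_point (- 1) c" using c by (simp add: unit_point_hyp_space)
  have z: "unit_point (- 1) z"
    using radial_projection_form(1)[of "- 1" x] True by (simp add: unit_point_def flip: z_def) (simp add: z_def)
  have t: "1 \<le> form (- 1) z c" using form_unit_pos[OF refl up z] .
  have zc: "form (- 1) z c = form (- 1) x c / sqrt (form (- 1) x x)"
    using radial_projection_form(2)[of "- 1" x c] True by (simp add: z_def)
  have "r1 \<le> arcosh (form (- 1) z c) \<longleftrightarrow> cosh r1 \<le> form (- 1) z c"
    using cosh_real_nonneg_le_iff[of r1 "arcosh (form (- 1) z c)"] t r by simp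
  moreover have "arcosh (form (- 1) z c) \<le> r2 \<longleftrightarrow> form (- 1) z c \<le> cosh r2"
    using cosh_real_nonneg_le_iff[of "arcosh (form (- 1) z c)" r2] t r by simp
  ultimately show ?thesis
    using True z
    by (auto simp: in_cone_def hyp_dist_def lorentz_eq_form zc pos_le_divide_eq pos_divide_le_eq
        unit_point_hyp_space simp flip: z_def)
next
  case False
  have "0 < cosh r1" by simp
  then have "in_cone (- 1) (cosh r1) (cosh r2) c x \<Longrightarrow> 0 < form (- 1) x c"
    unfolding in_cone_def by (meson less_le_trans mult_pos_pos real_sqrt_gt_zero)
  then have "\<not> in_cone (- 1) (cosh r1) (cosh r2) c x"
    using False snd_pos_of_form_pos[of c x] c by (auto simp: unit_point_hyp_space in_cone_def)
  then show ?thesis using False by (auto simp: lorentz_eq_form)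
qed

text \<open>Both \<open>form \<kappa> x p\<close> and \<open>p\<close> change sign. This reduces the
  region near the antipode of the center to the region near the center.\<close>

lemma attraction_antipode: "attraction \<kappa> m (- p) x = attraction \<kappa> m p x"
  by (simp add: attraction_def form_simps)

text \<open>The bounds of the cone are \<open>k1 = cos r2\<close> and \<open>k2 = cos r1\<close>.
  The antipodal region is treated by taking \<open>- p\<close> for the point in
  \<open>shell_theorem\<close>, while between the shell and its antipode the product of
  \<open>p\<close> and \<open>c\<close> is less than \<open>cos r2\<close> in absolute
  value.\<close>

lemma sph_shell_field:
  fixes c p :: "'a::euclidean_space \<times> real"
  assumes dim: "DIM('a) = m + 2" and \<rho>: "0 \<le> \<rho>" and r: "0 < r1" "r1 < r2" "r2 < pi / 2"
    and c: "c \<in> sphere 0 1" and p: "p \<in> sphere 0 1"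
  shows "sph_dist p c < r1 \<or> sph_dist p (- c) < r1 \<Longrightarrow>
      integrable (sph_shell \<rho> r1 r2 c) (sph_attraction p) \<and> sph_field (sph_shell \<rho> r1 r2 c) p = 0"
      (is "?inside \<Longrightarrow> _")
    and "r2 < sph_dist p c \<Longrightarrow> sph_dist p c < pi - r2 \<Longrightarrow>
      integrable (sph_shell \<rho> r1 r2 c) (sph_attraction p) \<and>
      sph_field (sph_shell \<rho> r1 r2 c) p = measure (sph_shell \<rho> r1 r2 c) UNIV *\<^sub>R sph_attraction p c"
      (is "?out1 \<Longrightarrow> ?out2 \<Longrightarrow> _")
proof -
  have k: "0 < cos r2" "cos r2 < cos r1" "cos r2 < 1"
    using r cos_monotone_0_pi[of r1 r2] cos_monotone_0_pi[of 0 r2] by (auto intro: cos_gt_zero_pi)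
  have nx: "norm x = sqrt (form 1 x x)" for x :: "'a \<times> real" by (simp add: form_one norm_eq_sqrt_inner)
  have A: "{x \<in> sphere (0 :: 'a \<times> real) 1. r1 \<le> sph_dist x c \<and> sph_dist x c \<le> r2} \<in> sets borel"
    unfolding sph_dist_def by measurable
  have D: "{X :: 'a \<times> real. 0 < norm X \<and> norm X \<le> 1} \<in> sets borel" by measurable
  have on_sphere: "x /\<^sub>R norm x \<in> sphere 0 1" if "in_cone 1 (cos r2) (cos r1) c x" for x
  proof -
    have "x \<noteq> 0" using that by (auto simp: in_cone_def form_def)
    then show ?thesis by simp
  qed
  have F: "sph_attraction p (x /\<^sub>R norm x) = attraction 1 m p (x /\<^sub>R norm x)" if "in_cone 1 (cos r2) (cos r1) c x" for x
    by (rule sph_attraction_eq_attraction[OF dim p on_sphere[OF that]])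
  have Fc: "sph_attraction p c = attraction 1 m p c"
    by (rule sph_attraction_eq_attraction[OF dim p c])
  have F': "sph_attraction p (x /\<^sub>R norm x) = attraction 1 m (- p) (x /\<^sub>R norm x)" if "in_cone 1 (cos r2) (cos r1) c x" for x
    unfolding attraction_antipode by (rule F[OF that])
  have Fc': "sph_attraction p c = attraction 1 m (- p) c"
    unfolding attraction_antipode by (rule Fc)
  have up: "unit_point 1 p" "unit_point 1 (- p)" "unit_point 1 c"
    using p c by (simp_all add: unit_point_sphere)
  have shell: "sph_shell \<rho> r1 r2 c = density (distr (density lborel
      (\<lambda>X. ennreal (real (DIM('a) + 1)) * indicator {X. 0 < norm X \<and> norm X \<le> 1} X)) borel (\<lambda>X. X /\<^sub>R norm X))
      (\<lambda>x. ennreal \<rho> * indicator {x \<in> sphere 0 1. r1 \<le> sph_dist x c \<and> sph_dist x c \<le> r2} x)"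
    by (simp only: sph_shell_def sph_volume_def)
  note field = shell_theorem[where D = "{X. 0 < norm X \<and> norm X \<le> 1}" and pr = "\<lambda>X. X /\<^sub>R norm X"
      and A = "{x \<in> sphere 0 1. r1 \<le> sph_dist x c \<and> sph_dist x c \<le> r2}" and F = "sph_attraction p", OF dim _ up(1,3) k(1,2) D A _ _ _ \<rho> shell sph_cone_iff[OF c r] _ F Fc]
  note antipodal_field = shell_theorem[where D = "{X. 0 < norm X \<and> norm X \<le> 1}" and pr = "\<lambda>X. X /\<^sub>R norm X"
      and A = "{x \<in> sphere 0 1. r1 \<le> sph_dist x c \<and> sph_dist x c \<le> r2}" and F = "sph_attraction p", OF dim _ up(2,3) k(1,2) D A _ _ _ \<rho> shell sph_cone_iff[OF c r] _
      F' Fc']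
  have t: "\<bar>p \<bullet> c\<bar> \<le> 1" by (rule abs_inner_sphere_le[OF p c])
  show "integrable (sph_shell \<rho> r1 r2 c) (sph_attraction p) \<and> sph_field (sph_shell \<rho> r1 r2 c) p = 0" if ?inside
  proof -
    have cos_less: "cos r1 < u" if "arccos u < r1" "\<bar>u\<bar> \<le> 1" for u
      using cos_monotone_0_pi[of "arccos u" r1] that r arccos_lbound[of u] by auto
    from that show ?thesis
    proof
      assume "sph_dist p c < r1"
      then have "cos r1 < form 1 c p"
        using cos_less[of "p \<bullet> c"] t by (simp add: sph_dist_def form_one inner_commute)
      then show ?thesis unfolding sph_field_def by (intro field(1)) (simp_all add: nx)
    next
      assume "sph_dist p (- c) < r1"
      then have "cos r1 < form 1 c (- p)"
        using cos_less[of "- (p \<bullet> c)"] t by (simp add: sph_dist_def form_one inner_commute)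
      then show ?thesis unfolding sph_field_def by (intro antipodal_field(1)) (simp_all add: nx)
    qed
  qed
  show "integrable (sph_shell \<rho> r1 r2 c) (sph_attraction p) \<and>
      sph_field (sph_shell \<rho> r1 r2 c) p = measure (sph_shell \<rho> r1 r2 c) UNIV *\<^sub>R sph_attraction p c" if ?out1 ?out2
  proof -
    have "p \<bullet> c < cos r2"
      using cos_monotone_0_pi[of r2 "arccos (p \<bullet> c)"] that t r arccos_ubound[of "p \<bullet> c"] by (auto simp: sph_dist_def)
    moreover have "cos (pi - r2) < p \<bullet> c"
      using cos_monotone_0_pi[of "arccos (p \<bullet> c)" "pi - r2"] that t r arccos_lbound[of "p \<bullet> c"] by (auto simp: sph_dist_def)
    ultimately have "\<bar>form 1 c p\<bar> < cos r2" by (simp add: form_one inner_commute)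
    then show ?thesis unfolding sph_field_def using k(3) by (intro field(2)) (simp_all add: nx)
  qed
qed

lemma hyp_shell_field:
  fixes c p :: "'a::euclidean_space \<times> real"
  assumes dim: "DIM('a) = m + 2" and \<rho>: "0 \<le> \<rho>" and r: "0 < r1" "r1 < r2"
    and c: "c \<in> hyp_space" and p: "p \<in> hyp_space"
  shows "hyp_dist p c < r1 \<Longrightarrow>
      integrable (hyp_shell \<rho> r1 r2 c) (hyp_attraction p) \<and> hyp_field (hyp_shell \<rho> r1 r2 c) p = 0"
    and "r2 < hyp_dist p c \<Longrightarrow>
      integrable (hyp_shell \<rho> r1 r2 c) (hyp_attraction p) \<and>
      hyp_field (hyp_shell \<rho> r1 r2 c) p = measure (hyp_shell \<rho> r1 r2 c) UNIV *\<^sub>R hyp_attraction p c"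
proof -
  have k: "0 < cosh r1" "cosh r1 < cosh r2" "1 < cosh r2"
    using r cosh_real_strict_mono[of r1 r2] cosh_real_strict_mono[of 0 r2] by auto
  have [measurable]: "Measurable.pred borel (\<lambda>x :: 'a \<times> real. 0 < snd x)"
    unfolding pred_def by (intro borel_open) (auto intro!: open_Collect_less continuous_intros)
  have "{x \<in> hyp_space. r1 \<le> hyp_dist x c \<and> hyp_dist x c \<le> r2} =
      {x. lorentz x x = - 1 \<and> 0 < snd x \<and> r1 \<le> arcosh (- lorentz x c) \<and> arcosh (- lorentz x c) \<le> r2}"
    by (auto simp: hyp_dist_def hyp_space_def)
  also have "\<dots> \<in> sets borel" by measurable
  finally have A: "{x \<in> hyp_space. r1 \<le> hyp_dist x c \<and> hyp_dist x c \<le> r2} \<in> sets borel" .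
  have D: "{X :: 'a \<times> real. 0 < snd X \<and> 0 < - lorentz X X \<and> - lorentz X X \<le> 1} \<in> sets borel"
    by measurable
  have up: "unit_point (- 1) p" "unit_point (- 1) c"
    using p c by (simp_all add: unit_point_hyp_space)
  have on_space: "x /\<^sub>R sqrt (- lorentz x x) \<in> hyp_space" if "in_cone (- 1) (cosh r1) (cosh r2) c x" for x
    using that hyp_cone_iff[OF c r, of x] by blast
  have F: "hyp_attraction p (x /\<^sub>R sqrt (- lorentz x x)) = attraction (- 1) m p (x /\<^sub>R sqrt (- lorentz x x))"
    if "in_cone (- 1) (cosh r1) (cosh r2) c x" for x
    by (rule hyp_attraction_eq_attraction[OF dim p on_space[OF that]])
  have Fc: "hyp_attraction p c = attraction (- 1) m p c"
    by (rule hyp_attraction_eq_attraction[OF dim p c])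
  have shell: "hyp_shell \<rho> r1 r2 c = density (distr (density lborel
      (\<lambda>X. ennreal (real (DIM('a) + 1)) * indicator {X. 0 < snd X \<and> 0 < - lorentz X X \<and> - lorentz X X \<le> 1} X))
      borel (\<lambda>X. X /\<^sub>R sqrt (- lorentz X X)))
      (\<lambda>x. ennreal \<rho> * indicator {x \<in> hyp_space. r1 \<le> hyp_dist x c \<and> hyp_dist x c \<le> r2} x)"
    by (simp only: hyp_shell_def hyp_volume_def)
  note field = shell_theorem[where D = "{X. 0 < snd X \<and> 0 < - lorentz X X \<and> - lorentz X X \<le> 1}"
      and pr = "\<lambda>X. X /\<^sub>R sqrt (- lorentz X X)"
      and A = "{x \<in> hyp_space. r1 \<le> hyp_dist x c \<and> hyp_dist x c \<le> r2}" and F = "hyp_attraction p", OF dim _ up k(1,2) D A _ _ _ \<rho> shell hyp_cone_iff[OF c r] _ F Fc]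
  have t: "1 \<le> form (- 1) c p" by (rule form_unit_pos[OF refl up])
  have dist: "hyp_dist p c = arcosh (form (- 1) c p)"
    by (simp add: hyp_dist_def lorentz_eq_form form_commute)
  show "integrable (hyp_shell \<rho> r1 r2 c) (hyp_attraction p) \<and> hyp_field (hyp_shell \<rho> r1 r2 c) p = 0"
    if "hyp_dist p c < r1"
  proof -
    have "form (- 1) c p < cosh r1"
      using cosh_real_nonneg_less_iff[of "arcosh (form (- 1) c p)" r1] that r t by (simp add: dist)
    then show ?thesis unfolding hyp_field_def by (intro field(1)) (simp_all add: lorentz_eq_form)
  qed
  show "integrable (hyp_shell \<rho> r1 r2 c) (hyp_attraction p) \<and>
      hyp_field (hyp_shell \<rho> r1 r2 c) p = measure (hyp_shell \<rho> r1 r2 c) UNIV *\<^sub>R hyp_attraction p c"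
    if "r2 < hyp_dist p c"
  proof -
    have "cosh r2 < form (- 1) c p"
      using cosh_real_nonneg_less_iff[of r2 "arcosh (form (- 1) c p)"] that r t by (simp add: dist)
    then show ?thesis unfolding hyp_field_def using k(3) by (intro field(2)) (simp_all add: lorentz_eq_form)
  qed
qed

theorem theorem12:
  fixes \<rho> r1 r2 :: real
  assumes "2 \<le> DIM('a::euclidean_space)"
    and "0 \<le> \<rho>" and "0 < r1" and "r1 < r2"
  shows
    "(\<forall>c \<in> (hyp_space :: ('a \<times> real) set). \<forall>p \<in> hyp_space.
        (hyp_dist p c < r1 \<longrightarrow>
           integrable (hyp_shell \<rho> r1 r2 c) (hyp_attraction p) \<and>
           hyp_field (hyp_shell \<rho> r1 r2 c) p = 0) \<and>
        (r2 < hyp_dist p c \<longrightarrow>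
           integrable (hyp_shell \<rho> r1 r2 c) (hyp_attraction p) \<and>
           hyp_field (hyp_shell \<rho> r1 r2 c) p =
             measure (hyp_shell \<rho> r1 r2 c) UNIV *\<^sub>R hyp_attraction p c))
     \<and>
     (r2 < pi / 2 \<longrightarrow>
      (\<forall>c \<in> sphere (0 :: 'a \<times> real) 1. \<forall>p \<in> sphere 0 1.
        (sph_dist p c < r1 \<or> sph_dist p (- c) < r1 \<longrightarrow>
           integrable (sph_shell \<rho> r1 r2 c) (sph_attraction p) \<and>
           sph_field (sph_shell \<rho> r1 r2 c) p = 0) \<and>
        (r2 < sph_dist p c \<and> sph_dist p c < pi - r2 \<longrightarrow>
           integrable (sph_shell \<rho> r1 r2 c) (sph_attraction p) \<and>
           sph_field (sph_shell \<rho> r1 r2 c) p =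
             measure (sph_shell \<rho> r1 r2 c) UNIV *\<^sub>R sph_attraction p c)))"
proof -
  \<comment> \<open>Writing the dimension as \<open>m + 2\<close> makes all exponents additive and
    avoids subtraction of natural numbers.\<close>
  obtain m where dim: "DIM('a) = m + 2" using assms(1) by (metis add.commute le_Suc_ex)
  show ?thesis
    using hyp_shell_field[OF dim assms(2-4)] sph_shell_field[OF dim assms(2-4)] by blast
qed

end
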